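(* An effectful category is a pseudomonoid in the monoidal 2-category of promonads, promonad homomorphisms and promonad modifications, with the pure tensor $\ast$ of promonads as tensor product. That is, under the identification of a promonad over $\mathbb V$ with the identity-on-objects functor $\mathbb V\to\mathbb C$ into its Kleisli category, a pseudomonoid structure on $\mathbb V\to\mathbb C$ in this monoidal 2-category is the same thing as the structure (monoidal structure on $\mathbb V$ and premonoidal structure on $\mathbb C$) of an effectful category on $\mathbb V\to\mathbb C$. Furthermore, a pseudomonoid homomorphism between effectful categories is the same thing as an effectful functor. As a consequence, premonoidal categories with their centre are pseudomonoids: for every premonoidal category $\mathbb C$ with centre $\mathcal Z(\mathbb C)$, the inclusion $\mathcal Z(\mathbb C)\to\mathbb C$ is a pseudomonoid in this monoidal 2-category.
   Context: Composition in categories is written diagrammatically: $f;g$ is first $f$, then $g$. **Premonoidal and effectful categories.** A *binoidal category* is a category $\mathbb C$ with an object $I$, an object $A\otimes B$ for each pair of objects, and functors $(A\otimes\bullet),(\bullet\otimes B)\colon\mathbb C\to\mathbb C$ with value $A\otimes B$ on objects (no joint functoriality). A morphism $f\colon A\to B$ is *central* if for every $g\colon A'\to B'$ both $(f\otimes A');(B\otimes g)=(A\otimes g);(f\otimes B')$ and $(A'\otimes f);(g\otimes B)=(g\otimes A);(B'\otimes f)$. The *centre* $\mathcal Z(\mathbb C)$ is the wide subcategory of central morphisms. A *premonoidal category* is a binoidal category with central isomorphisms $\alpha_{A,B,C}$ between $A\otimes(B\otimes C)$ and $(A\otimes B)\otimes C$ (the chosen direction is immaterial), $\rho_A\colon A\otimes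 I\to A$, $\lambda_A\colon I\otimes A\to A$, natural separately in each variable and satisfying the pentagon and triangle equations. An *effectful category* is an identity-on-objects functor $\mathbb V\to\mathbb C$ from a monoidal category $\mathbb V$ to a premonoidal category $\mathbb C$ that strictly preserves all the premonoidal structure and whose image is central. An *effectful functor* from $\mathbb V\to\mathbb C$ to $\mathbb W\to\mathbb D$ is $(F,F_0,\varepsilon,\mu)$ with functors $F\colon\mathbb C\to\mathbb D$, $F_0\colon\mathbb V\to\mathbb W$ making the square with the identity-on-objects functors commute, and isomorphisms $\varepsilon\colon J\cong F(I)$ (where $J$ is the unit of $\mathbb W$), $\mu\colon F(A\otimes B)\cong F(A)\otimes F(B)$ that are natural (in each variable) and pure (come from $\mathbb W$), making $F_0$ a (strong) monoidal functor. **Promonads.** A promonad over a category $\mathbb V$ is a profunctor $P\colon\mathbb V^{op}\times\mathbb V\to\mathbf{Set}$, with left and right actions $f>p$ and $p<g$, together with natural transformations $(\bullet)^\circ\colon\mathbb V(X,Y)\to P(X,Y)$ (unit) and $\star\colon P(X,Y)\times P(Y,Z)\to P(X,Z)$ (multiplication) such that $f^\circ\star p=f>p$, $p\star f^\circ=p<f$, $p\star(f>q)=(p<f)\star q$ and $\star$ is associative. Its *Kleisli category* has the objects of $\mathbb V$, hom-sets $P(X,Y)$, composition $\star$ and identities $\mathrm{id}^\circ$; the unit gives an identity-on-objects functor from $\mathbb V$ to it. Conversely an identity-on-objects functor $i\colon\mathbb V\to\mathbb C$ yields the promonad $\hom_{\mathbb C}(i(\bullet),i(\bullet))$ with this Kleisli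 category; the two notions are identified, and the promonad is denoted by $\mathbb V\to\mathbb C$ or simply $\mathbb C$. A *promonad homomorphism* from $\mathbb V\to\mathbb C$ to $\mathbb W\to\mathbb D$ is a functor $F_0\colon\mathbb V\to\mathbb W$ together with a natural family $F_{X,Y}\colon\mathbb C(X,Y)\to\mathbb D(F_0X,F_0Y)$ with $F(p_1\star p_2)=F(p_1)\star F(p_2)$ and $F(f^\circ)=F_0(f)^\circ$. A *promonad modification* $(F_0,F)\Rightarrow(G_0,G)$ is a natural transformation $\alpha\colon F_0\Rightarrow G_0$ with $\alpha_X>G(p)=F(p)<\alpha_Y$ for each $p\in\mathbb C(X,Y)$. **Pure tensor.** For promonads $\mathbb V\to\mathbb C$ and $\mathbb W\to\mathbb D$, the pure tensor $\mathbb C\ast\mathbb D$ is the promonad over $\mathbb V\times\mathbb W$ whose Kleisli category is presented as follows. Objects: pairs $(X,Y)$ of an object of $\mathbb V$ and an object of $\mathbb W$. Generating morphisms: $f_{\mathbb C}\colon(X,Y)\to(X',Y)$ for $f\in\mathbb C(X,X')$ and each $Y$; $g_{\mathbb D}\colon(X,Y)\to(X,Y')$ for $g\in\mathbb D(Y,Y')$ and each $X$; $v_{\mathbb V}\colon(X,Y)\to(X',Y)$ for $v\in\mathbb V(X,X')$ and each $Y$; $w_{\mathbb W}\colon(X,Y)\to(X,Y')$ for $w\in\mathbb W(Y,Y')$ and each $X$. Relations: $f_{\mathbb C};w_{\mathbb W}=w_{\mathbb W};f_{\mathbb C}$ and $g_{\mathbb D};v_{\mathbb V}=v_{\mathbb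 V};g_{\mathbb D}$; $f_{\mathbb C};f'_{\mathbb C}=(f\star f')_{\mathbb C}$, $\mathrm{id}_{\mathbb C}=\mathrm{id}$; $g_{\mathbb D};g'_{\mathbb D}=(g\star g')_{\mathbb D}$, $\mathrm{id}_{\mathbb D}=\mathrm{id}$; $v_{\mathbb V}=(v^\circ)_{\mathbb C}$ and $w_{\mathbb W}=(w^\circ)_{\mathbb D}$. (In general $f_{\mathbb C}$ and $g_{\mathbb D}$ do not interchange.) The unit sends $(v,w)$ to $v_{\mathbb V};w_{\mathbb W}$. On homomorphisms, $F\ast G$ has underlying functor $F_0\times G_0$ and sends $f_{\mathbb C}\mapsto F(f)_{\mathbb C'}$, $g_{\mathbb D}\mapsto G(g)_{\mathbb D'}$; on modifications, $\alpha\ast\beta$ has components $(\alpha_X,\beta_Y)$. The tensor unit is the promonad $1\to1$ on the terminal category. Promonads, promonad homomorphisms and promonad modifications form a monoidal 2-category with $\ast$, strict up to the canonical isomorphisms $(\mathbb C\ast\mathbb D)\ast\mathbb E\cong\mathbb C\ast(\mathbb D\ast\mathbb E)$ and $1\ast\mathbb C\cong\mathbb C\cong\mathbb C\ast1$, which are suppressed below. **Pseudomonoids.** In a monoidal 2-category with tensor $\boxtimes$ and unit $\mathbf 1$, a *pseudomonoid* is a 0-cell $M$ with 1-cells $m\colon M\boxtimes M\to M$, $u\colon\mathbf 1\to M$ and invertible 2-cells $\alpha\colon m\circ(m\boxtimes1)\Rightarrow m\circ(1\boxtimes m)$, $\lambda\colon m\circ(u\boxtimes1)\Rightarrow1$,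 $\rho\colon m\circ(1\boxtimes u)\Rightarrow1$ satisfying: (pentagon) the composite $m\circ(\alpha\boxtimes1)$, then $\alpha\circ(1\boxtimes m\boxtimes1)$, then $m\circ(1\boxtimes\alpha)$ equals the composite $\alpha\circ(m\boxtimes1\boxtimes1)$, then $\alpha\circ(1\boxtimes1\boxtimes m)$, as 2-cells $m\circ(m\boxtimes1)\circ(m\boxtimes1\boxtimes1)\Rightarrow m\circ(1\boxtimes m)\circ(1\boxtimes1\boxtimes m)$; (triangle) $\alpha\circ(1\boxtimes u\boxtimes1)$ followed by $m\circ(1\boxtimes\lambda)$ equals $m\circ(\rho\boxtimes1)$. A *homomorphism of pseudomonoids* $(M,m,u)\to(N,n,w)$ is a 1-cell $F\colon M\to N$ with invertible 2-cells $\mu\colon F\circ m\Rightarrow n\circ(F\boxtimes F)$ and $\varepsilon\colon w\Rightarrow F\circ u$ satisfying the usual compatibility equations with $\alpha,\lambda,\rho$ (the same form as the coherence equations of a strong monoidal functor). *)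

theory Defs
  imports "HOL-Library.FuncSet"
begin

section \<open>Categories and functors\<close>

text \<open>
  The objects of a category are the elements of a type; its arrows form a subset of a type.
  Composition is diagrammatic. Functions on arrows that are part of a structure are
  \<^const>\<open>extensional\<close> (\<^const>\<open>undefined\<close> outside the arrows), so that HOL
  equality of such data is equality of the structures.
\<close>

record ('o, 'a) cat =
  Arr :: "'a set"
  Dom :: "'a \<Rightarrow> 'o"
  Cod :: "'a \<Rightarrow> 'o"
  Idn :: "'o \<Rightarrow> 'a"
  Comp :: "'a \<Rightarrow> 'a \<Rightarrow> 'a" (infixl "\<Zcomp>\<index>" 70)

definition Hom :: "('o, 'a) cat \<Rightarrow> 'o \<Rightarrow> 'o \<Rightarrow> 'a set" where
  "Hom C X Y = {f \<in> Arr C. Dom C f = X \<and> Cod C f = Y}"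

locale category =
  fixes C :: "('o, 'a) cat" (structure)
  assumes Idn_Hom: "Idn C X \<in> Hom C X X"
    and Comp_Hom: "\<lbrakk>f \<in> Hom C X Y; g \<in> Hom C Y Z\<rbrakk> \<Longrightarrow> f \<Zcomp> g \<in> Hom C X Z"
    and Idn_Comp: "f \<in> Hom C X Y \<Longrightarrow> Idn C X \<Zcomp> f = f"
    and Comp_Idn: "f \<in> Hom C X Y \<Longrightarrow> f \<Zcomp> Idn C Y = f"
    and Comp_assoc: "\<lbrakk>f \<in> Hom C W X; g \<in> Hom C X Y; h \<in> Hom C Y Z\<rbrakk>
      \<Longrightarrow> (f \<Zcomp> g) \<Zcomp> h = f \<Zcomp> (g \<Zcomp> h)"

definition inverse_arrows :: "('o, 'a) cat \<Rightarrow> 'a \<Rightarrow> 'a \<Rightarrow> bool" where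
  "inverse_arrows C f g \<longleftrightarrow> f \<in> Arr C \<and> g \<in> Hom C (Cod C f) (Dom C f) \<and>
     f \<Zcomp>\<^bsub>C\<^esub> g = Idn C (Dom C f) \<and> g \<Zcomp>\<^bsub>C\<^esub> f = Idn C (Cod C f)"

definition iso_arrow :: "('o, 'a) cat \<Rightarrow> 'a \<Rightarrow> bool" where
  "iso_arrow C f \<longleftrightarrow> (\<exists>g. inverse_arrows C f g)"

definition inv_arrow :: "('o, 'a) cat \<Rightarrow> 'a \<Rightarrow> 'a" where
  "inv_arrow C f = (THE g. inverse_arrows C f g)"

definition prod_cat :: "('o, 'a) cat \<Rightarrow> ('p, 'b) cat \<Rightarrow> ('o \<times> 'p, 'a \<times> 'b) cat" where
  "prod_cat C D = \<lparr>
     Arr = Arr C \<times> Arr D,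
     Dom = (\<lambda>(f, g). (Dom C f, Dom D g)),
     Cod = (\<lambda>(f, g). (Cod C f, Cod D g)),
     Idn = (\<lambda>(X, Y). (Idn C X, Idn D Y)),
     Comp = (\<lambda>(f, g) (f', g'). (f \<Zcomp>\<^bsub>C\<^esub> f', g \<Zcomp>\<^bsub>D\<^esub> g'))\<rparr>"

definition terminal_cat :: "(unit, unit) cat" where
  "terminal_cat = \<lparr>Arr = UNIV, Dom = (\<lambda>_. ()), Cod = (\<lambda>_. ()), Idn = (\<lambda>_. ()), Comp = (\<lambda>_ _. ())\<rparr>"

record ('o, 'a, 'p, 'b) fctr =
  FO :: "'o \<Rightarrow> 'p"
  FA :: "'a \<Rightarrow> 'b"

definition is_functor :: "('o, 'a) cat \<Rightarrow> ('p, 'b) cat \<Rightarrow> ('o, 'a, 'p, 'b) fctr \<Rightarrow> bool" where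
  "is_functor C D F \<longleftrightarrow> category C \<and> category D \<and>
     FA F \<in> extensional (Arr C) \<and>
     (\<forall>X Y. \<forall>f\<in>Hom C X Y. FA F f \<in> Hom D (FO F X) (FO F Y)) \<and>
     (\<forall>X. FA F (Idn C X) = Idn D (FO F X)) \<and>
     (\<forall>X Y Z. \<forall>f\<in>Hom C X Y. \<forall>g\<in>Hom C Y Z. FA F (f \<Zcomp>\<^bsub>C\<^esub> g) = FA F f \<Zcomp>\<^bsub>D\<^esub> FA F g)"

definition nat_trans :: "('o, 'a) cat \<Rightarrow> ('p, 'b) cat \<Rightarrow> ('o, 'a, 'p, 'b) fctr
    \<Rightarrow> ('o, 'a, 'p, 'b) fctr \<Rightarrow> ('o \<Rightarrow> 'b) \<Rightarrow> bool" where
  "nat_trans C D F G \<tau> \<longleftrightarrow> is_functor C D F \<and> is_functor C D G \<and>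
     (\<forall>X. \<tau> X \<in> Hom D (FO F X) (FO G X)) \<and>
     (\<forall>X Y. \<forall>f\<in>Hom C X Y. FA F f \<Zcomp>\<^bsub>D\<^esub> \<tau> Y = \<tau> X \<Zcomp>\<^bsub>D\<^esub> FA G f)"


section \<open>Monoidal, premonoidal and effectful categories\<close>

record ('o, 'v) mon_str =
  mT :: "('o \<times> 'o, 'v \<times> 'v, 'o, 'v) fctr"
  mI :: 'o
  mA :: "'o \<Rightarrow> 'o \<Rightarrow> 'o \<Rightarrow> 'v"
  mL :: "'o \<Rightarrow> 'v"
  mR :: "'o \<Rightarrow> 'v"

locale monoidal_data =
  fixes V :: "('o, 'v) cat" (structure) and M :: "('o, 'v) mon_str"
begin

abbreviation tO (infixr "\<otimes>\<^sub>o" 75) where "A \<otimes>\<^sub>o B \<equiv> FO (mT M) (A, B)"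
abbreviation tA (infixr "\<otimes>\<^sub>a" 75) where "f \<otimes>\<^sub>a g \<equiv> FA (mT M) (f, g)"

end

locale monoidal = monoidal_data +
  assumes tensor_functor: "is_functor (prod_cat V V) V (mT M)"
    and assoc_Hom: "mA M A B C \<in> Hom V ((A \<otimes>\<^sub>o B) \<otimes>\<^sub>o C) (A \<otimes>\<^sub>o (B \<otimes>\<^sub>o C))"
    and assoc_iso: "iso_arrow V (mA M A B C)"
    and assoc_nat: "\<lbrakk>f \<in> Hom V A A'; g \<in> Hom V B B'; h \<in> Hom V C C'\<rbrakk> \<Longrightarrow>
      ((f \<otimes>\<^sub>a g) \<otimes>\<^sub>a h) \<Zcomp> mA M A' B' C' = mA M A B C \<Zcomp> (f \<otimes>\<^sub>a (g \<otimes>\<^sub>a h))"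
    and lunit_Hom: "mL M A \<in> Hom V (mI M \<otimes>\<^sub>o A) A"
    and lunit_iso: "iso_arrow V (mL M A)"
    and lunit_nat: "f \<in> Hom V A A' \<Longrightarrow> (Idn V (mI M) \<otimes>\<^sub>a f) \<Zcomp> mL M A' = mL M A \<Zcomp> f"
    and runit_Hom: "mR M A \<in> Hom V (A \<otimes>\<^sub>o mI M) A"
    and runit_iso: "iso_arrow V (mR M A)"
    and runit_nat: "f \<in> Hom V A A' \<Longrightarrow> (f \<otimes>\<^sub>a Idn V (mI M)) \<Zcomp> mR M A' = mR M A \<Zcomp> f"
    and pentagon: "(mA M A B C \<otimes>\<^sub>a Idn V D) \<Zcomp> mA M A (B \<otimes>\<^sub>o C) D \<Zcomp> (Idn V A \<otimes>\<^sub>a mA M B C D)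
      = mA M (A \<otimes>\<^sub>o B) C D \<Zcomp> mA M A B (C \<otimes>\<^sub>o D)"
    and triangle: "mA M A (mI M) B \<Zcomp> (Idn V A \<otimes>\<^sub>a mL M B) = mR M A \<otimes>\<^sub>a Idn V B"

text \<open>
  \<open>pL P A f\<close> is $A\otimes f$ and \<open>pR P B f\<close> is $f\otimes B$.
\<close>

record ('o, 'c) pre_str =
  pO :: "'o \<Rightarrow> 'o \<Rightarrow> 'o"
  pL :: "'o \<Rightarrow> 'c \<Rightarrow> 'c"
  pR :: "'o \<Rightarrow> 'c \<Rightarrow> 'c"
  pI :: 'o
  pA :: "'o \<Rightarrow> 'o \<Rightarrow> 'o \<Rightarrow> 'c"
  pLam :: "'o \<Rightarrow> 'c"
  pRho :: "'o \<Rightarrow> 'c"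

locale premonoidal_data =
  fixes C :: "('o, 'c) cat" (structure) and P :: "('o, 'c) pre_str"
begin

abbreviation pto (infixr "\<odot>" 75) where "X \<odot> Y \<equiv> pO P X Y"
abbreviation ptl (infixr "\<ltimes>" 75) where "X \<ltimes> f \<equiv> pL P X f"
abbreviation ptr (infixl "\<rtimes>" 75) where "f \<rtimes> Y \<equiv> pR P Y f"

definition central :: "'c \<Rightarrow> bool" where
  "central f \<longleftrightarrow> f \<in> Arr C \<and> (\<forall>g\<in>Arr C.
     (f \<rtimes> Dom C g) \<Zcomp> (Cod C f \<ltimes> g) = (Dom C f \<ltimes> g) \<Zcomp> (f \<rtimes> Cod C g) \<and>
     (Dom C g \<ltimes> f) \<Zcomp> (g \<rtimes> Cod C f) = (g \<rtimes> Dom C f) \<Zcomp> (Cod C g \<ltimes> f))"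

end

locale binoidal = premonoidal_data +
  assumes functor_L: "is_functor C C \<lparr>FO = (\<lambda>Y. X \<odot> Y), FA = (\<lambda>f. X \<ltimes> f)\<rparr>"
    and functor_R: "is_functor C C \<lparr>FO = (\<lambda>X. X \<odot> Y), FA = (\<lambda>f. f \<rtimes> Y)\<rparr>"

locale premonoidal = binoidal +
  assumes assoc_Hom: "pA P X Y Z \<in> Hom C ((X \<odot> Y) \<odot> Z) (X \<odot> (Y \<odot> Z))"
    and assoc_iso: "iso_arrow C (pA P X Y Z)"
    and assoc_central: "central (pA P X Y Z)"
    and assoc_nat1: "f \<in> Hom C X X' \<Longrightarrow>
      ((f \<rtimes> Y) \<rtimes> Z) \<Zcomp> pA P X' Y Z = pA P X Y Z \<Zcomp> (f \<rtimes> (Y \<odot> Z))"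
    and assoc_nat2: "f \<in> Hom C Y Y' \<Longrightarrow>
      ((X \<ltimes> f) \<rtimes> Z) \<Zcomp> pA P X Y' Z = pA P X Y Z \<Zcomp> (X \<ltimes> (f \<rtimes> Z))"
    and assoc_nat3: "f \<in> Hom C Z Z' \<Longrightarrow>
      ((X \<odot> Y) \<ltimes> f) \<Zcomp> pA P X Y Z' = pA P X Y Z \<Zcomp> (X \<ltimes> (Y \<ltimes> f))"
    and lunit_Hom: "pLam P X \<in> Hom C (pI P \<odot> X) X"
    and lunit_iso: "iso_arrow C (pLam P X)"
    and lunit_central: "central (pLam P X)"
    and lunit_nat: "f \<in> Hom C X X' \<Longrightarrow> (pI P \<ltimes> f) \<Zcomp> pLam P X' = pLam P X \<Zcomp> f"
    and runit_Hom: "pRho P X \<in> Hom C (X \<odot> pI P) X"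
    and runit_iso: "iso_arrow C (pRho P X)"
    and runit_central: "central (pRho P X)"
    and runit_nat: "f \<in> Hom C X X' \<Longrightarrow> (f \<rtimes> pI P) \<Zcomp> pRho P X' = pRho P X \<Zcomp> f"
    and pentagon: "(pA P X Y Z \<rtimes> W) \<Zcomp> pA P X (Y \<odot> Z) W \<Zcomp> (X \<ltimes> pA P Y Z W)
      = pA P (X \<odot> Y) Z W \<Zcomp> pA P X Y (Z \<odot> W)"
    and triangle: "pA P X (pI P) Y \<Zcomp> (X \<ltimes> pLam P Y) = pRho P X \<rtimes> Y"

record ('o, 'v, 'c) id_on_obj =
  iV :: "('o, 'v) cat"
  iC :: "('o, 'c) cat"
  incl :: "'v \<Rightarrow> 'c"

definition id_on_obj_functor :: "('o, 'v, 'c) id_on_obj \<Rightarrow> bool" where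
  "id_on_obj_functor J \<longleftrightarrow> is_functor (iV J) (iC J) \<lparr>FO = (\<lambda>X. X), FA = incl J\<rparr>"

definition centre :: "('o, 'c) cat \<Rightarrow> ('o, 'c) pre_str \<Rightarrow> ('o, 'c) cat" where
  "centre C P = C\<lparr>Arr := {f. premonoidal_data.central C P f}\<rparr>"

definition centre_inclusion :: "('o, 'c) cat \<Rightarrow> ('o, 'c) pre_str \<Rightarrow> ('o, 'c, 'c) id_on_obj" where
  "centre_inclusion C P = \<lparr>iV = centre C P, iC = C, incl = restrict (\<lambda>f. f) (Arr (centre C P))\<rparr>"

record ('o, 'v, 'c) eff_str =
  eMon :: "('o, 'v) mon_str"
  ePre :: "('o, 'c) pre_str"

text \<open>
  \<open>effectful J E\<close>: the identity-on-objects functor \<open>J\<close> with the monoidal structure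
  \<open>eMon E\<close> on its source and the premonoidal structure \<open>ePre E\<close> on its target is an
  effectful category.
\<close>

definition effectful :: "('o, 'v, 'c) id_on_obj \<Rightarrow> ('o, 'v, 'c) eff_str \<Rightarrow> bool" where
  "effectful J E \<longleftrightarrow> id_on_obj_functor J \<and>
     monoidal (iV J) (eMon E) \<and> premonoidal (iC J) (ePre E) \<and>
     (\<forall>v\<in>Arr (iV J). premonoidal_data.central (iC J) (ePre E) (incl J v)) \<and>
     (\<forall>A B. FO (mT (eMon E)) (A, B) = pO (ePre E) A B) \<and>
     mI (eMon E) = pI (ePre E) \<and>
     (\<forall>A. \<forall>v\<in>Arr (iV J).
        incl J (FA (mT (eMon E)) (Idn (iV J) A, v)) = pL (ePre E) A (incl J v) \<and>
        incl J (FA (mT (eMon E)) (v, Idn (iV J) A)) = pR (ePre E) A (incl J v)) \<and>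
     (\<forall>A B C. incl J (mA (eMon E) A B C) = pA (ePre E) A B C) \<and>
     (\<forall>A. incl J (mL (eMon E) A) = pLam (ePre E) A) \<and>
     (\<forall>A. incl J (mR (eMon E) A) = pRho (ePre E) A)"

text \<open>Here $\mu_{A,B}\colon F(A\otimes B)\to FA\otimes FB$ and $\varepsilon\colon J\to FI$.\<close>

definition strong_monoidal :: "('o, 'v) cat \<Rightarrow> ('o, 'v) mon_str \<Rightarrow> ('q, 'w) cat \<Rightarrow> ('q, 'w) mon_str
    \<Rightarrow> ('o, 'v, 'q, 'w) fctr \<Rightarrow> 'w \<Rightarrow> ('o \<Rightarrow> 'o \<Rightarrow> 'w) \<Rightarrow> bool" where
  "strong_monoidal V M W N F \<epsilon> \<mu> \<longleftrightarrow> monoidal V M \<and> monoidal W N \<and> is_functor V W F \<and>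
     \<epsilon> \<in> Hom W (mI N) (FO F (mI M)) \<and> iso_arrow W \<epsilon> \<and>
     (\<forall>A B. \<mu> A B \<in> Hom W (FO F (FO (mT M) (A, B))) (FO (mT N) (FO F A, FO F B)) \<and> iso_arrow W (\<mu> A B)) \<and>
     (\<forall>A A' B B'. \<forall>f\<in>Hom V A A'. \<forall>g\<in>Hom V B B'.
        FA F (FA (mT M) (f, g)) \<Zcomp>\<^bsub>W\<^esub> \<mu> A' B' = \<mu> A B \<Zcomp>\<^bsub>W\<^esub> FA (mT N) (FA F f, FA F g)) \<and>
     (\<forall>A B C.
        \<mu> (FO (mT M) (A, B)) C \<Zcomp>\<^bsub>W\<^esub> FA (mT N) (\<mu> A B, Idn W (FO F C)) \<Zcomp>\<^bsub>W\<^esub> mA N (FO F A) (FO F B) (FO F C)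
        = FA F (mA M A B C) \<Zcomp>\<^bsub>W\<^esub> \<mu> A (FO (mT M) (B, C)) \<Zcomp>\<^bsub>W\<^esub> FA (mT N) (Idn W (FO F A), \<mu> B C)) \<and>
     (\<forall>A. FA F (mL M A)
        = \<mu> (mI M) A \<Zcomp>\<^bsub>W\<^esub> FA (mT N) (inv_arrow W \<epsilon>, Idn W (FO F A)) \<Zcomp>\<^bsub>W\<^esub> mL N (FO F A)) \<and>
     (\<forall>A. FA F (mR M A)
        = \<mu> A (mI M) \<Zcomp>\<^bsub>W\<^esub> FA (mT N) (Idn W (FO F A), inv_arrow W \<epsilon>) \<Zcomp>\<^bsub>W\<^esub> mR N (FO F A))"

text \<open>
  The isomorphisms $\varepsilon$ and $\mu$ are pure: they are data in the target's category of
  pure morphisms, and their images under the identity-on-objects functor are the isomorphisms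
  in the effectful target. The inclusion need not be faithful, so the pure arrows are the data.
\<close>

record ('o, 'v, 'c, 'q, 'w, 'd) eff_fctr =
  eF :: "('o, 'c, 'q, 'd) fctr"
  eF0 :: "('o, 'v, 'q, 'w) fctr"
  eEps :: 'w
  eMu :: "'o \<Rightarrow> 'o \<Rightarrow> 'w"

definition effectful_functor :: "('o, 'v, 'c) id_on_obj \<Rightarrow> ('o, 'v, 'c) eff_str
    \<Rightarrow> ('q, 'w, 'd) id_on_obj \<Rightarrow> ('q, 'w, 'd) eff_str \<Rightarrow> ('o, 'v, 'c, 'q, 'w, 'd) eff_fctr \<Rightarrow> bool" where
  "effectful_functor J E K E' H \<longleftrightarrow> effectful J E \<and> effectful K E' \<and>
     is_functor (iC J) (iC K) (eF H) \<and> is_functor (iV J) (iV K) (eF0 H) \<and>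
     FO (eF H) = FO (eF0 H) \<and>
     (\<forall>v\<in>Arr (iV J). FA (eF H) (incl J v) = incl K (FA (eF0 H) v)) \<and>
     strong_monoidal (iV J) (eMon E) (iV K) (eMon E') (eF0 H) (eEps H) (eMu H) \<and>
     (\<forall>A A' B. \<forall>f\<in>Hom (iC J) A A'.
        FA (eF H) (pR (ePre E) B f) \<Zcomp>\<^bsub>iC K\<^esub> incl K (eMu H A' B)
        = incl K (eMu H A B) \<Zcomp>\<^bsub>iC K\<^esub> pR (ePre E') (FO (eF H) B) (FA (eF H) f)) \<and>
     (\<forall>A B B'. \<forall>f\<in>Hom (iC J) B B'.
        FA (eF H) (pL (ePre E) A f) \<Zcomp>\<^bsub>iC K\<^esub> incl K (eMu H A B')
        = incl K (eMu H A B) \<Zcomp>\<^bsub>iC K\<^esub> pL (ePre E') (FO (eF H) A) (FA (eF H) f))"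


section \<open>Promonads\<close>

text \<open>
  The family of sets $P(X,Y)$ of the underlying profunctor is given, like the hom-sets of a category,
  by a set \<open>El\<close> of elements with maps \<open>Src\<close> and \<open>Tgt\<close>.
\<close>

record ('o, 'v, 'p) promonad =
  Base :: "('o, 'v) cat"
  El :: "'p set"
  Src :: "'p \<Rightarrow> 'o"
  Tgt :: "'p \<Rightarrow> 'o"
  Lact :: "'v \<Rightarrow> 'p \<Rightarrow> 'p" (infixr "\<rhd>\<index>" 75)
  Ract :: "'p \<Rightarrow> 'v \<Rightarrow> 'p" (infixl "\<lhd>\<index>" 75)
  Unit :: "'v \<Rightarrow> 'p"
  Mult :: "'p \<Rightarrow> 'p \<Rightarrow> 'p" (infixl "\<star>\<index>" 70)

definition Pro :: "('o, 'v, 'p) promonad \<Rightarrow> 'o \<Rightarrow> 'o \<Rightarrow> 'p set" where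
  "Pro P X Y = {p \<in> El P. Src P p = X \<and> Tgt P p = Y}"

locale promonad =
  fixes P :: "('o, 'v, 'p) promonad" (structure)
  assumes base: "category (Base P)"
    and Lact_Pro: "\<lbrakk>f \<in> Hom (Base P) X Y; p \<in> Pro P Y Z\<rbrakk> \<Longrightarrow> f \<rhd> p \<in> Pro P X Z"
    and Ract_Pro: "\<lbrakk>p \<in> Pro P X Y; f \<in> Hom (Base P) Y Z\<rbrakk> \<Longrightarrow> p \<lhd> f \<in> Pro P X Z"
    and Lact_Idn: "p \<in> Pro P X Y \<Longrightarrow> Idn (Base P) X \<rhd> p = p"
    and Ract_Idn: "p \<in> Pro P X Y \<Longrightarrow> p \<lhd> Idn (Base P) Y = p"
    and Lact_Comp: "\<lbrakk>f \<in> Hom (Base P) W X; g \<in> Hom (Base P) X Y; p \<in> Pro P Y Z\<rbrakk>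
      \<Longrightarrow> (f \<Zcomp>\<^bsub>Base P\<^esub> g) \<rhd> p = f \<rhd> (g \<rhd> p)"
    and Ract_Comp: "\<lbrakk>p \<in> Pro P W X; f \<in> Hom (Base P) X Y; g \<in> Hom (Base P) Y Z\<rbrakk>
      \<Longrightarrow> p \<lhd> (f \<Zcomp>\<^bsub>Base P\<^esub> g) = (p \<lhd> f) \<lhd> g"
    and Lact_Ract: "\<lbrakk>f \<in> Hom (Base P) W X; p \<in> Pro P X Y; g \<in> Hom (Base P) Y Z\<rbrakk>
      \<Longrightarrow> (f \<rhd> p) \<lhd> g = f \<rhd> (p \<lhd> g)"
    and Unit_Pro: "f \<in> Hom (Base P) X Y \<Longrightarrow> Unit P f \<in> Pro P X Y"
    and Unit_nat_l: "\<lbrakk>f \<in> Hom (Base P) X Y; g \<in> Hom (Base P) Y Z\<rbrakk>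
      \<Longrightarrow> Unit P (f \<Zcomp>\<^bsub>Base P\<^esub> g) = f \<rhd> Unit P g"
    and Unit_nat_r: "\<lbrakk>f \<in> Hom (Base P) X Y; g \<in> Hom (Base P) Y Z\<rbrakk>
      \<Longrightarrow> Unit P (f \<Zcomp>\<^bsub>Base P\<^esub> g) = Unit P f \<lhd> g"
    and Mult_Pro: "\<lbrakk>p \<in> Pro P X Y; q \<in> Pro P Y Z\<rbrakk> \<Longrightarrow> p \<star> q \<in> Pro P X Z"
    and Mult_nat_l: "\<lbrakk>f \<in> Hom (Base P) W X; p \<in> Pro P X Y; q \<in> Pro P Y Z\<rbrakk>
      \<Longrightarrow> (f \<rhd> p) \<star> q = f \<rhd> (p \<star> q)"
    and Mult_nat_r: "\<lbrakk>p \<in> Pro P W X; q \<in> Pro P X Y; f \<in> Hom (Base P) Y Z\<rbrakk>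
      \<Longrightarrow> p \<star> (q \<lhd> f) = (p \<star> q) \<lhd> f"
    and Unit_Mult: "\<lbrakk>f \<in> Hom (Base P) X Y; p \<in> Pro P Y Z\<rbrakk> \<Longrightarrow> Unit P f \<star> p = f \<rhd> p"
    and Mult_Unit: "\<lbrakk>p \<in> Pro P X Y; f \<in> Hom (Base P) Y Z\<rbrakk> \<Longrightarrow> p \<star> Unit P f = p \<lhd> f"
    and Mult_dinat: "\<lbrakk>p \<in> Pro P W X; f \<in> Hom (Base P) X Y; q \<in> Pro P Y Z\<rbrakk>
      \<Longrightarrow> p \<star> (f \<rhd> q) = (p \<lhd> f) \<star> q"
    and Mult_assoc: "\<lbrakk>p \<in> Pro P W X; q \<in> Pro P X Y; r \<in> Pro P Y Z\<rbrakk>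
      \<Longrightarrow> (p \<star> q) \<star> r = p \<star> (q \<star> r)"

definition Kleisli :: "('o, 'v, 'p) promonad \<Rightarrow> ('o, 'p) cat" where
  "Kleisli P = \<lparr>Arr = El P, Dom = Src P, Cod = Tgt P,
     Idn = (\<lambda>X. Unit P (Idn (Base P) X)), Comp = Mult P\<rparr>"

definition Kleisli_functor :: "('o, 'v, 'p) promonad \<Rightarrow> ('o, 'v, 'p) id_on_obj" where
  "Kleisli_functor P = \<lparr>iV = Base P, iC = Kleisli P, incl = restrict (Unit P) (Arr (Base P))\<rparr>"

text \<open>The promonad $\hom_C(i(\bullet),i(\bullet))$ of an identity-on-objects functor $i\colon V\to C$.\<close>

definition promonad_of :: "('o, 'v, 'c) id_on_obj \<Rightarrow> ('o, 'v, 'c) promonad" where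
  "promonad_of J = \<lparr>Base = iV J, El = Arr (iC J), Src = Dom (iC J), Tgt = Cod (iC J),
     Lact = (\<lambda>v p. incl J v \<Zcomp>\<^bsub>iC J\<^esub> p), Ract = (\<lambda>p v. p \<Zcomp>\<^bsub>iC J\<^esub> incl J v),
     Unit = incl J, Mult = Comp (iC J)\<rparr>"

text \<open>Homomorphisms carry their source and target.\<close>

record ('o, 'v, 'p, 'q, 'w, 'r) phom =
  PSrc :: "('o, 'v, 'p) promonad"
  PTgt :: "('q, 'w, 'r) promonad"
  BF :: "('o, 'v, 'q, 'w) fctr"
  EF :: "'p \<Rightarrow> 'r"

definition promonad_hom :: "('o, 'v, 'p) promonad \<Rightarrow> ('q, 'w, 'r) promonad
    \<Rightarrow> ('o, 'v, 'p, 'q, 'w, 'r) phom \<Rightarrow> bool" where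
  "promonad_hom P Q F \<longleftrightarrow> promonad P \<and> promonad Q \<and> PSrc F = P \<and> PTgt F = Q \<and>
     is_functor (Base P) (Base Q) (BF F) \<and>
     EF F \<in> extensional (El P) \<and>
     (\<forall>X Y. \<forall>p\<in>Pro P X Y. EF F p \<in> Pro Q (FO (BF F) X) (FO (BF F) Y)) \<and>
     (\<forall>X Y Z. \<forall>f\<in>Hom (Base P) X Y. \<forall>p\<in>Pro P Y Z. EF F (f \<rhd>\<^bsub>P\<^esub> p) = FA (BF F) f \<rhd>\<^bsub>Q\<^esub> EF F p) \<and>
     (\<forall>X Y Z. \<forall>p\<in>Pro P X Y. \<forall>f\<in>Hom (Base P) Y Z. EF F (p \<lhd>\<^bsub>P\<^esub> f) = EF F p \<lhd>\<^bsub>Q\<^esub> FA (BF F) f) \<and>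
     (\<forall>X Y Z. \<forall>p\<in>Pro P X Y. \<forall>q\<in>Pro P Y Z. EF F (p \<star>\<^bsub>P\<^esub> q) = EF F p \<star>\<^bsub>Q\<^esub> EF F q) \<and>
     (\<forall>f\<in>Arr (Base P). EF F (Unit P f) = Unit Q (FA (BF F) f))"

text \<open>
  A modification is given by its components; \<open>modification F G \<alpha>\<close> is the typing judgement
  $\alpha\colon F\Rightarrow G$ of 2-cells.
\<close>

definition modification :: "('o, 'v, 'p, 'q, 'w, 'r) phom \<Rightarrow> ('o, 'v, 'p, 'q, 'w, 'r) phom
    \<Rightarrow> ('o \<Rightarrow> 'w) \<Rightarrow> bool" where
  "modification F G \<alpha> \<longleftrightarrow>
     promonad_hom (PSrc F) (PTgt F) F \<and> promonad_hom (PSrc G) (PTgt G) G \<and>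
     PSrc F = PSrc G \<and> PTgt F = PTgt G \<and>
     nat_trans (Base (PSrc F)) (Base (PTgt F)) (BF F) (BF G) \<alpha> \<and>
     (\<forall>X Y. \<forall>p\<in>Pro (PSrc F) X Y. \<alpha> X \<rhd>\<^bsub>PTgt F\<^esub> EF G p = EF F p \<lhd>\<^bsub>PTgt F\<^esub> \<alpha> Y)"


subsection \<open>The pure tensor\<close>

datatype ('o, 'v, 'p, 'q, 'w, 'r) gen =
    GC 'p 'q  \<comment> \<open>$f_{\mathbb C}$ at an object of the second base\<close>
  | GD 'o 'r  \<comment> \<open>$g_{\mathbb D}$ at an object of the first base\<close>
  | GV 'v 'q
  | GW 'o 'w

inductive pt_gen :: "('o, 'v, 'p) promonad \<Rightarrow> ('q, 'w, 'r) promonad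
    \<Rightarrow> 'o \<times> 'q \<Rightarrow> ('o, 'v, 'p, 'q, 'w, 'r) gen \<Rightarrow> 'o \<times> 'q \<Rightarrow> bool" for P Q where
  "f \<in> Pro P X X' \<Longrightarrow> pt_gen P Q (X, Y) (GC f Y) (X', Y)"
| "g \<in> Pro Q Y Y' \<Longrightarrow> pt_gen P Q (X, Y) (GD X g) (X, Y')"
| "v \<in> Hom (Base P) X X' \<Longrightarrow> pt_gen P Q (X, Y) (GV v Y) (X', Y)"
| "w \<in> Hom (Base Q) Y Y' \<Longrightarrow> pt_gen P Q (X, Y) (GW X w) (X, Y')"

inductive pt_path :: "('o, 'v, 'p) promonad \<Rightarrow> ('q, 'w, 'r) promonad
    \<Rightarrow> 'o \<times> 'q \<Rightarrow> ('o, 'v, 'p, 'q, 'w, 'r) gen list \<Rightarrow> 'o \<times> 'q \<Rightarrow> bool" for P Q where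
  "pt_path P Q s [] s"
| "\<lbrakk>pt_gen P Q s g t; pt_path P Q t gs u\<rbrakk> \<Longrightarrow> pt_path P Q s (g # gs) u"

text \<open>
  The congruence generated by the relations of the presentation, on paths from \<open>s\<close> to \<open>t\<close>.
\<close>

inductive pt_eq :: "('o, 'v, 'p) promonad \<Rightarrow> ('q, 'w, 'r) promonad
    \<Rightarrow> 'o \<times> 'q \<Rightarrow> 'o \<times> 'q \<Rightarrow> ('o, 'v, 'p, 'q, 'w, 'r) gen list
    \<Rightarrow> ('o, 'v, 'p, 'q, 'w, 'r) gen list \<Rightarrow> bool" for P Q where
  refl: "pt_path P Q s a t \<Longrightarrow> pt_eq P Q s t a a"
| sym: "pt_eq P Q s t a b \<Longrightarrow> pt_eq P Q s t b a"
| trans: "\<lbrakk>pt_eq P Q s t a b; pt_eq P Q s t b c\<rbrakk> \<Longrightarrow> pt_eq P Q s t a c"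
| cong: "\<lbrakk>pt_eq P Q s t a a'; pt_eq P Q t u b b'\<rbrakk> \<Longrightarrow> pt_eq P Q s u (a @ b) (a' @ b')"
| CW: "\<lbrakk>f \<in> Pro P X X'; w \<in> Hom (Base Q) Y Y'\<rbrakk>
    \<Longrightarrow> pt_eq P Q (X, Y) (X', Y') [GC f Y, GW X' w] [GW X w, GC f Y']"
| DV: "\<lbrakk>g \<in> Pro Q Y Y'; v \<in> Hom (Base P) X X'\<rbrakk>
    \<Longrightarrow> pt_eq P Q (X, Y) (X', Y') [GD X g, GV v Y'] [GV v Y, GD X' g]"
| CC: "\<lbrakk>f \<in> Pro P X X'; f' \<in> Pro P X' X''\<rbrakk>
    \<Longrightarrow> pt_eq P Q (X, Y) (X'', Y) [GC f Y, GC f' Y] [GC (f \<star>\<^bsub>P\<^esub> f') Y]"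
| C1: "pt_eq P Q (X, Y) (X, Y) [GC (Unit P (Idn (Base P) X)) Y] []"
| DD: "\<lbrakk>g \<in> Pro Q Y Y'; g' \<in> Pro Q Y' Y''\<rbrakk>
    \<Longrightarrow> pt_eq P Q (X, Y) (X, Y'') [GD X g, GD X g'] [GD X (g \<star>\<^bsub>Q\<^esub> g')]"
| D1: "pt_eq P Q (X, Y) (X, Y) [GD X (Unit Q (Idn (Base Q) Y))] []"
| VC: "v \<in> Hom (Base P) X X' \<Longrightarrow> pt_eq P Q (X, Y) (X', Y) [GV v Y] [GC (Unit P v) Y]"
| WD: "w \<in> Hom (Base Q) Y Y' \<Longrightarrow> pt_eq P Q (X, Y) (X, Y') [GW X w] [GD X (Unit Q w)]"

text \<open>A morphism of the presented category: source, congruence class of paths, target.\<close>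

type_synonym ('o, 'v, 'p, 'q, 'w, 'r) pt =
  "('o \<times> 'q) \<times> ('o, 'v, 'p, 'q, 'w, 'r) gen list set \<times> ('o \<times> 'q)"

definition pt_class :: "('o, 'v, 'p) promonad \<Rightarrow> ('q, 'w, 'r) promonad \<Rightarrow> 'o \<times> 'q
    \<Rightarrow> ('o, 'v, 'p, 'q, 'w, 'r) gen list \<Rightarrow> 'o \<times> 'q \<Rightarrow> ('o, 'v, 'p, 'q, 'w, 'r) pt" where
  "pt_class P Q s a t = (s, {b. pt_eq P Q s t a b}, t)"

definition pt_El :: "('o, 'v, 'p) promonad \<Rightarrow> ('q, 'w, 'r) promonad \<Rightarrow> ('o, 'v, 'p, 'q, 'w, 'r) pt set" where
  "pt_El P Q = {pt_class P Q s a t | s a t. pt_path P Q s a t}"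

definition pt_Mult :: "('o, 'v, 'p) promonad \<Rightarrow> ('q, 'w, 'r) promonad
    \<Rightarrow> ('o, 'v, 'p, 'q, 'w, 'r) pt \<Rightarrow> ('o, 'v, 'p, 'q, 'w, 'r) pt \<Rightarrow> ('o, 'v, 'p, 'q, 'w, 'r) pt" where
  "pt_Mult P Q = (\<lambda>(s, A, t) (t', B, u). (s, {c. \<exists>a\<in>A. \<exists>b\<in>B. pt_eq P Q s u (a @ b) c}, u))"

definition pt_Unit :: "('o, 'v, 'p) promonad \<Rightarrow> ('q, 'w, 'r) promonad
    \<Rightarrow> 'v \<times> 'w \<Rightarrow> ('o, 'v, 'p, 'q, 'w, 'r) pt" where
  "pt_Unit P Q = (\<lambda>(v, w). pt_class P Q (Dom (Base P) v, Dom (Base Q) w)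
     [GV v (Dom (Base Q) w), GW (Cod (Base P) v) w] (Cod (Base P) v, Cod (Base Q) w))"

definition pure_tensor :: "('o, 'v, 'p) promonad \<Rightarrow> ('q, 'w, 'r) promonad
    \<Rightarrow> ('o \<times> 'q, 'v \<times> 'w, ('o, 'v, 'p, 'q, 'w, 'r) pt) promonad" (infixr "\<otimes>\<^sub>0" 75) where
  "P \<otimes>\<^sub>0 Q = \<lparr>Base = prod_cat (Base P) (Base Q), El = pt_El P Q,
     Src = fst, Tgt = (\<lambda>p. snd (snd p)),
     Lact = (\<lambda>f p. pt_Mult P Q (pt_Unit P Q f) p), Ract = (\<lambda>p f. pt_Mult P Q p (pt_Unit P Q f)),
     Unit = pt_Unit P Q, Mult = pt_Mult P Q\<rparr>"

definition inC :: "('o, 'v, 'p) promonad \<Rightarrow> ('q, 'w, 'r) promonad \<Rightarrow> 'p \<Rightarrow> 'q \<Rightarrow> ('o, 'v, 'p, 'q, 'w, 'r) pt" where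
  "inC P Q f Y = pt_class P Q (Src P f, Y) [GC f Y] (Tgt P f, Y)"

definition inD :: "('o, 'v, 'p) promonad \<Rightarrow> ('q, 'w, 'r) promonad \<Rightarrow> 'o \<Rightarrow> 'r \<Rightarrow> ('o, 'v, 'p, 'q, 'w, 'r) pt" where
  "inD P Q X g = pt_class P Q (X, Src Q g) [GD X g] (X, Tgt Q g)"

text \<open>
  A functor from the presented category to \<open>D\<close>, with object map \<open>h\<close>, is determined by the images
  \<open>c f Y\<close> and \<open>d X g\<close> of the generators $f_{\mathbb C}$ and $g_{\mathbb D}$; the images of
  $v_{\mathbb V}$ and $w_{\mathbb W}$ are forced by the relations $v_{\mathbb V}=(v^\circ)_{\mathbb C}$
  and $w_{\mathbb W}=(w^\circ)_{\mathbb D}$.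
\<close>

fun pt_eval :: "('o, 'v, 'p) promonad \<Rightarrow> ('q, 'w, 'r) promonad \<Rightarrow> ('x, 'a) cat
    \<Rightarrow> ('p \<Rightarrow> 'q \<Rightarrow> 'a) \<Rightarrow> ('o \<Rightarrow> 'r \<Rightarrow> 'a) \<Rightarrow> 'x \<Rightarrow> ('o, 'v, 'p, 'q, 'w, 'r) gen list \<Rightarrow> 'a" where
  "pt_eval P Q D c d x [] = Idn D x"
| "pt_eval P Q D c d x (GC f Y # gs) = c f Y \<Zcomp>\<^bsub>D\<^esub> pt_eval P Q D c d x gs"
| "pt_eval P Q D c d x (GD X g # gs) = d X g \<Zcomp>\<^bsub>D\<^esub> pt_eval P Q D c d x gs"
| "pt_eval P Q D c d x (GV v Y # gs) = c (Unit P v) Y \<Zcomp>\<^bsub>D\<^esub> pt_eval P Q D c d x gs"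
| "pt_eval P Q D c d x (GW X w # gs) = d X (Unit Q w) \<Zcomp>\<^bsub>D\<^esub> pt_eval P Q D c d x gs"

definition pt_ext :: "('o, 'v, 'p) promonad \<Rightarrow> ('q, 'w, 'r) promonad \<Rightarrow> ('x, 'a) cat
    \<Rightarrow> ('o \<times> 'q \<Rightarrow> 'x) \<Rightarrow> ('p \<Rightarrow> 'q \<Rightarrow> 'a) \<Rightarrow> ('o \<Rightarrow> 'r \<Rightarrow> 'a)
    \<Rightarrow> ('o, 'v, 'p, 'q, 'w, 'r) pt \<Rightarrow> 'a" where
  "pt_ext P Q D h c d = restrict
     (\<lambda>(s, A, t). pt_eval P Q D c d (h t) (SOME a. a \<in> A)) (pt_El P Q)"

definition unit_promonad :: "(unit, unit, unit) promonad" where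
  "unit_promonad = \<lparr>Base = terminal_cat, El = UNIV, Src = (\<lambda>_. ()), Tgt = (\<lambda>_. ()),
     Lact = (\<lambda>_ _. ()), Ract = (\<lambda>_ _. ()), Unit = (\<lambda>_. ()), Mult = (\<lambda>_ _. ())\<rparr>"


subsection \<open>The operations of the monoidal 2-category\<close>

definition hom_id :: "('o, 'v, 'p) promonad \<Rightarrow> ('o, 'v, 'p, 'o, 'v, 'p) phom" where
  "hom_id P = \<lparr>PSrc = P, PTgt = P,
     BF = \<lparr>FO = (\<lambda>X. X), FA = restrict (\<lambda>f. f) (Arr (Base P))\<rparr>,
     EF = restrict (\<lambda>p. p) (El P)\<rparr>"

definition hom_comp :: "('q, 'w, 'r, 'x, 'y, 'z) phom \<Rightarrow> ('o, 'v, 'p, 'q, 'w, 'r) phom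
    \<Rightarrow> ('o, 'v, 'p, 'x, 'y, 'z) phom" (infixr "\<circ>\<^sub>1" 65) where
  "G \<circ>\<^sub>1 F = \<lparr>PSrc = PSrc F, PTgt = PTgt G,
     BF = \<lparr>FO = (\<lambda>X. FO (BF G) (FO (BF F) X)),
           FA = restrict (\<lambda>f. FA (BF G) (FA (BF F) f)) (Arr (Base (PSrc F)))\<rparr>,
     EF = restrict (\<lambda>p. EF G (EF F p)) (El (PSrc F))\<rparr>"

definition hom_tensor :: "('o, 'v, 'p, 'o1, 'v1, 'p1) phom \<Rightarrow> ('q, 'w, 'r, 'q1, 'w1, 'r1) phom
    \<Rightarrow> ('o \<times> 'q, 'v \<times> 'w, ('o, 'v, 'p, 'q, 'w, 'r) pt,
        'o1 \<times> 'q1, 'v1 \<times> 'w1, ('o1, 'v1, 'p1, 'q1, 'w1, 'r1) pt) phom" (infixr "\<otimes>\<^sub>1" 75) where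
  "F \<otimes>\<^sub>1 G = \<lparr>PSrc = PSrc F \<otimes>\<^sub>0 PSrc G, PTgt = PTgt F \<otimes>\<^sub>0 PTgt G,
     BF = \<lparr>FO = map_prod (FO (BF F)) (FO (BF G)),
           FA = restrict (map_prod (FA (BF F)) (FA (BF G))) (Arr (Base (PSrc F)) \<times> Arr (Base (PSrc G)))\<rparr>,
     EF = pt_ext (PSrc F) (PSrc G) (Kleisli (PTgt F \<otimes>\<^sub>0 PTgt G)) (map_prod (FO (BF F)) (FO (BF G)))
       (\<lambda>f Y. inC (PTgt F) (PTgt G) (EF F f) (FO (BF G) Y))
       (\<lambda>X g. inD (PTgt F) (PTgt G) (FO (BF F) X) (EF G g))\<rparr>"

text \<open>The canonical isomorphisms
  $(P\ast Q)\ast R\cong P\ast(Q\ast R)$, $1\ast P\cong P$ and $P\ast 1\cong P$.\<close>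

definition hom_assoc where
  "hom_assoc (P :: ('o, 'v, 'p) promonad) (Q :: ('q, 'w, 'r) promonad) (R :: ('x, 'y, 'z) promonad) =
     \<lparr>PSrc = (P \<otimes>\<^sub>0 Q) \<otimes>\<^sub>0 R, PTgt = P \<otimes>\<^sub>0 (Q \<otimes>\<^sub>0 R),
      BF = \<lparr>FO = (\<lambda>((X, Y), Z). (X, (Y, Z))),
            FA = restrict (\<lambda>((f, g), h). (f, (g, h))) ((Arr (Base P) \<times> Arr (Base Q)) \<times> Arr (Base R))\<rparr>,
      EF = pt_ext (P \<otimes>\<^sub>0 Q) R (Kleisli (P \<otimes>\<^sub>0 (Q \<otimes>\<^sub>0 R))) (\<lambda>((X, Y), Z). (X, (Y, Z)))
        (\<lambda>p Z. pt_ext P Q (Kleisli (P \<otimes>\<^sub>0 (Q \<otimes>\<^sub>0 R))) (\<lambda>(X, Y). (X, (Y, Z)))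
           (\<lambda>f Y. inC P (Q \<otimes>\<^sub>0 R) f (Y, Z))
           (\<lambda>X g. inD P (Q \<otimes>\<^sub>0 R) X (inC Q R g Z)) p)
        (\<lambda>(X, Y) h. inD P (Q \<otimes>\<^sub>0 R) X (inD Q R Y h))\<rparr>"

definition hom_lunit where
  "hom_lunit (P :: ('o, 'v, 'p) promonad) =
     \<lparr>PSrc = unit_promonad \<otimes>\<^sub>0 P, PTgt = P,
      BF = \<lparr>FO = snd, FA = restrict snd (UNIV \<times> Arr (Base P))\<rparr>,
      EF = pt_ext unit_promonad P (Kleisli P) snd (\<lambda>_ X. Idn (Kleisli P) X) (\<lambda>_ p. p)\<rparr>"

definition hom_runit where
  "hom_runit (P :: ('o, 'v, 'p) promonad) =
     \<lparr>PSrc = P \<otimes>\<^sub>0 unit_promonad, PTgt = P,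
      BF = \<lparr>FO = fst, FA = restrict fst (Arr (Base P) \<times> UNIV)\<rparr>,
      EF = pt_ext P unit_promonad (Kleisli P) fst (\<lambda>p _. p) (\<lambda>X _. Idn (Kleisli P) X)\<rparr>"

definition mod_id :: "('o, 'v, 'p, 'q, 'w, 'r) phom \<Rightarrow> 'o \<Rightarrow> 'w" where
  "mod_id F = (\<lambda>X. Idn (Base (PTgt F)) (FO (BF F) X))"

text \<open>Vertical composition of 2-cells between homomorphisms into \<open>Q\<close>, first \<open>\<alpha>\<close>, then \<open>\<beta>\<close>.\<close>

definition mod_vcomp :: "('q, 'w, 'r) promonad \<Rightarrow> ('o \<Rightarrow> 'w) \<Rightarrow> ('o \<Rightarrow> 'w) \<Rightarrow> 'o \<Rightarrow> 'w" where
  "mod_vcomp Q \<alpha> \<beta> = (\<lambda>X. \<alpha> X \<Zcomp>\<^bsub>Base Q\<^esub> \<beta> X)"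

definition mod_tensor :: "('o \<Rightarrow> 'v) \<Rightarrow> ('q \<Rightarrow> 'w) \<Rightarrow> 'o \<times> 'q \<Rightarrow> 'v \<times> 'w" (infixr "\<otimes>\<^sub>2" 75) where
  "\<alpha> \<otimes>\<^sub>2 \<beta> = (\<lambda>(X, Y). (\<alpha> X, \<beta> Y))"

text \<open>\<open>H \<circ>\<^sub>L \<alpha>\<close> and \<open>\<alpha> \<circ>\<^sub>R K\<close> are the whiskerings $H\circ\alpha$ and $\alpha\circ K$.\<close>

definition whisker_L :: "('q, 'w, 'r, 'x, 'y, 'z) phom \<Rightarrow> ('o \<Rightarrow> 'w) \<Rightarrow> 'o \<Rightarrow> 'y" (infixr "\<circ>\<^sub>L" 65) where
  "H \<circ>\<^sub>L \<alpha> = (\<lambda>X. FA (BF H) (\<alpha> X))"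

definition whisker_R :: "('o \<Rightarrow> 'w) \<Rightarrow> ('a, 'b, 'c, 'o, 'v, 'p) phom \<Rightarrow> 'a \<Rightarrow> 'w" (infixl "\<circ>\<^sub>R" 65) where
  "\<alpha> \<circ>\<^sub>R K = (\<lambda>X. \<alpha> (FO (BF K) X))"

definition invertible_modification where
  "invertible_modification F G \<alpha> \<longleftrightarrow> modification F G \<alpha> \<and>
     (\<exists>\<beta>. modification G F \<beta> \<and>
        mod_vcomp (PTgt F) \<alpha> \<beta> = mod_id F \<and> mod_vcomp (PTgt F) \<beta> \<alpha> = mod_id G)"

definition mod_inv :: "('q, 'w, 'r) promonad \<Rightarrow> ('o \<Rightarrow> 'w) \<Rightarrow> 'o \<Rightarrow> 'w" where
  "mod_inv Q \<alpha> = (\<lambda>X. inv_arrow (Base Q) (\<alpha> X))"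


section \<open>Pseudomonoids in the monoidal 2-category of promonads\<close>

record ('o, 'v, 'p) pseudo_str =
  sm :: "('o \<times> 'o, 'v \<times> 'v, ('o, 'v, 'p, 'o, 'v, 'p) pt, 'o, 'v, 'p) phom"
  su :: "(unit, unit, unit, 'o, 'v, 'p) phom"
  sA :: "('o \<times> 'o) \<times> 'o \<Rightarrow> 'v"
  sL :: "unit \<times> 'o \<Rightarrow> 'v"
  sR :: "'o \<times> unit \<Rightarrow> 'v"

text \<open>
  0-cells live at different types, so the notion of pseudomonoid is written out with the operations above.
  The canonical isomorphisms of the tensor are inserted where the 2-cells and equations need them.
\<close>

definition pseudomonoid :: "('o, 'v, 'p) promonad \<Rightarrow> ('o, 'v, 'p) pseudo_str \<Rightarrow> bool" where
  "pseudomonoid P S \<longleftrightarrow> (let m = sm S; u = su S; \<alpha> = sA S; l = sL S; \<rho> = sR S; i = hom_id P in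
     promonad P \<and>
     promonad_hom (P \<otimes>\<^sub>0 P) P m \<and>
     promonad_hom unit_promonad P u \<and>
     invertible_modification (m \<circ>\<^sub>1 (m \<otimes>\<^sub>1 i)) (m \<circ>\<^sub>1 (i \<otimes>\<^sub>1 m) \<circ>\<^sub>1 hom_assoc P P P) \<alpha> \<and>
     invertible_modification (m \<circ>\<^sub>1 (u \<otimes>\<^sub>1 i)) (hom_lunit P) l \<and>
     invertible_modification (m \<circ>\<^sub>1 (i \<otimes>\<^sub>1 u)) (hom_runit P) \<rho> \<and>
     mod_vcomp P (mod_vcomp P
         (m \<circ>\<^sub>L (\<alpha> \<otimes>\<^sub>2 mod_id i))
         (\<alpha> \<circ>\<^sub>R (((i \<otimes>\<^sub>1 m) \<otimes>\<^sub>1 i) \<circ>\<^sub>1 (hom_assoc P P P \<otimes>\<^sub>1 i))))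
         ((m \<circ>\<^sub>L (mod_id i \<otimes>\<^sub>2 \<alpha>)) \<circ>\<^sub>R (hom_assoc P (P \<otimes>\<^sub>0 P) P \<circ>\<^sub>1 (hom_assoc P P P \<otimes>\<^sub>1 i)))
       = mod_vcomp P
         (\<alpha> \<circ>\<^sub>R ((m \<otimes>\<^sub>1 i) \<otimes>\<^sub>1 i))
         (\<alpha> \<circ>\<^sub>R ((hom_id (P \<otimes>\<^sub>0 P) \<otimes>\<^sub>1 m) \<circ>\<^sub>1 hom_assoc (P \<otimes>\<^sub>0 P) P P)) \<and>
     mod_vcomp P
         (\<alpha> \<circ>\<^sub>R ((i \<otimes>\<^sub>1 u) \<otimes>\<^sub>1 i))
         ((m \<circ>\<^sub>L (mod_id i \<otimes>\<^sub>2 l)) \<circ>\<^sub>R hom_assoc P unit_promonad P)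
       = m \<circ>\<^sub>L (\<rho> \<otimes>\<^sub>2 mod_id i))"

record ('o, 'v, 'p, 'q, 'w, 'r) pseudo_hom =
  hF :: "('o, 'v, 'p, 'q, 'w, 'r) phom"
  hMu :: "'o \<times> 'o \<Rightarrow> 'w"
  hEps :: "unit \<Rightarrow> 'w"

definition pseudomonoid_hom :: "('o, 'v, 'p) promonad \<Rightarrow> ('o, 'v, 'p) pseudo_str
    \<Rightarrow> ('q, 'w, 'r) promonad \<Rightarrow> ('q, 'w, 'r) pseudo_str
    \<Rightarrow> ('o, 'v, 'p, 'q, 'w, 'r) pseudo_hom \<Rightarrow> bool" where
  "pseudomonoid_hom P S Q T H \<longleftrightarrow> (let m = sm S; u = su S; n = sm T; w = su T;
       F = hF H; \<mu> = hMu H; \<epsilon> = hEps H; i = hom_id P in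
     pseudomonoid P S \<and> pseudomonoid Q T \<and>
     promonad_hom P Q F \<and>
     invertible_modification (F \<circ>\<^sub>1 m) (n \<circ>\<^sub>1 (F \<otimes>\<^sub>1 F)) \<mu> \<and>
     invertible_modification w (F \<circ>\<^sub>1 u) \<epsilon> \<and>
     mod_vcomp Q (mod_vcomp Q
         (\<mu> \<circ>\<^sub>R (m \<otimes>\<^sub>1 i))
         (n \<circ>\<^sub>L (\<mu> \<otimes>\<^sub>2 mod_id F)))
         (sA T \<circ>\<^sub>R ((F \<otimes>\<^sub>1 F) \<otimes>\<^sub>1 F))
       = mod_vcomp Q (mod_vcomp Q
         (F \<circ>\<^sub>L sA S)
         (\<mu> \<circ>\<^sub>R ((i \<otimes>\<^sub>1 m) \<circ>\<^sub>1 hom_assoc P P P)))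
         ((n \<circ>\<^sub>L (mod_id F \<otimes>\<^sub>2 \<mu>)) \<circ>\<^sub>R hom_assoc P P P) \<and>
     F \<circ>\<^sub>L sL S = mod_vcomp Q (mod_vcomp Q
         (\<mu> \<circ>\<^sub>R (u \<otimes>\<^sub>1 i))
         (n \<circ>\<^sub>L (mod_inv Q \<epsilon> \<otimes>\<^sub>2 mod_id F)))
         (sL T \<circ>\<^sub>R (hom_id unit_promonad \<otimes>\<^sub>1 F)) \<and>
     F \<circ>\<^sub>L sR S = mod_vcomp Q (mod_vcomp Q
         (\<mu> \<circ>\<^sub>R (i \<otimes>\<^sub>1 u))
         (n \<circ>\<^sub>L (mod_id F \<otimes>\<^sub>2 mod_inv Q \<epsilon>)))
         (sR T \<circ>\<^sub>R (F \<otimes>\<^sub>1 hom_id unit_promonad)))"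


section \<open>The comparison\<close>

text \<open>
  The structure read off from a pseudomonoid structure: $A\otimes g=m(g_{\mathbb D})$ and
  $f\otimes B=m(f_{\mathbb C})$.
\<close>

definition eff_of_pseudo :: "('o, 'v, 'p) promonad \<Rightarrow> ('o, 'v, 'p) pseudo_str \<Rightarrow> ('o, 'v, 'p) eff_str" where
  "eff_of_pseudo P S = \<lparr>
     eMon = \<lparr>
       mT = BF (sm S),
       mI = FO (BF (su S)) (),
       mA = (\<lambda>A B C. sA S ((A, B), C)),
       mL = (\<lambda>A. sL S ((), A)),
       mR = (\<lambda>A. sR S (A, ()))\<rparr>,
     ePre = \<lparr>
       pO = (\<lambda>A B. FO (BF (sm S)) (A, B)),
       pL = (\<lambda>A. restrict (\<lambda>g. EF (sm S) (inD P P A g)) (El P)),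
       pR = (\<lambda>B. restrict (\<lambda>f. EF (sm S) (inC P P f B)) (El P)),
       pI = FO (BF (su S)) (),
       pA = (\<lambda>A B C. Unit P (sA S ((A, B), C))),
       pLam = (\<lambda>A. Unit P (sL S ((), A))),
       pRho = (\<lambda>A. Unit P (sR S (A, ())))\<rparr>\<rparr>"

definition eff_fctr_of_pseudo_hom :: "('o, 'v, 'p, 'q, 'w, 'r) pseudo_hom
    \<Rightarrow> ('o, 'v, 'p, 'q, 'w, 'r) eff_fctr" where
  "eff_fctr_of_pseudo_hom H = \<lparr>
     eF = \<lparr>FO = FO (BF (hF H)), FA = EF (hF H)\<rparr>,
     eF0 = BF (hF H),
     eEps = hEps H (),
     eMu = (\<lambda>A B. hMu H (A, B))\<rparr>"

end

theory Submission
  imports Defs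
begin

text \<open>
  A promonad is an identity-on-objects functor in disguise, so homomorphisms and modifications become
  pairs of functors and transformations that are natural on both levels. The Kleisli category of the
  pure tensor is given by generators and relations: a functor out of it is a pair of families of
  functors, one for each variable, that interchange whenever one of the two arrows is pure. A tensor
  homomorphism \<open>m\<close> is therefore a functor on the base together with two one-variable
  actions on the Kleisli category for which pure arrows are central, and a transformation out of an iterated
  tensor is natural as soon as it is natural in each variable. Read through this dictionary,
  the axioms of a pseudomonoid become those of an effectful category, one by one. For the centre,
  it remains to see that central arrows are closed under \<open>X \<otimes> _\<close> and \<open>_ \<otimes> X\<close>.
\<close>

section \<open>Categories, functors and isomorphisms\<close>

text \<open>Two features of the setting shape everything. The unit of a promonad need not be
  faithful, so an equation between pure arrows cannot be recovered from its image in the Kleisli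
  category. Naturality is therefore tracked on both levels, and pentagon and triangle are equations
  in the base whose images are the premonoidal ones. Moreover, the correspondence is a bijection of
  structures up to HOL equality, so functions on arrows must be pinned down off the arrows as well;
  this is why \<open>restrict\<close> and \<open>extensional\<close> recur.

  The most delicate obligation is that the associator of the pure tensor is a homomorphism at all.
  It is defined on the generators of a presentation whose first family of generators is indexed by
  congruence classes of another presentation. Its interchange law with a pure arrow of the third
  factor thus has to hold for every arrow of the inner tensor, which takes an induction over the
  inner presentation.\<close>

lemma Hom_iff: "f \<in> Hom C X Y \<longleftrightarrow> f \<in> Arr C \<and> Dom C f = X \<and> Cod C f = Y"
  by (auto simp: Hom_def)

lemma Arr_Hom: "f \<in> Arr C \<Longrightarrow> f \<in> Hom C (Dom C f) (Cod C f)"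
  by (simp add: Hom_iff)

text \<open>The definitions quantify over hom-sets, which leaves simp to guess the objects;
  quantifying over arrows makes the objects functions of the arrow.\<close>

lemma Ball_Hom: "(\<forall>X Y. \<forall>f\<in>Hom C X Y. R X Y f) \<longleftrightarrow> (\<forall>f\<in>Arr C. R (Dom C f) (Cod C f) f)"
  by (auto simp: Hom_iff)

context category
begin

lemma Idn_simps [simp]: "Idn C X \<in> Arr C" "Dom C (Idn C X) = X" "Cod C (Idn C X) = X"
  using Idn_Hom[of X] by (auto simp: Hom_iff)

lemma Comp_simps [simp]:
  assumes "f \<in> Arr C" "g \<in> Arr C" "Cod C f = Dom C g"
  shows "f \<Zcomp> g \<in> Arr C" "Dom C (f \<Zcomp> g) = Dom C f" "Cod C (f \<Zcomp> g) = Cod C g"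
  using Comp_Hom[of f "Dom C f" "Cod C f" g "Cod C g"] assms by (auto simp: Hom_iff)

lemma Idn_left [simp]: "\<lbrakk>f \<in> Arr C; Dom C f = X\<rbrakk> \<Longrightarrow> Idn C X \<Zcomp> f = f"
  by (rule Idn_Comp) (simp add: Hom_iff)

lemma Idn_right [simp]: "\<lbrakk>f \<in> Arr C; Cod C f = X\<rbrakk> \<Longrightarrow> f \<Zcomp> Idn C X = f"
  by (rule Comp_Idn) (simp add: Hom_iff)

lemma assoc:
  assumes "f \<in> Arr C" "g \<in> Arr C" "h \<in> Arr C" "Cod C f = Dom C g" "Cod C g = Dom C h"
  shows "(f \<Zcomp> g) \<Zcomp> h = f \<Zcomp> (g \<Zcomp> h)"
  by (rule Comp_assoc[of _ "Dom C f" "Cod C f" _ "Cod C g" _ "Cod C h"])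
    (use assms in \<open>auto simp: Hom_iff\<close>)

text \<open>In a right-nested composite the pair \<open>f\<close>, \<open>g\<close> is not a
  subterm; this form allows a commuting square to be used at the head of a longer composite.\<close>

lemma Comp_reassoc:
  assumes "f \<Zcomp> g = f' \<Zcomp> g'" "f \<in> Arr C" "g \<in> Arr C" "Cod C f = Dom C g"
    "f' \<in> Arr C" "g' \<in> Arr C" "Cod C f' = Dom C g'" "h \<in> Arr C" "Cod C g = Dom C h" "Cod C g' = Dom C h"
  shows "f \<Zcomp> (g \<Zcomp> h) = f' \<Zcomp> (g' \<Zcomp> h)"
  using assms by (metis assoc)

text \<open>Pasting of two squares along the common leg \<open>t\<close>. Interchange squares are
  naturality squares in disguise, so this rule carries the composition step of the naturality and
  centrality arguments below.\<close>

lemma natural_Comp: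
  assumes "f \<in> Arr C" "f' \<in> Arr C" "Cod C f = Dom C f'" "g \<in> Arr C" "g' \<in> Arr C" "Cod C g = Dom C g'"
    "s \<in> Hom C (Dom C f) (Dom C g)" "t \<in> Hom C (Cod C f) (Cod C g)" "u \<in> Hom C (Cod C f') (Cod C g')"
    and sq: "f \<Zcomp> t = s \<Zcomp> g" "f' \<Zcomp> u = t \<Zcomp> g'"
  shows "(f \<Zcomp> f') \<Zcomp> u = s \<Zcomp> (g \<Zcomp> g')"
proof -
  have "(f \<Zcomp> f') \<Zcomp> u = f \<Zcomp> (t \<Zcomp> g')"
    using assms by (simp add: Hom_iff assoc)
  also have "\<dots> = (s \<Zcomp> g) \<Zcomp> g'"
    unfolding sq(1)[symmetric] using assms(1-9) by (simp add: Hom_iff assoc)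
  finally show ?thesis
    using assms by (simp add: Hom_iff assoc)
qed

lemma inverse_arrows_unique:
  assumes "inverse_arrows C f g" "inverse_arrows C f h"
  shows "g = h"
proof -
  have "g = g \<Zcomp> (f \<Zcomp> h)"
    using assms by (simp add: inverse_arrows_def Hom_iff)
  also have "\<dots> = (g \<Zcomp> f) \<Zcomp> h"
    using assms by (intro assoc[symmetric]) (auto simp: inverse_arrows_def Hom_iff)
  also have "\<dots> = h"
    using assms by (simp add: inverse_arrows_def Hom_iff)
  finally show ?thesis .
qed

lemma inv_arrow_eq: "inverse_arrows C f g \<Longrightarrow> inv_arrow C f = g"
  unfolding inv_arrow_def using inverse_arrows_unique by blast

lemma inverse_arrows_inv: "iso_arrow C f \<Longrightarrow> inverse_arrows C f (inv_arrow C f)"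
  unfolding iso_arrow_def using inv_arrow_eq by auto

lemma iso_arrow_Arr: "iso_arrow C f \<Longrightarrow> f \<in> Arr C"
  by (auto simp: iso_arrow_def inverse_arrows_def)

lemma inv_simps [simp]:
  assumes "iso_arrow C f"
  shows "inv_arrow C f \<in> Arr C" "Dom C (inv_arrow C f) = Cod C f" "Cod C (inv_arrow C f) = Dom C f"
    "f \<Zcomp> inv_arrow C f = Idn C (Dom C f)" "inv_arrow C f \<Zcomp> f = Idn C (Cod C f)"
  using inverse_arrows_inv[OF assms] by (auto simp: inverse_arrows_def Hom_iff)

lemma iso_cancel:
  assumes "iso_arrow C f" "g \<in> Arr C" "Cod C f = Dom C g"
  shows "inv_arrow C f \<Zcomp> (f \<Zcomp> g) = g"
  using assms by (subst assoc[symmetric]) (auto simp: iso_arrow_Arr)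

text \<open>Composing with the inverse legs turns the square around. This yields both the naturality
  of a pointwise inverse and the centrality of the inverse of a central arrow.\<close>

lemma natural_inv:
  assumes "f \<Zcomp> t = s \<Zcomp> g" "iso_arrow C s" "iso_arrow C t" "f \<in> Arr C" "g \<in> Arr C"
    "Cod C f = Dom C t" "Cod C s = Dom C g" "Dom C f = Dom C s" "Cod C g = Cod C t"
  shows "g \<Zcomp> inv_arrow C t = inv_arrow C s \<Zcomp> f"
proof -
  have "inv_arrow C s \<Zcomp> f = inv_arrow C s \<Zcomp> ((f \<Zcomp> t) \<Zcomp> inv_arrow C t)"
    using assms(2-) iso_arrow_Arr by (simp add: assoc)
  also have "\<dots> = inv_arrow C s \<Zcomp> (s \<Zcomp> (g \<Zcomp> inv_arrow C t))"
    using assms iso_arrow_Arr by (simp add: assoc)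
  also have "\<dots> = g \<Zcomp> inv_arrow C t"
    using assms(2-) by (intro iso_cancel) auto
  finally show ?thesis by simp
qed

end

section \<open>Functors and natural transformations\<close>

lemma is_functor_iff: "is_functor C D F \<longleftrightarrow> category C \<and> category D \<and> FA F \<in> extensional (Arr C) \<and>
    (\<forall>f\<in>Arr C. FA F f \<in> Hom D (FO F (Dom C f)) (FO F (Cod C f))) \<and>
    (\<forall>X. FA F (Idn C X) = Idn D (FO F X)) \<and>
    (\<forall>f\<in>Arr C. \<forall>g\<in>Arr C. Cod C f = Dom C g \<longrightarrow> FA F (f \<Zcomp>\<^bsub>C\<^esub> g) = FA F f \<Zcomp>\<^bsub>D\<^esub> FA F g)"
  unfolding is_functor_def Ball_Hom by (auto simp: Hom_iff)

locale cat_functor = src: category C + tgt: category D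
  for C :: "('o, 'a) cat" and D :: "('p, 'b) cat" and F :: "('o, 'a, 'p, 'b) fctr" +
  assumes is_functor: "is_functor C D F"
begin

lemma FA_simps [simp]:
  assumes "f \<in> Arr C"
  shows "FA F f \<in> Arr D" "Dom D (FA F f) = FO F (Dom C f)" "Cod D (FA F f) = FO F (Cod C f)"
  using is_functor assms by (auto simp: is_functor_iff Hom_iff)

lemma FA_Idn [simp]: "FA F (Idn C X) = Idn D (FO F X)"
  using is_functor by (simp add: is_functor_iff)

lemma FA_Comp [simp]:
  "\<lbrakk>f \<in> Arr C; g \<in> Arr C; Cod C f = Dom C g\<rbrakk> \<Longrightarrow> FA F (f \<Zcomp>\<^bsub>C\<^esub> g) = FA F f \<Zcomp>\<^bsub>D\<^esub> FA F g"
  using is_functor by (simp add: is_functor_iff)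

lemma FA_ext: "FA F \<in> extensional (Arr C)"
  using is_functor by (simp add: is_functor_iff)

lemma FA_inverse_arrows: "inverse_arrows C f g \<Longrightarrow> inverse_arrows D (FA F f) (FA F g)"
  by (auto simp: inverse_arrows_def Hom_iff simp flip: FA_Comp FA_Idn)

lemma FA_iso: "iso_arrow C f \<Longrightarrow> iso_arrow D (FA F f)"
  unfolding iso_arrow_def using FA_inverse_arrows by blast

lemma FA_inv: "iso_arrow C f \<Longrightarrow> FA F (inv_arrow C f) = inv_arrow D (FA F f)"
  using tgt.inv_arrow_eq[OF FA_inverse_arrows[OF src.inverse_arrows_inv]] by simp

end

lemma cat_functorI: "is_functor C D F \<Longrightarrow> cat_functor C D F"
  by (auto simp: cat_functor_def cat_functor_axioms_def is_functor_def)

lemma nat_trans_iff: "nat_trans C D F G \<tau> \<longleftrightarrow> is_functor C D F \<and> is_functor C D G \<and>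
    (\<forall>X. \<tau> X \<in> Hom D (FO F X) (FO G X)) \<and>
    (\<forall>f\<in>Arr C. FA F f \<Zcomp>\<^bsub>D\<^esub> \<tau> (Cod C f) = \<tau> (Dom C f) \<Zcomp>\<^bsub>D\<^esub> FA G f)"
  unfolding nat_trans_def Ball_Hom ..

lemma nat_trans_inv:
  assumes "nat_trans C D F G \<tau>" "\<And>X. iso_arrow D (\<tau> X)"
  shows "nat_trans C D G F (\<lambda>X. inv_arrow D (\<tau> X))"
proof -
  interpret F: cat_functor C D F using assms by (auto simp: nat_trans_def intro: cat_functorI)
  interpret G: cat_functor C D G using assms by (auto simp: nat_trans_def intro: cat_functorI)
  show ?thesis
    using assms unfolding nat_trans_iff
    by (auto simp: Hom_iff intro!: F.tgt.natural_inv)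
qed

lemma is_functor_comp:
  assumes "is_functor C D F" "is_functor D E G" "A = Arr C"
  shows "is_functor C E \<lparr>FO = (\<lambda>X. FO G (FO F X)), FA = restrict (\<lambda>f. FA G (FA F f)) A\<rparr>"
proof -
  interpret F: cat_functor C D F using assms(1) by (rule cat_functorI)
  interpret G: cat_functor D E G using assms(2) by (rule cat_functorI)
  show ?thesis using assms(3)
    by (auto simp: is_functor_iff F.src.category_axioms G.tgt.category_axioms Hom_iff)
qed

lemma is_functor_id:
  assumes "category C" "A = Arr C"
  shows "is_functor C C \<lparr>FO = (\<lambda>X. X), FA = restrict (\<lambda>f. f) A\<rparr>"
proof -
  interpret category C by fact
  show ?thesis by (auto simp: is_functor_iff category_axioms Hom_iff assms)
qed

section \<open>Product categories and the terminal category\<close>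

lemma prod_cat_simps [simp]:
  "Arr (prod_cat C D) = Arr C \<times> Arr D"
  "Dom (prod_cat C D) (f, g) = (Dom C f, Dom D g)"
  "Cod (prod_cat C D) (f, g) = (Cod C f, Cod D g)"
  "Idn (prod_cat C D) (X, Y) = (Idn C X, Idn D Y)"
  "(f, g) \<Zcomp>\<^bsub>prod_cat C D\<^esub> (f', g') = (f \<Zcomp>\<^bsub>C\<^esub> f', g \<Zcomp>\<^bsub>D\<^esub> g')"
  by (simp_all add: prod_cat_def)

lemma category_prod_cat:
  assumes "category C" "category D"
  shows "category (prod_cat C D)"
proof -
  interpret C: category C by fact
  interpret D: category D by fact
  show ?thesis
    by unfold_locales (auto simp: Hom_iff C.assoc D.assoc)
qed

lemma terminal_cat_simps [simp]: "Arr terminal_cat = UNIV" "Hom terminal_cat X Y = UNIV"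
  by (auto simp: terminal_cat_def Hom_def)

lemma category_terminal_cat: "category terminal_cat"
  by unfold_locales (auto simp: terminal_cat_def Hom_iff)

lemma is_functor_prod:
  assumes "is_functor C C' F" "is_functor D D' G" "A = Arr C \<times> Arr D"
  shows "is_functor (prod_cat C D) (prod_cat C' D')
    \<lparr>FO = map_prod (FO F) (FO G), FA = restrict (map_prod (FA F) (FA G)) A\<rparr>"
proof -
  interpret F: cat_functor C C' F using assms(1) by (rule cat_functorI)
  interpret G: cat_functor D D' G using assms(2) by (rule cat_functorI)
  show ?thesis unfolding assms(3)
    by (auto simp: is_functor_iff category_prod_cat F.src.category_axioms F.tgt.category_axioms
        G.src.category_axioms G.tgt.category_axioms Hom_iff)
qed

section \<open>Promonads as identity-on-objects functors\<close>

text \<open>Oriented from the promonad to its Kleisli category: elements of the profunctor are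
  treated as arrows from here on, so that the rules for categories apply to them.\<close>

lemma Kleisli_simps:
  "El P = Arr (Kleisli P)" "Src P = Dom (Kleisli P)" "Tgt P = Cod (Kleisli P)" "Mult P = Comp (Kleisli P)"
  by (simp_all add: Kleisli_def)

lemma Idn_Kleisli: "Idn (Kleisli P) X = Unit P (Idn (Base P) X)"
  by (simp add: Kleisli_def)

lemma Pro_Kleisli: "Pro P = Hom (Kleisli P)"
  by (auto simp: Pro_def Hom_def Kleisli_def fun_eq_iff)

text \<open>The laws \<open>Unit_Mult\<close> and \<open>Mult_Unit\<close> force both actions:
  acting by \<open>f\<close> is composing with \<open>Unit P f\<close>. Once the actions are
  eliminated, the profunctor and naturality laws reduce to the category laws of the Kleisli category
  and functoriality of the unit. Identities are preserved by definition, since a Kleisli identity is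
  the unit of an identity.\<close>

lemma promonad_iff: "promonad P \<longleftrightarrow> category (Base P) \<and> category (Kleisli P) \<and>
    (\<forall>X Y. \<forall>f\<in>Hom (Base P) X Y. Unit P f \<in> Hom (Kleisli P) X Y) \<and>
    (\<forall>f\<in>Arr (Base P). \<forall>g\<in>Arr (Base P). Cod (Base P) f = Dom (Base P) g \<longrightarrow>
       Unit P (f \<Zcomp>\<^bsub>Base P\<^esub> g) = Unit P f \<Zcomp>\<^bsub>Kleisli P\<^esub> Unit P g) \<and>
    (\<forall>f\<in>Arr (Base P). \<forall>p\<in>Arr (Kleisli P). Cod (Base P) f = Dom (Kleisli P) p \<longrightarrow>
       Lact P f p = Unit P f \<Zcomp>\<^bsub>Kleisli P\<^esub> p) \<and>
    (\<forall>f\<in>Arr (Base P). \<forall>p\<in>Arr (Kleisli P). Dom (Base P) f = Cod (Kleisli P) p \<longrightarrow>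
       Ract P p f = p \<Zcomp>\<^bsub>Kleisli P\<^esub> Unit P f)" (is "_ \<longleftrightarrow> ?R")
proof
  assume "promonad P"
  then interpret promonad P .
  have "category (Kleisli P)"
  proof
    fix X show "Idn (Kleisli P) X \<in> Hom (Kleisli P) X X"
      using Unit_Pro[OF category.Idn_Hom[OF base]] by (simp add: Idn_Kleisli Pro_Kleisli)
  next
    fix f X Y assume "f \<in> Hom (Kleisli P) X Y"
    then show "Idn (Kleisli P) X \<Zcomp>\<^bsub>Kleisli P\<^esub> f = f" "f \<Zcomp>\<^bsub>Kleisli P\<^esub> Idn (Kleisli P) Y = f"
      using Unit_Mult[OF category.Idn_Hom[OF base], of f X Y] Lact_Idn[of f X Y]
        Mult_Unit[OF _ category.Idn_Hom[OF base], of f X Y] Ract_Idn[of f X Y]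
      by (simp_all add: Idn_Kleisli Pro_Kleisli Kleisli_simps)
  qed (use Mult_Pro Mult_assoc in \<open>auto simp: Pro_Kleisli Kleisli_simps\<close>)
  moreover have "Unit P (f \<Zcomp>\<^bsub>Base P\<^esub> g) = Unit P f \<Zcomp>\<^bsub>Kleisli P\<^esub> Unit P g"
    if "f \<in> Arr (Base P)" "g \<in> Arr (Base P)" "Cod (Base P) f = Dom (Base P) g" for f g
    using Unit_nat_l[of f _ _ g "Cod (Base P) g"] Unit_Mult[of f _ _ "Unit P g" "Cod (Base P) g"]
      Unit_Pro[of g _ "Cod (Base P) g"] that
    by (simp add: Hom_iff Kleisli_simps Pro_Kleisli)
  moreover have "Lact P f p = Unit P f \<Zcomp>\<^bsub>Kleisli P\<^esub> p"
    if "f \<in> Arr (Base P)" "p \<in> Arr (Kleisli P)" "Cod (Base P) f = Dom (Kleisli P) p" for f p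
    using Unit_Mult[of f _ _ p] that by (simp add: Hom_iff Kleisli_simps Pro_Kleisli)
  moreover have "Ract P p f = p \<Zcomp>\<^bsub>Kleisli P\<^esub> Unit P f"
    if "f \<in> Arr (Base P)" "p \<in> Arr (Kleisli P)" "Dom (Base P) f = Cod (Kleisli P) p" for f p
    using Mult_Unit[of p _ _ f] that by (simp add: Hom_iff Kleisli_simps Pro_Kleisli)
  ultimately show ?R
    using base Unit_Pro by (simp add: Pro_Kleisli)
next
  assume R: ?R
  interpret V: category "Base P" using R by blast
  interpret K: category "Kleisli P" using R by blast
  have U: "\<And>f. f \<in> Arr (Base P) \<Longrightarrow> Unit P f \<in> Arr (Kleisli P)"
    "\<And>f. f \<in> Arr (Base P) \<Longrightarrow> Dom (Kleisli P) (Unit P f) = Dom (Base P) f"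
    "\<And>f. f \<in> Arr (Base P) \<Longrightarrow> Cod (Kleisli P) (Unit P f) = Cod (Base P) f"
    using R by (auto simp: Hom_iff)
  have [simp]: "Unit P (Idn (Base P) X) = Idn (Kleisli P) X" for X
    by (simp add: Kleisli_def)
  show "promonad P"
    by unfold_locales (use R in \<open>auto simp: Hom_iff Pro_Kleisli U K.assoc Kleisli_simps(4)\<close>)
qed

context promonad
begin

lemma category_Kleisli: "category (Kleisli P)"
  using promonad_axioms by (simp add: promonad_iff)

lemma Unit_simps [simp]:
  assumes "f \<in> Arr (Base P)"
  shows "Unit P f \<in> Arr (Kleisli P)" "Dom (Kleisli P) (Unit P f) = Dom (Base P) f"
    "Cod (Kleisli P) (Unit P f) = Cod (Base P) f"
  using promonad_axioms assms by (auto simp: promonad_iff Hom_iff)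

lemma Unit_Idn [simp]: "Unit P (Idn (Base P) X) = Idn (Kleisli P) X"
  by (simp add: Kleisli_def)

lemma Unit_Comp [simp]: "\<lbrakk>f \<in> Arr (Base P); g \<in> Arr (Base P); Cod (Base P) f = Dom (Base P) g\<rbrakk>
    \<Longrightarrow> Unit P (f \<Zcomp>\<^bsub>Base P\<^esub> g) = Unit P f \<Zcomp>\<^bsub>Kleisli P\<^esub> Unit P g"
  using promonad_axioms by (auto simp: promonad_iff)

lemma Lact_eq: "\<lbrakk>f \<in> Arr (Base P); p \<in> Arr (Kleisli P); Cod (Base P) f = Dom (Kleisli P) p\<rbrakk>
    \<Longrightarrow> Lact P f p = Unit P f \<Zcomp>\<^bsub>Kleisli P\<^esub> p"
  using promonad_axioms by (auto simp: promonad_iff)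

lemma Ract_eq: "\<lbrakk>f \<in> Arr (Base P); p \<in> Arr (Kleisli P); Dom (Base P) f = Cod (Kleisli P) p\<rbrakk>
    \<Longrightarrow> Ract P p f = p \<Zcomp>\<^bsub>Kleisli P\<^esub> Unit P f"
  using promonad_axioms by (auto simp: promonad_iff)

lemma id_on_obj_functor_Kleisli: "id_on_obj_functor (Kleisli_functor P)"
proof -
  interpret V: category "Base P" by (rule base)
  show ?thesis
    by (auto simp: id_on_obj_functor_def is_functor_iff Kleisli_functor_def base category_Kleisli Hom_iff)
qed

end

sublocale promonad \<subseteq> V: category "Base P" by (rule base)
sublocale promonad \<subseteq> K: category "Kleisli P" by (rule category_Kleisli)

text \<open>The promonad axioms leave \<open>Unit P\<close> arbitrary off the arrows of the base,
  whereas a functor has to be extensional; hence the restriction.\<close>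

sublocale promonad \<subseteq> Unit: cat_functor "Base P" "Kleisli P" "\<lparr>FO = (\<lambda>X. X), FA = restrict (Unit P) (Arr (Base P))\<rparr>"
  using id_on_obj_functor_Kleisli unfolding id_on_obj_functor_def Kleisli_functor_def
  by (intro cat_functorI) simp

text \<open>The identities are the point: those of the Kleisli category are \<open>incl J\<close> of
  the base identities, which are the identities of \<open>iC J\<close> because \<open>J\<close> is a
  functor.\<close>

lemma Kleisli_promonad_of:
  assumes "id_on_obj_functor J"
  shows "Kleisli (promonad_of J) = iC J"
  using assms by (simp add: Kleisli_def promonad_of_def id_on_obj_functor_def is_functor_def)

lemma promonad_promonad_of:
  assumes "id_on_obj_functor J"
  shows "promonad (promonad_of J)"
proof -
  interpret cat_functor "iV J" "iC J" "\<lparr>FO = (\<lambda>X. X), FA = incl J\<rparr>"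
    using assms unfolding id_on_obj_functor_def by (rule cat_functorI)
  show ?thesis
    unfolding promonad_iff Kleisli_promonad_of[OF assms]
    using FA_simps FA_Comp
    by (auto simp: promonad_of_def Hom_iff src.category_axioms tgt.category_axioms)
qed

text \<open>The equality is on the nose because \<open>incl J\<close> is already extensional, so
  restricting it changes nothing.\<close>

lemma Kleisli_functor_promonad_of:
  assumes "id_on_obj_functor J"
  shows "Kleisli_functor (promonad_of J) = J"
  using assms by (auto simp: Kleisli_functor_def Kleisli_promonad_of)
    (auto simp: promonad_of_def id_on_obj_functor_def is_functor_def extensional_restrict)

section \<open>Homomorphisms and modifications as functors and transformations\<close>

definition Kleisli_fctr :: "('o, 'v, 'p, 'q, 'w, 'r) phom \<Rightarrow> ('o, 'p, 'q, 'r) fctr" where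
  "Kleisli_fctr F = \<lparr>FO = FO (BF F), FA = EF F\<rparr>"

lemma Kleisli_fctr_simps [simp]: "FO (Kleisli_fctr F) = FO (BF F)" "FA (Kleisli_fctr F) = EF F"
  by (simp_all add: Kleisli_fctr_def)

text \<open>Since the actions are composites with units, preserving them follows from preserving
  \<open>Mult\<close> and \<open>Unit\<close>; preservation of identities comes from the unit
  condition. The functor on Kleisli categories reuses the object map of the base functor, as both
  units are the identity on objects.\<close>

lemma promonad_hom_iff: "promonad_hom P Q F \<longleftrightarrow> promonad P \<and> promonad Q \<and> PSrc F = P \<and> PTgt F = Q \<and>
    is_functor (Base P) (Base Q) (BF F) \<and> is_functor (Kleisli P) (Kleisli Q) (Kleisli_fctr F) \<and>
    (\<forall>f\<in>Arr (Base P). EF F (Unit P f) = Unit Q (FA (BF F) f))" (is "?L \<longleftrightarrow> ?R")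
proof
  assume L: ?L
  interpret P: promonad P using L by (simp add: promonad_hom_def)
  interpret Q: promonad Q using L by (simp add: promonad_hom_def)
  interpret F: cat_functor "Base P" "Base Q" "BF F"
    using L by (intro cat_functorI) (simp add: promonad_hom_def)
  have "EF F (Idn (Kleisli P) X) = Idn (Kleisli Q) (FO (BF F) X)" for X
    using L by (simp add: promonad_hom_def flip: P.Unit_Idn Q.Unit_Idn)
  then have "is_functor (Kleisli P) (Kleisli Q) (Kleisli_fctr F)"
    unfolding is_functor_def using L
    by (simp add: promonad_hom_def Pro_Kleisli Kleisli_simps P.category_Kleisli Q.category_Kleisli)
  with L show ?R by (simp add: promonad_hom_def)
next
  assume R: ?R
  interpret P: promonad P using R by simp
  interpret Q: promonad Q using R by simp
  interpret F: cat_functor "Base P" "Base Q" "BF F" using R by (intro cat_functorI) simp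
  interpret KF: cat_functor "Kleisli P" "Kleisli Q" "Kleisli_fctr F" using R by (intro cat_functorI) simp
  have E: "EF F f = FA (Kleisli_fctr F) f" for f by simp
  show ?L
    using R KF.FA_ext unfolding promonad_hom_def Pro_Kleisli
    by (auto simp: Hom_iff P.Lact_eq P.Ract_eq Q.Lact_eq Q.Ract_eq Kleisli_simps
        KF.FA_simps[simplified] KF.FA_Comp[simplified])
qed

locale promonad_homomorphism = src: promonad P + tgt: promonad Q
  for P :: "('o, 'v, 'p) promonad" and Q :: "('q, 'w, 'r) promonad"
    and F :: "('o, 'v, 'p, 'q, 'w, 'r) phom" +
  assumes hom: "promonad_hom P Q F"
begin

lemma PSrc [simp]: "PSrc F = P" and PTgt [simp]: "PTgt F = Q"
  using hom by (simp_all add: promonad_hom_def)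

lemma EF_Unit [simp]: "f \<in> Arr (Base P) \<Longrightarrow> EF F (Unit P f) = Unit Q (FA (BF F) f)"
  using hom by (simp add: promonad_hom_def)

end

sublocale promonad_homomorphism \<subseteq> B: cat_functor "Base P" "Base Q" "BF F"
  using hom by (intro cat_functorI) (simp add: promonad_hom_iff)

text \<open>The \<open>rewrites\<close> clause makes the functor rules fire on \<open>EF F\<close>
  and \<open>FO (BF F)\<close>, the forms in which they occur in goals.\<close>

sublocale promonad_homomorphism \<subseteq> E: cat_functor "Kleisli P" "Kleisli Q" "Kleisli_fctr F"
  rewrites "FO (Kleisli_fctr F) = FO (BF F)" and "FA (Kleisli_fctr F) = EF F"
  using hom by (auto simp: promonad_hom_iff intro: cat_functorI)

lemma promonad_homomorphismI: "promonad_hom P Q F \<Longrightarrow> promonad_homomorphism P Q F"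
  by (auto simp: promonad_homomorphism_def promonad_homomorphism_axioms_def promonad_hom_def)

lemma promonad_hom_id:
  assumes "promonad P"
  shows "promonad_hom P P (hom_id P)"
proof -
  interpret promonad P by fact
  show ?thesis
    by (auto simp: promonad_hom_iff assms hom_id_def Kleisli_fctr_def Kleisli_simps(1)
        intro!: is_functor_id V.category_axioms K.category_axioms)
qed

lemma promonad_hom_comp:
  assumes "promonad_hom Q R G" "promonad_hom P Q F"
  shows "promonad_hom P R (G \<circ>\<^sub>1 F)"
proof -
  interpret F: promonad_homomorphism P Q F using assms(2) by (rule promonad_homomorphismI)
  interpret G: promonad_homomorphism Q R G using assms(1) by (rule promonad_homomorphismI)
  show ?thesis
    using is_functor_comp[OF F.E.is_functor G.E.is_functor HOL.refl]
      is_functor_comp[OF F.B.is_functor G.B.is_functor HOL.refl]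
    by (simp add: promonad_hom_iff F.src.promonad_axioms G.tgt.promonad_axioms hom_comp_def
        Kleisli_fctr_def Kleisli_simps(1))
qed

text \<open>With the actions replaced by composition with units, the modification law says that
  \<open>Unit Q (\<alpha> X)\<close> is natural between the functors on Kleisli categories. In
  general neither of the two naturalities implies the other.\<close>

lemma modification_iff:
  assumes "promonad_hom P Q F" "promonad_hom P Q G"
  shows "modification F G \<alpha> \<longleftrightarrow> nat_trans (Base P) (Base Q) (BF F) (BF G) \<alpha> \<and>
    nat_trans (Kleisli P) (Kleisli Q) (Kleisli_fctr F) (Kleisli_fctr G) (\<lambda>X. Unit Q (\<alpha> X))"
proof -
  interpret F: promonad_homomorphism P Q F using assms(1) by (rule promonad_homomorphismI)
  interpret G: promonad_homomorphism P Q G using assms(2) by (rule promonad_homomorphismI)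
  show ?thesis
    unfolding modification_def nat_trans_iff Pro_Kleisli Ball_Hom
    using assms F.B.is_functor G.B.is_functor F.E.is_functor G.E.is_functor
    by (auto simp: Hom_iff F.tgt.Lact_eq F.tgt.Ract_eq)
qed

text \<open>Pointwise inverses form a modification for free: squares with inverted legs still
  commute, and the unit, being a functor, carries base inverses to Kleisli inverses, so the same
  argument works on both levels.\<close>

lemma invertible_modification_iff:
  assumes F: "promonad_hom P Q F" and G: "promonad_hom P Q G"
  shows "invertible_modification F G \<alpha> \<longleftrightarrow> modification F G \<alpha> \<and> (\<forall>X. iso_arrow (Base Q) (\<alpha> X))"
proof -
  interpret F: promonad_homomorphism P Q F using assms(1) by (rule promonad_homomorphismI)
  interpret G: promonad_homomorphism P Q G using assms(2) by (rule promonad_homomorphismI)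
  show ?thesis
  proof
    assume L: "invertible_modification F G \<alpha>"
    then obtain \<beta> where \<beta>: "modification G F \<beta>" "mod_vcomp (PTgt F) \<alpha> \<beta> = mod_id F"
      "mod_vcomp (PTgt F) \<beta> \<alpha> = mod_id G" and \<alpha>: "modification F G \<alpha>"
      unfolding invertible_modification_def by blast
    from \<alpha> \<beta> have "inverse_arrows (Base Q) (\<alpha> X) (\<beta> X)" for X
      unfolding modification_iff[OF F G] modification_iff[OF G F]
      by (auto simp: inverse_arrows_def nat_trans_def Hom_iff mod_vcomp_def mod_id_def fun_eq_iff)
    with \<alpha> show "modification F G \<alpha> \<and> (\<forall>X. iso_arrow (Base Q) (\<alpha> X))"
      by (auto simp: iso_arrow_def)
  next
    assume R: "modification F G \<alpha> \<and> (\<forall>X. iso_arrow (Base Q) (\<alpha> X))"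
    let ?\<beta> = "\<lambda>X. inv_arrow (Base Q) (\<alpha> X)"
    have H: "\<alpha> X \<in> Hom (Base Q) (FO (BF F) X) (FO (BF G) X)" for X
      using R unfolding modification_iff[OF F G] by (auto simp: nat_trans_def)
    then have A: "\<alpha> X \<in> Arr (Base Q)" for X by (simp add: Hom_iff)
    have [simp]: "iso_arrow (Kleisli Q) (Unit Q (\<alpha> X))" for X
      using F.tgt.Unit.FA_iso[of "\<alpha> X"] R A by simp
    have "Unit Q (?\<beta> X) = inv_arrow (Kleisli Q) (Unit Q (\<alpha> X))" for X
      using F.tgt.Unit.FA_inv[of "\<alpha> X"] R A by simp
    then have "modification G F ?\<beta>"
      using R nat_trans_inv[of "Base P" "Base Q" "BF F" "BF G" \<alpha>]
        nat_trans_inv[of "Kleisli P" "Kleisli Q" "Kleisli_fctr F" "Kleisli_fctr G" "\<lambda>X. Unit Q (\<alpha> X)"]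
      unfolding modification_iff[OF F G] modification_iff[OF G F] by simp
    moreover have "mod_vcomp (PTgt F) \<alpha> ?\<beta> = mod_id F" "mod_vcomp (PTgt F) ?\<beta> \<alpha> = mod_id G"
      using R H by (auto simp: mod_vcomp_def mod_id_def Hom_iff fun_eq_iff)
    ultimately show "invertible_modification F G \<alpha>"
      using R unfolding invertible_modification_def by blast
  qed
qed

section \<open>The pure tensor\<close>

lemma pt_path_append: "\<lbrakk>pt_path P Q s a t; pt_path P Q t b u\<rbrakk> \<Longrightarrow> pt_path P Q s (a @ b) u"
  by (induction rule: pt_path.induct) (auto intro: pt_path.intros)

lemma pt_path_single: "pt_gen P Q s g t \<Longrightarrow> pt_path P Q s [g] t"
  by (auto intro: pt_path.intros)

locale promonad_pair = P: promonad P + Q: promonad Q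
  for P :: "('o, 'v, 'p) promonad" and Q :: "('q, 'w, 'r) promonad"
begin

abbreviation "K \<equiv> Kleisli (P \<otimes>\<^sub>0 Q)"

lemma pt_gen_GC [simp]: "pt_gen P Q s (GC f Y) t \<longleftrightarrow>
    f \<in> Arr (Kleisli P) \<and> s = (Dom (Kleisli P) f, Y) \<and> t = (Cod (Kleisli P) f, Y)"
  by (auto simp: pt_gen.simps Pro_Kleisli Hom_iff)

lemma pt_gen_GD [simp]: "pt_gen P Q s (GD X g) t \<longleftrightarrow>
    g \<in> Arr (Kleisli Q) \<and> s = (X, Dom (Kleisli Q) g) \<and> t = (X, Cod (Kleisli Q) g)"
  by (auto simp: pt_gen.simps Pro_Kleisli Hom_iff)

lemma pt_gen_GV [simp]: "pt_gen P Q s (GV v Y) t \<longleftrightarrow>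
    v \<in> Arr (Base P) \<and> s = (Dom (Base P) v, Y) \<and> t = (Cod (Base P) v, Y)"
  by (auto simp: pt_gen.simps Hom_iff)

lemma pt_gen_GW [simp]: "pt_gen P Q s (GW X w) t \<longleftrightarrow>
    w \<in> Arr (Base Q) \<and> s = (X, Dom (Base Q) w) \<and> t = (X, Cod (Base Q) w)"
  by (auto simp: pt_gen.simps Hom_iff)

lemma pt_path_Nil [simp]: "pt_path P Q s [] t \<longleftrightarrow> s = t"
  by (auto elim: pt_path.cases intro: pt_path.intros)

lemma pt_path_Cons [simp]: "pt_path P Q s (g # a) u \<longleftrightarrow> (\<exists>t. pt_gen P Q s g t \<and> pt_path P Q t a u)"
  by (subst pt_path.simps) blast

lemma pt_eq_path: "pt_eq P Q s t a b \<Longrightarrow> pt_path P Q s a t \<and> pt_path P Q s b t"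
  by (induction rule: pt_eq.induct) (auto simp: Pro_Kleisli Hom_iff Kleisli_simps(4) simp flip: Idn_Kleisli intro: pt_path_append)

lemma pt_class_eqI: "pt_eq P Q s t a b \<Longrightarrow> pt_class P Q s a t = pt_class P Q s b t"
  by (auto simp: pt_class_def intro: pt_eq.sym pt_eq.trans)

text \<open>\<open>pt_Mult\<close> chooses no representatives; it collects everything congruent to a
  concatenation of representatives. By \<open>pt_eq.cong\<close> this is the class of any single
  concatenation.\<close>

lemma pt_Mult_class:
  assumes "pt_path P Q s a t" "pt_path P Q t b u"
  shows "pt_class P Q s a t \<Zcomp>\<^bsub>K\<^esub> pt_class P Q t b u = pt_class P Q s (a @ b) u"
proof -
  have "(\<exists>a'\<in>{c. pt_eq P Q s t a c}. \<exists>b'\<in>{c. pt_eq P Q t u b c}. pt_eq P Q s u (a' @ b') c)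
      \<longleftrightarrow> pt_eq P Q s u (a @ b) c" for c
    using assms by (auto intro: pt_eq.intros)
  then show ?thesis
    by (simp add: Kleisli_def pure_tensor_def pt_Mult_def pt_class_def)
qed

lemma Arr_K: "Arr K = pt_El P Q"
  by (simp add: Kleisli_def pure_tensor_def)

lemma Hom_K: "p \<in> Hom K s t \<longleftrightarrow> (\<exists>a. pt_path P Q s a t \<and> p = pt_class P Q s a t)"
  by (auto simp: Hom_def Kleisli_def pure_tensor_def pt_El_def pt_class_def simp del: split_paired_Ex)

lemma pt_class_Hom: "pt_path P Q s a t \<Longrightarrow> pt_class P Q s a t \<in> Hom K s t"
  unfolding Hom_K by blast

text \<open>A Kleisli identity is the unit of a pair of identities, hence the class of a path of two
  pure generators. Each is replaced by its unit (\<open>VC\<close>, \<open>WD\<close>), which is the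
  unit of an identity and can be deleted (\<open>C1\<close>, \<open>D1\<close>).\<close>

lemma Idn_K: "Idn K s = pt_class P Q s [] s"
proof (cases s)
  case (Pair X Y)
  let ?v = "Idn (Base P) X" and ?w = "Idn (Base Q) Y"
  have "pt_eq P Q s s [GV ?v Y] [GC (Unit P ?v) Y]" "pt_eq P Q s s [GC (Unit P ?v) Y] []"
    "pt_eq P Q s s [GW X ?w] [GD X (Unit Q ?w)]" "pt_eq P Q s s [GD X (Unit Q ?w)] []"
    unfolding Pair by (blast intro: pt_eq.intros P.V.Idn_Hom Q.V.Idn_Hom)+
  then have "pt_eq P Q s s ([GV ?v Y] @ [GW X ?w]) ([] @ [])"
    by (blast intro: pt_eq.cong pt_eq.trans)
  from pt_class_eqI[OF this] show ?thesis
    by (simp add: Kleisli_def pure_tensor_def prod_cat_def pt_Unit_def Pair)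
qed

lemma category_K: "category K"
proof
  show "Idn K s \<in> Hom K s s" for s
    by (simp add: Idn_K pt_class_Hom)
next
  fix p q s t u assume "p \<in> Hom K s t" "q \<in> Hom K t u"
  then show "p \<Zcomp>\<^bsub>K\<^esub> q \<in> Hom K s u"
    unfolding Hom_K using pt_Mult_class pt_path_append by metis
next
  fix p s t assume "p \<in> Hom K s t"
  then show "Idn K s \<Zcomp>\<^bsub>K\<^esub> p = p" "p \<Zcomp>\<^bsub>K\<^esub> Idn K t = p"
    by (auto simp: Hom_K pt_Mult_class Idn_K)
next
  fix p q r s t u v assume "p \<in> Hom K s t" "q \<in> Hom K t u" "r \<in> Hom K u v"
  then show "(p \<Zcomp>\<^bsub>K\<^esub> q) \<Zcomp>\<^bsub>K\<^esub> r = p \<Zcomp>\<^bsub>K\<^esub> (q \<Zcomp>\<^bsub>K\<^esub> r)"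
    by (auto simp: Hom_K pt_Mult_class pt_path_append)
qed

sublocale K: category K by (rule category_K)

lemma inC_class: "inC P Q f Y = pt_class P Q (Dom (Kleisli P) f, Y) [GC f Y] (Cod (Kleisli P) f, Y)"
  by (simp add: inC_def Kleisli_simps)

lemma inD_class: "inD P Q X g = pt_class P Q (X, Dom (Kleisli Q) g) [GD X g] (X, Cod (Kleisli Q) g)"
  by (simp add: inD_def Kleisli_simps)

lemma inC_Hom: "f \<in> Arr (Kleisli P) \<Longrightarrow>
    inC P Q f Y \<in> Hom K (Dom (Kleisli P) f, Y) (Cod (Kleisli P) f, Y)"
  by (simp add: inC_class pt_class_Hom)

lemma inD_Hom: "g \<in> Arr (Kleisli Q) \<Longrightarrow>
    inD P Q X g \<in> Hom K (X, Dom (Kleisli Q) g) (X, Cod (Kleisli Q) g)"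
  by (simp add: inD_class pt_class_Hom)

lemma inC_simps [simp]:
  assumes "f \<in> Arr (Kleisli P)"
  shows "inC P Q f Y \<in> Arr K" "Dom K (inC P Q f Y) = (Dom (Kleisli P) f, Y)"
    "Cod K (inC P Q f Y) = (Cod (Kleisli P) f, Y)"
  using inC_Hom[OF assms, of Y] by (auto simp: Hom_iff)

lemma inD_simps [simp]:
  assumes "g \<in> Arr (Kleisli Q)"
  shows "inD P Q X g \<in> Arr K" "Dom K (inD P Q X g) = (X, Dom (Kleisli Q) g)"
    "Cod K (inD P Q X g) = (X, Cod (Kleisli Q) g)"
  using inD_Hom[OF assms, of X] by (auto simp: Hom_iff)

lemma inC_Comp [simp]:
  assumes "f \<in> Arr (Kleisli P)" "f' \<in> Arr (Kleisli P)" "Cod (Kleisli P) f = Dom (Kleisli P) f'"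
  shows "inC P Q (f \<Zcomp>\<^bsub>Kleisli P\<^esub> f') Y = inC P Q f Y \<Zcomp>\<^bsub>K\<^esub> inC P Q f' Y"
proof -
  have "pt_eq P Q (Dom (Kleisli P) f, Y) (Cod (Kleisli P) f', Y) [GC f Y, GC f' Y] [GC (f \<Zcomp>\<^bsub>Kleisli P\<^esub> f') Y]"
    using pt_eq.CC[of f P "Dom (Kleisli P) f" "Cod (Kleisli P) f" f' "Cod (Kleisli P) f'"] assms
    by (simp add: Pro_Kleisli Hom_iff Kleisli_simps(4))
  from pt_class_eqI[OF this] show ?thesis
    using assms pt_Mult_class[of "(Dom (Kleisli P) f, Y)" "[GC f Y]" "(Cod (Kleisli P) f, Y)" "[GC f' Y]"]
    by (simp add: inC_class)
qed

lemma inD_Comp [simp]: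
  assumes "g \<in> Arr (Kleisli Q)" "g' \<in> Arr (Kleisli Q)" "Cod (Kleisli Q) g = Dom (Kleisli Q) g'"
  shows "inD P Q X (g \<Zcomp>\<^bsub>Kleisli Q\<^esub> g') = inD P Q X g \<Zcomp>\<^bsub>K\<^esub> inD P Q X g'"
proof -
  have "pt_eq P Q (X, Dom (Kleisli Q) g) (X, Cod (Kleisli Q) g') [GD X g, GD X g'] [GD X (g \<Zcomp>\<^bsub>Kleisli Q\<^esub> g')]"
    using pt_eq.DD[of g Q "Dom (Kleisli Q) g" "Cod (Kleisli Q) g" g' "Cod (Kleisli Q) g'"] assms
    by (simp add: Pro_Kleisli Hom_iff Kleisli_simps(4))
  from pt_class_eqI[OF this] show ?thesis
    using assms pt_Mult_class[of "(X, Dom (Kleisli Q) g)" "[GD X g]" "(X, Cod (Kleisli Q) g)" "[GD X g']"]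
    by (simp add: inD_class)
qed

lemma inC_Idn [simp]: "inC P Q (Idn (Kleisli P) X) Y = Idn K (X, Y)"
  using pt_class_eqI[OF pt_eq.C1[of P Q X Y]] by (simp add: inC_class Idn_K)

lemma inD_Idn [simp]: "inD P Q X (Idn (Kleisli Q) Y) = Idn K (X, Y)"
  using pt_class_eqI[OF pt_eq.D1[of P Q X Y]] by (simp add: inD_class Idn_K)

lemma pt_class_GV: "v \<in> Arr (Base P) \<Longrightarrow>
    pt_class P Q (Dom (Base P) v, Y) [GV v Y] (Cod (Base P) v, Y) = inC P Q (Unit P v) Y"
  using pt_class_eqI[OF pt_eq.VC[OF Arr_Hom]] by (simp add: inC_class)

lemma pt_class_GW: "w \<in> Arr (Base Q) \<Longrightarrow>
    pt_class P Q (X, Dom (Base Q) w) [GW X w] (X, Cod (Base Q) w) = inD P Q X (Unit Q w)"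
  using pt_class_eqI[OF pt_eq.WD[OF Arr_Hom]] by (simp add: inD_class)

lemma Unit_K: "\<lbrakk>v \<in> Arr (Base P); w \<in> Arr (Base Q)\<rbrakk> \<Longrightarrow> Unit (P \<otimes>\<^sub>0 Q) (v, w) =
    inC P Q (Unit P v) (Dom (Base Q) w) \<Zcomp>\<^bsub>K\<^esub> inD P Q (Cod (Base P) v) (Unit Q w)"
  by (subst pure_tensor_def) (simp add: pt_Unit_def pt_Mult_class flip: pt_class_GV pt_class_GW)

text \<open>Relation \<open>DV\<close> of the presentation, read between classes. The objects are
  variables tied by equations, so that the rule also applies where they occur in computed
  form.\<close>

lemma inC_Unit_inD:
  assumes "v \<in> Arr (Base P)" "g \<in> Arr (Kleisli Q)"
    "X = Dom (Base P) v" "X' = Cod (Base P) v" "Y = Dom (Kleisli Q) g" "Y' = Cod (Kleisli Q) g"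
  shows "inC P Q (Unit P v) Y \<Zcomp>\<^bsub>K\<^esub> inD P Q X' g = inD P Q X g \<Zcomp>\<^bsub>K\<^esub> inC P Q (Unit P v) Y'"
proof -
  have "pt_eq P Q (X, Y) (X', Y') [GD X g, GV v Y'] [GV v Y, GD X' g]"
    using assms by (intro pt_eq.DV) (auto simp: Pro_Kleisli Hom_iff)
  from pt_class_eqI[OF this] show ?thesis
    using assms pt_Mult_class[of "(X, Y)" "[GD X g]" "(X, Y')" "[GV v Y']" "(X', Y')"]
      pt_Mult_class[of "(X, Y)" "[GV v Y]" "(X', Y)" "[GD X' g]" "(X', Y')"]
    by (simp add: pt_class_GV inD_class[symmetric])
qed

lemma inC_inD_Unit:
  assumes "f \<in> Arr (Kleisli P)" "w \<in> Arr (Base Q)"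
    "X = Dom (Kleisli P) f" "X' = Cod (Kleisli P) f" "Y = Dom (Base Q) w" "Y' = Cod (Base Q) w"
  shows "inC P Q f Y \<Zcomp>\<^bsub>K\<^esub> inD P Q X' (Unit Q w) = inD P Q X (Unit Q w) \<Zcomp>\<^bsub>K\<^esub> inC P Q f Y'"
proof -
  have "pt_eq P Q (X, Y) (X', Y') [GC f Y, GW X' w] [GW X w, GC f Y']"
    using assms by (intro pt_eq.CW) (auto simp: Pro_Kleisli Hom_iff)
  from pt_class_eqI[OF this] show ?thesis
    using assms pt_Mult_class[of "(X, Y)" "[GC f Y]" "(X', Y)" "[GW X' w]" "(X', Y')"]
      pt_Mult_class[of "(X, Y)" "[GW X w]" "(X, Y')" "[GC f Y']" "(X', Y')"]
    by (simp add: pt_class_GW inC_class[symmetric])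
qed

lemma promonad_tensor: "promonad (P \<otimes>\<^sub>0 Q)"
  unfolding promonad_iff
proof (intro conjI allI ballI impI)
  show "category (Base (P \<otimes>\<^sub>0 Q))"
    by (simp add: pure_tensor_def category_prod_cat P.base Q.base)
  show "category K" by (rule category_K)
  have B: "Base (P \<otimes>\<^sub>0 Q) = prod_cat (Base P) (Base Q)"
    by (simp add: pure_tensor_def)
  show "Unit (P \<otimes>\<^sub>0 Q) f \<in> Hom K s t" if "f \<in> Hom (Base (P \<otimes>\<^sub>0 Q)) s t" for f s t
    using that by (cases f; cases s; cases t) (auto simp: B Unit_K Hom_iff)
  show "Unit (P \<otimes>\<^sub>0 Q) (f \<Zcomp>\<^bsub>Base (P \<otimes>\<^sub>0 Q)\<^esub> g) = Unit (P \<otimes>\<^sub>0 Q) f \<Zcomp>\<^bsub>K\<^esub> Unit (P \<otimes>\<^sub>0 Q) g"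
    if "f \<in> Arr (Base (P \<otimes>\<^sub>0 Q))" "g \<in> Arr (Base (P \<otimes>\<^sub>0 Q))"
      "Cod (Base (P \<otimes>\<^sub>0 Q)) f = Dom (Base (P \<otimes>\<^sub>0 Q)) g" for f g
  proof (cases f; cases g)
    fix v w v' w' assume f: "f = (v, w)" "g = (v', w')"
    have A: "v \<in> Arr (Base P)" "w \<in> Arr (Base Q)" "v' \<in> Arr (Base P)" "w' \<in> Arr (Base Q)"
      "Cod (Base P) v = Dom (Base P) v'" "Cod (Base Q) w = Dom (Base Q) w'"
      using that by (simp_all add: B f)
    let ?X = "Dom (Base P) v'" and ?Y = "Dom (Base Q) w" and ?X' = "Cod (Base P) v'" and ?Y' = "Dom (Base Q) w'"
    \<comment> \<open>The one step of functoriality that is not formal: to merge two pairs of pure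
      arrows, \<open>w\<close> has to slide past \<open>v'\<close>, an instance of the interchange
      of a pure arrow with an arbitrary one.\<close>
    have "inC P Q (Unit P v') ?Y \<Zcomp>\<^bsub>K\<^esub> (inD P Q ?X' (Unit Q w) \<Zcomp>\<^bsub>K\<^esub> inD P Q ?X' (Unit Q w'))
       = inD P Q ?X (Unit Q w) \<Zcomp>\<^bsub>K\<^esub> (inC P Q (Unit P v') ?Y' \<Zcomp>\<^bsub>K\<^esub> inD P Q ?X' (Unit Q w'))"
      using A by (intro K.Comp_reassoc inC_Unit_inD) auto
    then show ?thesis
      using A by (simp add: B f Unit_K K.assoc)
  qed
  show "Lact (P \<otimes>\<^sub>0 Q) f p = Unit (P \<otimes>\<^sub>0 Q) f \<Zcomp>\<^bsub>K\<^esub> p" "Ract (P \<otimes>\<^sub>0 Q) p f = p \<Zcomp>\<^bsub>K\<^esub> Unit (P \<otimes>\<^sub>0 Q) f" for f p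
    by (simp_all add: Kleisli_def pure_tensor_def)
qed

lemma Base_tensor [simp]: "Base (P \<otimes>\<^sub>0 Q) = prod_cat (Base P) (Base Q)"
  by (simp add: pure_tensor_def)

text \<open>Induction along a representing path. Pure generators get no cases of their own, because
  their classes are those of units under \<open>inC\<close> and \<open>inD\<close>.\<close>

lemma tensor_induct [consumes 1, case_names Idn inC inD Comp]:
  assumes "p \<in> Arr K"
    and Idn: "\<And>X Y. R (Idn K (X, Y))"
    and C: "\<And>f Y. f \<in> Arr (Kleisli P) \<Longrightarrow> R (inC P Q f Y)"
    and D: "\<And>X g. g \<in> Arr (Kleisli Q) \<Longrightarrow> R (inD P Q X g)"
    and Comp: "\<And>p q. \<lbrakk>p \<in> Arr K; q \<in> Arr K; Cod K p = Dom K q; R p; R q\<rbrakk> \<Longrightarrow> R (p \<Zcomp>\<^bsub>K\<^esub> q)"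
  shows "R p"
proof -
  have "R (pt_class P Q s a t)" if "pt_path P Q s a t" for s a t
    using that
  proof (induction rule: pt_path.induct)
    case (1 s)
    then show ?case using Idn by (cases s) (simp flip: Idn_K)
  next
    case (2 s g t gs u)
    have "R (pt_class P Q s [g] t)"
      using \<open>pt_gen P Q s g t\<close>
      by (cases g) (auto simp: pt_class_GV pt_class_GW C D simp flip: inC_class inD_class)
    moreover have "pt_class P Q s (g # gs) u = pt_class P Q s [g] t \<Zcomp>\<^bsub>K\<^esub> pt_class P Q t gs u"
      using 2 pt_Mult_class[of s "[g]" t gs u] by (simp add: pt_path_single del: pt_path_Cons)
    moreover have "pt_class P Q s [g] t \<in> Hom K s t" "pt_class P Q t gs u \<in> Hom K t u"
      using 2 by (simp_all add: pt_class_Hom pt_path_single del: pt_path_Cons)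
    ultimately show ?case using 2 by (auto simp: Hom_iff intro: Comp)
  qed
  then show ?thesis using Arr_Hom[OF assms(1)] unfolding Hom_K by metis
qed

end

sublocale promonad_pair \<subseteq> PQ: promonad "P \<otimes>\<^sub>0 Q" by (rule promonad_tensor)

lemma promonad_pairI: "promonad P \<Longrightarrow> promonad Q \<Longrightarrow> promonad_pair P Q"
  by (simp add: promonad_pair_def)

section \<open>Functors and transformations out of the pure tensor\<close>

locale tensor_interp = promonad_pair P Q + D: category D
  for P :: "('o, 'v, 'p) promonad" and Q :: "('q, 'w, 'r) promonad" and D :: "('x, 'a) cat" +
  fixes h :: "'o \<times> 'q \<Rightarrow> 'x" and c :: "'p \<Rightarrow> 'q \<Rightarrow> 'a" and d :: "'o \<Rightarrow> 'r \<Rightarrow> 'a"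
  assumes c_functor: "\<And>Y. is_functor (Kleisli P) D \<lparr>FO = (\<lambda>X. h (X, Y)), FA = restrict (\<lambda>f. c f Y) (Arr (Kleisli P))\<rparr>"
    and d_functor: "\<And>X. is_functor (Kleisli Q) D \<lparr>FO = (\<lambda>Y. h (X, Y)), FA = restrict (d X) (Arr (Kleisli Q))\<rparr>"
    and c_d_Unit: "\<And>f w. \<lbrakk>f \<in> Arr (Kleisli P); w \<in> Arr (Base Q)\<rbrakk> \<Longrightarrow>
      c f (Dom (Base Q) w) \<Zcomp>\<^bsub>D\<^esub> d (Cod (Kleisli P) f) (Unit Q w)
      = d (Dom (Kleisli P) f) (Unit Q w) \<Zcomp>\<^bsub>D\<^esub> c f (Cod (Base Q) w)"
    and c_Unit_d: "\<And>v g. \<lbrakk>v \<in> Arr (Base P); g \<in> Arr (Kleisli Q)\<rbrakk> \<Longrightarrow>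
      d (Dom (Base P) v) g \<Zcomp>\<^bsub>D\<^esub> c (Unit P v) (Cod (Kleisli Q) g)
      = c (Unit P v) (Dom (Kleisli Q) g) \<Zcomp>\<^bsub>D\<^esub> d (Cod (Base P) v) g"
begin

sublocale c: cat_functor "Kleisli P" D "\<lparr>FO = (\<lambda>X. h (X, Y)), FA = restrict (\<lambda>f. c f Y) (Arr (Kleisli P))\<rparr>" for Y
  by (rule cat_functorI[OF c_functor])
sublocale d: cat_functor "Kleisli Q" D "\<lparr>FO = (\<lambda>Y. h (X, Y)), FA = restrict (d X) (Arr (Kleisli Q))\<rparr>" for X
  by (rule cat_functorI[OF d_functor])

lemma c_simps [simp]:
  assumes "f \<in> Arr (Kleisli P)"
  shows "c f Y \<in> Arr D" "Dom D (c f Y) = h (Dom (Kleisli P) f, Y)" "Cod D (c f Y) = h (Cod (Kleisli P) f, Y)"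
  using c.FA_simps[OF assms, of Y] assms by simp_all

lemma d_simps [simp]:
  assumes "g \<in> Arr (Kleisli Q)"
  shows "d X g \<in> Arr D" "Dom D (d X g) = h (X, Dom (Kleisli Q) g)" "Cod D (d X g) = h (X, Cod (Kleisli Q) g)"
  using d.FA_simps[OF assms, of X] assms by simp_all

lemma c_Comp [simp]: "\<lbrakk>f \<in> Arr (Kleisli P); f' \<in> Arr (Kleisli P); Cod (Kleisli P) f = Dom (Kleisli P) f'\<rbrakk>
    \<Longrightarrow> c (f \<Zcomp>\<^bsub>Kleisli P\<^esub> f') Y = c f Y \<Zcomp>\<^bsub>D\<^esub> c f' Y"
  using c.FA_Comp[of f f' Y] by simp

lemma d_Comp [simp]: "\<lbrakk>g \<in> Arr (Kleisli Q); g' \<in> Arr (Kleisli Q); Cod (Kleisli Q) g = Dom (Kleisli Q) g'\<rbrakk>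
    \<Longrightarrow> d X (g \<Zcomp>\<^bsub>Kleisli Q\<^esub> g') = d X g \<Zcomp>\<^bsub>D\<^esub> d X g'"
  using d.FA_Comp[of g g' X] by simp

lemma c_Idn [simp]: "c (Idn (Kleisli P) X) Y = Idn D (h (X, Y))"
  using c.FA_Idn[of Y X] by simp

lemma d_Idn [simp]: "d X (Idn (Kleisli Q) Y) = Idn D (h (X, Y))"
  using d.FA_Idn[of X Y] by simp

abbreviation "E \<equiv> pt_eval P Q D c d"

lemma eval_Hom: "pt_path P Q s a t \<Longrightarrow> E (h t) a \<in> Hom D (h s) (h t)"
proof (induction rule: pt_path.induct)
  case (2 s g t gs u)
  then show ?case by (cases g) (auto simp: Hom_iff)
qed (simp add: Hom_iff)

lemma eval_append:
  "\<lbrakk>pt_path P Q s a t; pt_path P Q t b u\<rbrakk> \<Longrightarrow> E (h u) (a @ b) = E (h t) a \<Zcomp>\<^bsub>D\<^esub> E (h u) b"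
proof (induction rule: pt_path.induct)
  case (1 s)
  then show ?case using eval_Hom[of s b u] by (auto simp: Hom_iff)
next
  case (2 s g t gs v)
  then show ?case using eval_Hom[of v b u] eval_Hom[of t gs v]
    by (cases g) (auto simp: Hom_iff D.assoc)
qed

text \<open>Soundness of the presentation. Functoriality of \<open>c\<close> and \<open>d\<close>
  settles \<open>CC\<close>, \<open>C1\<close>, \<open>DD\<close> and \<open>D1\<close>; the
  assumptions \<open>c_d_Unit\<close> and \<open>c_Unit_d\<close> are \<open>CW\<close> and
  \<open>DV\<close>; \<open>VC\<close> and \<open>WD\<close> hold by the clauses of
  \<open>pt_eval\<close> for pure generators.\<close>

lemma eval_eq: "pt_eq P Q s t a b \<Longrightarrow> E (h t) a = E (h t) b"
proof (induction rule: pt_eq.induct)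
  case (cong s t a a' u b b')
  then show ?case using eval_append pt_eq_path by metis
qed (auto simp: Pro_Kleisli Hom_iff c_d_Unit c_Unit_d Kleisli_simps(4) D.assoc simp flip: Idn_Kleisli)

abbreviation "ext \<equiv> pt_ext P Q D h c d"

text \<open>\<open>pt_ext\<close> evaluates a representative picked by choice; it is congruent to
  \<open>a\<close>, and evaluation is constant on congruence classes.\<close>

lemma ext_class:
  assumes "pt_path P Q s a t"
  shows "ext (pt_class P Q s a t) = E (h t) a"
proof -
  have "pt_eq P Q s t a (SOME b. pt_eq P Q s t a b)"
    using someI[of "pt_eq P Q s t a", OF pt_eq.refl[OF assms]] .
  from eval_eq[OF this] show ?thesis
    using assms unfolding pt_ext_def
    by (auto simp: pt_class_def pt_El_def simp del: split_paired_Ex split_paired_All)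
qed

lemma is_functor_ext: "is_functor K D \<lparr>FO = h, FA = ext\<rparr>"
  unfolding is_functor_def
proof (intro conjI allI ballI)
  show "category K" "category D" by (rule K.category_axioms D.category_axioms)+
  show "FA \<lparr>FO = h, FA = ext\<rparr> \<in> extensional (Arr K)"
    by (simp add: pt_ext_def Arr_K)
  show "FA \<lparr>FO = h, FA = ext\<rparr> p \<in> Hom D (FO \<lparr>FO = h, FA = ext\<rparr> s) (FO \<lparr>FO = h, FA = ext\<rparr> t)"
    if "p \<in> Hom K s t" for p s t
    using that unfolding Hom_K by (auto simp: ext_class simp del: split_paired_Ex split_paired_All intro: eval_Hom)
  show "FA \<lparr>FO = h, FA = ext\<rparr> (Idn K s) = Idn D (FO \<lparr>FO = h, FA = ext\<rparr> s)" for s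
    by (simp add: Idn_K ext_class)
  show "FA \<lparr>FO = h, FA = ext\<rparr> (p \<Zcomp>\<^bsub>K\<^esub> q) = FA \<lparr>FO = h, FA = ext\<rparr> p \<Zcomp>\<^bsub>D\<^esub> FA \<lparr>FO = h, FA = ext\<rparr> q"
    if "p \<in> Hom K s t" "q \<in> Hom K t u" for p q s t u
    using that by (auto simp: Hom_K pt_Mult_class ext_class eval_append pt_path_append)
qed

lemma ext_inC [simp]: "f \<in> Arr (Kleisli P) \<Longrightarrow> ext (inC P Q f Y) = c f Y"
  by (simp add: inC_class ext_class)

lemma ext_inD [simp]: "g \<in> Arr (Kleisli Q) \<Longrightarrow> ext (inD P Q X g) = d X g"
  by (simp add: inD_class ext_class)

end

text \<open>A functor on the Kleisli category becomes a homomorphism as soon as it matches the base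
  functor on units. A unit of the tensor is a composite of one pure arrow from each factor, whence
  the form of hypothesis \<open>U\<close>.\<close>

lemma promonad_hom_ext:
  assumes "tensor_interp P Q (Kleisli R) h c d" "promonad R"
    and B: "is_functor (prod_cat (Base P) (Base Q)) (Base R) B" "FO B = h"
    and U: "\<And>v w. \<lbrakk>v \<in> Arr (Base P); w \<in> Arr (Base Q)\<rbrakk> \<Longrightarrow>
      c (Unit P v) (Dom (Base Q) w) \<Zcomp>\<^bsub>Kleisli R\<^esub> d (Cod (Base P) v) (Unit Q w) = Unit R (FA B (v, w))"
  shows "promonad_hom (P \<otimes>\<^sub>0 Q) R \<lparr>PSrc = P \<otimes>\<^sub>0 Q, PTgt = R, BF = B, EF = pt_ext P Q (Kleisli R) h c d\<rparr>"
proof -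
  interpret tensor_interp P Q "Kleisli R" h c d by fact
  interpret ext: cat_functor K "Kleisli R" "\<lparr>FO = h, FA = ext\<rparr>"
    by (rule cat_functorI[OF is_functor_ext])
  show ?thesis
    unfolding promonad_hom_iff
    using is_functor_ext B U PQ.promonad_axioms assms(2) ext.FA_Comp
    by (auto simp: Kleisli_fctr_def Unit_K)
qed

text \<open>The arrows at which \<open>\<tau>\<close> is natural contain the identities and are
  closed under composition, so \<open>tensor_induct\<close> leaves only the two families of
  generators.\<close>

lemma nat_trans_tensor_iff:
  assumes "promonad P" "promonad Q"
    and "is_functor (Kleisli (P \<otimes>\<^sub>0 Q)) D F" "is_functor (Kleisli (P \<otimes>\<^sub>0 Q)) D G"
  shows "nat_trans (Kleisli (P \<otimes>\<^sub>0 Q)) D F G \<tau> \<longleftrightarrow> (\<forall>s. \<tau> s \<in> Hom D (FO F s) (FO G s)) \<and>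
    (\<forall>f\<in>Arr (Kleisli P). \<forall>Y. FA F (inC P Q f Y) \<Zcomp>\<^bsub>D\<^esub> \<tau> (Cod (Kleisli P) f, Y)
      = \<tau> (Dom (Kleisli P) f, Y) \<Zcomp>\<^bsub>D\<^esub> FA G (inC P Q f Y)) \<and>
    (\<forall>g\<in>Arr (Kleisli Q). \<forall>X. FA F (inD P Q X g) \<Zcomp>\<^bsub>D\<^esub> \<tau> (X, Cod (Kleisli Q) g)
      = \<tau> (X, Dom (Kleisli Q) g) \<Zcomp>\<^bsub>D\<^esub> FA G (inD P Q X g))" (is "_ \<longleftrightarrow> ?R")
proof -
  interpret promonad_pair P Q using assms by (simp add: promonad_pairI)
  interpret F: cat_functor K D F by (rule cat_functorI) fact
  interpret G: cat_functor K D G by (rule cat_functorI) fact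
  have "FA F p \<Zcomp>\<^bsub>D\<^esub> \<tau> (Cod K p) = \<tau> (Dom K p) \<Zcomp>\<^bsub>D\<^esub> FA G p" if ?R "p \<in> Arr K" for p
    using that(2)
  proof (induction rule: tensor_induct)
    case (Idn X Y)
    then show ?case using that(1) by (simp add: Hom_iff)
  next
    case (Comp p q)
    then show ?case
      using that(1) F.tgt.natural_Comp[of "FA F p" "FA F q" "FA G p" "FA G q" "\<tau> (Dom K p)" "\<tau> (Cod K p)" "\<tau> (Cod K q)"]
      by (simp add: Hom_iff del: split_paired_All)
  qed (use that(1) in auto)
  moreover have ?R if "nat_trans K D F G \<tau>"
    using that inC_simps inD_simps unfolding nat_trans_iff by metis
  ultimately show ?thesis
    unfolding nat_trans_iff using assms(3,4) by blast
qed

text \<open>The generators that the outer tensor takes from \<open>P \<otimes>\<^sub>0 Q\<close> are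
  indexed by arbitrary arrows of the inner one. As \<open>inC\<close> is functorial in that index, a
  second induction reduces them to inner generators.\<close>

lemma nat_trans_tensor3_iff:
  assumes P: "promonad P" "promonad Q" "promonad R"
    and F: "is_functor (Kleisli ((P \<otimes>\<^sub>0 Q) \<otimes>\<^sub>0 R)) D F" "is_functor (Kleisli ((P \<otimes>\<^sub>0 Q) \<otimes>\<^sub>0 R)) D G"
  shows "nat_trans (Kleisli ((P \<otimes>\<^sub>0 Q) \<otimes>\<^sub>0 R)) D F G \<tau> \<longleftrightarrow> (\<forall>s. \<tau> s \<in> Hom D (FO F s) (FO G s)) \<and>
    (\<forall>f\<in>Arr (Kleisli P). \<forall>Y Z. FA F (inC (P \<otimes>\<^sub>0 Q) R (inC P Q f Y) Z) \<Zcomp>\<^bsub>D\<^esub> \<tau> ((Cod (Kleisli P) f, Y), Z)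
      = \<tau> ((Dom (Kleisli P) f, Y), Z) \<Zcomp>\<^bsub>D\<^esub> FA G (inC (P \<otimes>\<^sub>0 Q) R (inC P Q f Y) Z)) \<and>
    (\<forall>g\<in>Arr (Kleisli Q). \<forall>X Z. FA F (inC (P \<otimes>\<^sub>0 Q) R (inD P Q X g) Z) \<Zcomp>\<^bsub>D\<^esub> \<tau> ((X, Cod (Kleisli Q) g), Z)
      = \<tau> ((X, Dom (Kleisli Q) g), Z) \<Zcomp>\<^bsub>D\<^esub> FA G (inC (P \<otimes>\<^sub>0 Q) R (inD P Q X g) Z)) \<and>
    (\<forall>k\<in>Arr (Kleisli R). \<forall>X Y. FA F (inD (P \<otimes>\<^sub>0 Q) R (X, Y) k) \<Zcomp>\<^bsub>D\<^esub> \<tau> ((X, Y), Cod (Kleisli R) k)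
      = \<tau> ((X, Y), Dom (Kleisli R) k) \<Zcomp>\<^bsub>D\<^esub> FA G (inD (P \<otimes>\<^sub>0 Q) R (X, Y) k))" (is "_ \<longleftrightarrow> ?R")
proof -
  interpret PQ: promonad_pair P Q using assms by (simp add: promonad_pairI)
  interpret T: promonad_pair "P \<otimes>\<^sub>0 Q" R using assms PQ.promonad_tensor by (simp add: promonad_pairI)
  interpret F: cat_functor "Kleisli ((P \<otimes>\<^sub>0 Q) \<otimes>\<^sub>0 R)" D F by (rule cat_functorI) fact
  interpret G: cat_functor "Kleisli ((P \<otimes>\<^sub>0 Q) \<otimes>\<^sub>0 R)" D G by (rule cat_functorI) fact
  have "FA F (inC (P \<otimes>\<^sub>0 Q) R p Z) \<Zcomp>\<^bsub>D\<^esub> \<tau> (Cod PQ.K p, Z) = \<tau> (Dom PQ.K p, Z) \<Zcomp>\<^bsub>D\<^esub> FA G (inC (P \<otimes>\<^sub>0 Q) R p Z)"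
    if ?R "p \<in> Arr PQ.K" for p Z
    using that(2)
  proof (induction rule: PQ.tensor_induct)
    case (Idn X Y)
    then show ?case using that(1) by (simp add: Hom_iff)
  next
    case (Comp p q)
    then show ?case
      using that(1) F.tgt.natural_Comp[of "FA F (inC (P \<otimes>\<^sub>0 Q) R p Z)" "FA F (inC (P \<otimes>\<^sub>0 Q) R q Z)" "FA G (inC (P \<otimes>\<^sub>0 Q) R p Z)"
          "FA G (inC (P \<otimes>\<^sub>0 Q) R q Z)" "\<tau> (Dom PQ.K p, Z)" "\<tau> (Cod PQ.K p, Z)" "\<tau> (Cod PQ.K q, Z)"]
      by (simp add: Hom_iff del: split_paired_All)
  qed (use that(1) in auto)
  then show ?thesis
    unfolding nat_trans_tensor_iff[OF PQ.promonad_tensor assms(3) F]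
    by (auto simp: split_paired_all) (metis surj_pair PQ.inC_simps PQ.inD_simps)+
qed

section \<open>The operations on homomorphisms\<close>

lemma hom_id_simps [simp]:
  "PSrc (hom_id P) = P" "PTgt (hom_id P) = P" "FO (BF (hom_id P)) X = X"
  "f \<in> Arr (Base P) \<Longrightarrow> FA (BF (hom_id P)) f = f" "p \<in> Arr (Kleisli P) \<Longrightarrow> EF (hom_id P) p = p"
  by (simp_all add: hom_id_def Kleisli_simps)

lemma hom_comp_simps [simp]:
  "PSrc (G \<circ>\<^sub>1 F) = PSrc F" "PTgt (G \<circ>\<^sub>1 F) = PTgt G"
  "FO (BF (G \<circ>\<^sub>1 F)) X = FO (BF G) (FO (BF F) X)"
  "f \<in> Arr (Base (PSrc F)) \<Longrightarrow> FA (BF (G \<circ>\<^sub>1 F)) f = FA (BF G) (FA (BF F) f)"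
  "p \<in> Arr (Kleisli (PSrc F)) \<Longrightarrow> EF (G \<circ>\<^sub>1 F) p = EF G (EF F p)"
  by (simp_all add: hom_comp_def Kleisli_simps)

lemma hom_tensor_simps [simp]:
  "PSrc (F \<otimes>\<^sub>1 G) = PSrc F \<otimes>\<^sub>0 PSrc G" "PTgt (F \<otimes>\<^sub>1 G) = PTgt F \<otimes>\<^sub>0 PTgt G"
  "FO (BF (F \<otimes>\<^sub>1 G)) (X, Y) = (FO (BF F) X, FO (BF G) Y)"
  "\<lbrakk>v \<in> Arr (Base (PSrc F)); w \<in> Arr (Base (PSrc G))\<rbrakk> \<Longrightarrow>
    FA (BF (F \<otimes>\<^sub>1 G)) (v, w) = (FA (BF F) v, FA (BF G) w)"
  by (simp_all add: hom_tensor_def)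

lemma hom_assoc_simps [simp]:
  "PSrc (hom_assoc P Q R) = (P \<otimes>\<^sub>0 Q) \<otimes>\<^sub>0 R" "PTgt (hom_assoc P Q R) = P \<otimes>\<^sub>0 (Q \<otimes>\<^sub>0 R)"
  "FO (BF (hom_assoc P Q R)) ((X, Y), Z) = (X, (Y, Z))"
  "\<lbrakk>f \<in> Arr (Base P); g \<in> Arr (Base Q); k \<in> Arr (Base R)\<rbrakk> \<Longrightarrow> FA (BF (hom_assoc P Q R)) ((f, g), k) = (f, (g, k))"
  by (simp_all add: hom_assoc_def)

lemma hom_lunit_simps [simp]:
  "PSrc (hom_lunit P) = unit_promonad \<otimes>\<^sub>0 P" "PTgt (hom_lunit P) = P" "FO (BF (hom_lunit P)) (x, X) = X"
  "f \<in> Arr (Base P) \<Longrightarrow> FA (BF (hom_lunit P)) (x, f) = f"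
  by (simp_all add: hom_lunit_def)

lemma hom_runit_simps [simp]:
  "PSrc (hom_runit P) = P \<otimes>\<^sub>0 unit_promonad" "PTgt (hom_runit P) = P" "FO (BF (hom_runit P)) (X, x) = X"
  "f \<in> Arr (Base P) \<Longrightarrow> FA (BF (hom_runit P)) (f, x) = f"
  by (simp_all add: hom_runit_def)

lemma unit_promonad_simps [simp]:
  "Base unit_promonad = terminal_cat" "Arr (Kleisli unit_promonad) = UNIV"
  by (simp_all add: unit_promonad_def Kleisli_def)

lemma promonad_unit: "promonad unit_promonad"
  by unfold_locales (auto simp: unit_promonad_def terminal_cat_def Hom_iff Pro_def)

section \<open>Tensor products of homomorphisms\<close>

locale hom_pair = F: promonad_homomorphism P P' F + G: promonad_homomorphism Q Q' G
  for P :: "('o, 'v, 'p) promonad" and P' :: "('o1, 'v1, 'p1) promonad" and F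
    and Q :: "('q, 'w, 'r) promonad" and Q' :: "('q1, 'w1, 'r1) promonad" and G
begin

sublocale src: promonad_pair P Q ..
sublocale tgt: promonad_pair P' Q' ..

text \<open>The interchange conditions survive because a homomorphism sends units to units: the
  image of a pure arrow is pure, so the relations of the target tensor apply.\<close>

sublocale interp: tensor_interp P Q tgt.K "map_prod (FO (BF F)) (FO (BF G))"
  "\<lambda>f Y. inC P' Q' (EF F f) (FO (BF G) Y)" "\<lambda>X g. inD P' Q' (FO (BF F) X) (EF G g)"
  by unfold_locales
    (auto simp: is_functor_iff F.src.K.category_axioms G.src.K.category_axioms tgt.K.category_axioms Hom_iff
      intro!: tgt.inC_inD_Unit tgt.inC_Unit_inD[symmetric])

lemma tensor_hom: "promonad_hom (P \<otimes>\<^sub>0 Q) (P' \<otimes>\<^sub>0 Q') (F \<otimes>\<^sub>1 G)"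
  unfolding hom_tensor_def F.PSrc F.PTgt G.PSrc G.PTgt
  by (intro promonad_hom_ext interp.tensor_interp_axioms tgt.promonad_tensor)
    (auto simp: tgt.Unit_K intro!: is_functor_prod F.B.is_functor G.B.is_functor)

lemma tensor_inC: "f \<in> Arr (Kleisli P) \<Longrightarrow> EF (F \<otimes>\<^sub>1 G) (inC P Q f Y) = inC P' Q' (EF F f) (FO (BF G) Y)"
  by (simp add: hom_tensor_def)

lemma tensor_inD: "g \<in> Arr (Kleisli Q) \<Longrightarrow> EF (F \<otimes>\<^sub>1 G) (inD P Q X g) = inD P' Q' (FO (BF F) X) (EF G g)"
  by (simp add: hom_tensor_def)

end

lemma hom_pairI: "promonad_hom P P' F \<Longrightarrow> promonad_hom Q Q' G \<Longrightarrow> hom_pair P P' F Q Q' G"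
  by (simp add: hom_pair_def promonad_homomorphismI)

section \<open>The associator of the pure tensor\<close>

locale promonad_triple = P: promonad P + Q: promonad Q + R: promonad R
  for P :: "('o, 'v, 'p) promonad" and Q :: "('q, 'w, 'r) promonad" and R :: "('x, 'y, 'z) promonad"
begin

sublocale PQ: promonad_pair P Q ..
sublocale QR: promonad_pair Q R ..
sublocale PQ_R: promonad_pair "P \<otimes>\<^sub>0 Q" R ..
sublocale P_QR: promonad_pair P "Q \<otimes>\<^sub>0 R" ..

lemma inD_Unit_assoc:
  "\<lbrakk>w \<in> Arr (Base Q); y \<in> Arr (Base R)\<rbrakk> \<Longrightarrow>
    inD P (Q \<otimes>\<^sub>0 R) X (inC Q R (Unit Q w) (Dom (Base R) y)) \<Zcomp>\<^bsub>P_QR.K\<^esub> inD P (Q \<otimes>\<^sub>0 R) X (inD Q R (Cod (Base Q) w) (Unit R y))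
    = inD P (Q \<otimes>\<^sub>0 R) X (Unit (Q \<otimes>\<^sub>0 R) (w, y))"
  by (simp add: QR.Unit_K)

text \<open>A pure arrow of \<open>Q\<close> paired with an identity is pure in
  \<open>Q \<otimes>\<^sub>0 R\<close>. This brings generators of the inner tensor under the
  interchange relations of the outer one.\<close>

lemma Unit_inC: "w \<in> Arr (Base Q) \<Longrightarrow> Unit (Q \<otimes>\<^sub>0 R) (w, Idn (Base R) Z) = inC Q R (Unit Q w) Z"
  by (simp add: QR.Unit_K)

lemma Unit_inD: "y \<in> Arr (Base R) \<Longrightarrow> Unit (Q \<otimes>\<^sub>0 R) (Idn (Base Q) Y, y) = inD Q R Y (Unit R y)"
  by (simp add: QR.Unit_K)

lemma inC_inD_inC:
  "\<lbrakk>f \<in> Arr (Kleisli P); w \<in> Arr (Base Q)\<rbrakk> \<Longrightarrow>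
    inC P (Q \<otimes>\<^sub>0 R) f (Dom (Base Q) w, Z) \<Zcomp>\<^bsub>P_QR.K\<^esub> inD P (Q \<otimes>\<^sub>0 R) (Cod (Kleisli P) f) (inC Q R (Unit Q w) Z)
    = inD P (Q \<otimes>\<^sub>0 R) (Dom (Kleisli P) f) (inC Q R (Unit Q w) Z) \<Zcomp>\<^bsub>P_QR.K\<^esub> inC P (Q \<otimes>\<^sub>0 R) f (Cod (Base Q) w, Z)"
  using P_QR.inC_inD_Unit[of f "(w, Idn (Base R) Z)"] by (simp add: Unit_inC)

lemma inC_inD_inD:
  "\<lbrakk>f \<in> Arr (Kleisli P); y \<in> Arr (Base R)\<rbrakk> \<Longrightarrow>
    inC P (Q \<otimes>\<^sub>0 R) f (Y, Dom (Base R) y) \<Zcomp>\<^bsub>P_QR.K\<^esub> inD P (Q \<otimes>\<^sub>0 R) (Cod (Kleisli P) f) (inD Q R Y (Unit R y))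
    = inD P (Q \<otimes>\<^sub>0 R) (Dom (Kleisli P) f) (inD Q R Y (Unit R y)) \<Zcomp>\<^bsub>P_QR.K\<^esub> inC P (Q \<otimes>\<^sub>0 R) f (Y, Cod (Base R) y)"
  using P_QR.inC_inD_Unit[of f "(Idn (Base Q) Y, y)"] by (simp add: Unit_inD)

text \<open>The part of the associator that acts on the arrows of
  \<open>P \<otimes>\<^sub>0 Q\<close>, at a fixed object \<open>Z\<close> of the third factor. Its
  interchange conditions are relations of the target tensor.\<close>

sublocale inner: tensor_interp P Q P_QR.K "\<lambda>(X, Y). (X, (Y, Z))"
  "\<lambda>f Y. inC P (Q \<otimes>\<^sub>0 R) f (Y, Z)" "\<lambda>X g. inD P (Q \<otimes>\<^sub>0 R) X (inC Q R g Z)" for Z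
  by unfold_locales
    (auto simp: is_functor_iff P.K.category_axioms Q.K.category_axioms P_QR.K.category_axioms Hom_iff
      inC_inD_inC P_QR.inC_Unit_inD)

sublocale inner_functor: cat_functor PQ.K P_QR.K "\<lparr>FO = (\<lambda>(X, Y). (X, (Y, Z))), FA = inner.ext Z\<rparr>" for Z
  by (intro cat_functorI inner.is_functor_ext)

text \<open>The law is required for all arrows of the inner tensor, since the outer presentation has
  them as generators. Generators from \<open>P\<close> use the relations of the target tensor; those
  from \<open>Q\<close> use the relations of \<open>Q \<otimes>\<^sub>0 R\<close>, transported along
  \<open>inD\<close>; composites paste.\<close>

lemma inner_inD_Unit:
  assumes "p \<in> Arr PQ.K" and y: "y \<in> Arr (Base R)"
  shows "inner.ext (Dom (Base R) y) p \<Zcomp>\<^bsub>P_QR.K\<^esub>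
      (case Cod PQ.K p of (X, Y) \<Rightarrow> inD P (Q \<otimes>\<^sub>0 R) X (inD Q R Y (Unit R y)))
    = (case Dom PQ.K p of (X, Y) \<Rightarrow> inD P (Q \<otimes>\<^sub>0 R) X (inD Q R Y (Unit R y))) \<Zcomp>\<^bsub>P_QR.K\<^esub>
      inner.ext (Cod (Base R) y) p"
  using assms(1)
proof (induction rule: PQ.tensor_induct)
  case (Idn X Y)
  then show ?case
    using y inner_functor.FA_Idn[of "Dom (Base R) y" "(X, Y)"] inner_functor.FA_Idn[of "Cod (Base R) y" "(X, Y)"]
    by simp
next
  case (inC f Y)
  then show ?case using y by (simp add: inC_inD_inD)
next
  case (inD X g)
  then show ?case
    using y QR.inC_inD_Unit[of g y "Dom (Kleisli Q) g" "Cod (Kleisli Q) g"] by (simp flip: P_QR.inD_Comp)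
next
  case (Comp p q)
  obtain X Y X' Y' X'' Y'' where "Dom PQ.K p = (X, Y)" "Dom PQ.K q = (X', Y')" "Cod PQ.K q = (X'', Y'')"
    by fastforce
  note D = this
  have F: "inner.ext Z r \<in> Hom P_QR.K (case Dom PQ.K r of (X, Y) \<Rightarrow> (X, (Y, Z))) (case Cod PQ.K r of (X, Y) \<Rightarrow> (X, (Y, Z)))"
    if "r \<in> Arr PQ.K" for r Z
    using inner_functor.FA_simps[OF that, of Z] by (simp add: Hom_iff)
  have "inner.ext Z (p \<Zcomp>\<^bsub>PQ.K\<^esub> q) = inner.ext Z p \<Zcomp>\<^bsub>P_QR.K\<^esub> inner.ext Z q" for Z
    using inner_functor.FA_Comp[of p q Z] Comp by simp
  moreover have "Dom PQ.K (p \<Zcomp>\<^bsub>PQ.K\<^esub> q) = (X, Y)" "Cod PQ.K (p \<Zcomp>\<^bsub>PQ.K\<^esub> q) = (X'', Y'')" "Cod PQ.K p = (X', Y')"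
    using Comp D by auto
  moreover have "(inner.ext (Dom (Base R) y) p \<Zcomp>\<^bsub>P_QR.K\<^esub> inner.ext (Dom (Base R) y) q) \<Zcomp>\<^bsub>P_QR.K\<^esub> inD P (Q \<otimes>\<^sub>0 R) X'' (inD Q R Y'' (Unit R y))
    = inD P (Q \<otimes>\<^sub>0 R) X (inD Q R Y (Unit R y)) \<Zcomp>\<^bsub>P_QR.K\<^esub> (inner.ext (Cod (Base R) y) p \<Zcomp>\<^bsub>P_QR.K\<^esub> inner.ext (Cod (Base R) y) q)"
    using Comp.IH F[OF \<open>p \<in> Arr PQ.K\<close>] F[OF \<open>q \<in> Arr PQ.K\<close>] y D \<open>Cod PQ.K p = (X', Y')\<close>
    by (intro P_QR.K.natural_Comp[where t = "inD P (Q \<otimes>\<^sub>0 R) X' (inD Q R Y' (Unit R y))"]) (simp_all add: Hom_iff)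
  ultimately show ?case by (simp only: D prod.case)
qed

sublocale outer: tensor_interp "P \<otimes>\<^sub>0 Q" R P_QR.K "\<lambda>((X, Y), Z). (X, (Y, Z))"
  "\<lambda>p Z. inner.ext Z p" "\<lambda>(X, Y) k. inD P (Q \<otimes>\<^sub>0 R) X (inD Q R Y k)"
proof unfold_locales
  show "is_functor PQ.K P_QR.K \<lparr>FO = \<lambda>X. case (X, Z) of (x, xa) \<Rightarrow> (case x of (X, Y) \<Rightarrow> \<lambda>Z. (X, Y, Z)) xa,
      FA = restrict (inner.ext Z) (Arr PQ.K)\<rparr>" for Z
    using inner.is_functor_ext[of Z] inner_functor.FA_ext[of Z] by (simp add: extensional_restrict case_prod_unfold)
  show "is_functor (Kleisli R) P_QR.K \<lparr>FO = \<lambda>Z. case (s, Z) of (x, xa) \<Rightarrow> (case x of (X, Y) \<Rightarrow> \<lambda>Z. (X, Y, Z)) xa,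
      FA = restrict (case s of (X, Y) \<Rightarrow> \<lambda>k. inD P (Q \<otimes>\<^sub>0 R) X (inD Q R Y k)) (Arr (Kleisli R))\<rparr>" for s
    by (cases s) (auto simp: is_functor_iff R.K.category_axioms P_QR.K.category_axioms Hom_iff)
next
  fix p y assume "p \<in> Arr PQ.K" "y \<in> Arr (Base R)"
  then show "inner.ext (Dom (Base R) y) p \<Zcomp>\<^bsub>P_QR.K\<^esub>
      (case Cod PQ.K p of (X, Y) \<Rightarrow> \<lambda>k. inD P (Q \<otimes>\<^sub>0 R) X (inD Q R Y k)) (Unit R y)
    = (case Dom PQ.K p of (X, Y) \<Rightarrow> \<lambda>k. inD P (Q \<otimes>\<^sub>0 R) X (inD Q R Y k)) (Unit R y) \<Zcomp>\<^bsub>P_QR.K\<^esub>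
      inner.ext (Cod (Base R) y) p"
    using inner_inD_Unit[of p y] by (simp add: case_prod_unfold)
next
  fix f k assume f: "f \<in> Arr (Base (P \<otimes>\<^sub>0 Q))" and k: "k \<in> Arr (Kleisli R)"
  obtain v w where vw: "f = (v, w)" "v \<in> Arr (Base P)" "w \<in> Arr (Base Q)"
    using f by auto
  let ?X = "Dom (Base P) v" and ?X' = "Cod (Base P) v" and ?Y = "Dom (Base Q) w" and ?Y' = "Cod (Base Q) w"
    and ?Z = "Dom (Kleisli R) k" and ?Z' = "Cod (Kleisli R) k"
  have C: "inner.ext Z (Unit (P \<otimes>\<^sub>0 Q) f) = inC P (Q \<otimes>\<^sub>0 R) (Unit P v) (?Y, Z) \<Zcomp>\<^bsub>P_QR.K\<^esub> inD P (Q \<otimes>\<^sub>0 R) ?X' (inC Q R (Unit Q w) Z)" for Z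
    using vw inner_functor.FA_Comp[of "inC P Q (Unit P v) (Dom (Base Q) w)" "inD P Q (Cod (Base P) v) (Unit Q w)"]
    by (simp add: PQ.Unit_K)
  \<comment> \<open>An arrow \<open>k\<close> of the third factor passes the pure pair in two moves:
    past \<open>w\<close> by a relation of \<open>Q \<otimes>\<^sub>0 R\<close> mapped along
    \<open>inD\<close>, and past \<open>v\<close> by a relation of the target tensor.\<close>
  have "inD P (Q \<otimes>\<^sub>0 R) ?X' (inD Q R ?Y k) \<Zcomp>\<^bsub>P_QR.K\<^esub> inD P (Q \<otimes>\<^sub>0 R) ?X' (inC Q R (Unit Q w) ?Z')
      = inD P (Q \<otimes>\<^sub>0 R) ?X' (inC Q R (Unit Q w) ?Z) \<Zcomp>\<^bsub>P_QR.K\<^esub> inD P (Q \<otimes>\<^sub>0 R) ?X' (inD Q R ?Y' k)"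
    using vw k QR.inC_Unit_inD[of w k ?Y ?Y' ?Z ?Z'] by (simp flip: P_QR.inD_Comp)
  moreover have "inD P (Q \<otimes>\<^sub>0 R) ?X (inD Q R ?Y k) \<Zcomp>\<^bsub>P_QR.K\<^esub> inC P (Q \<otimes>\<^sub>0 R) (Unit P v) (?Y, ?Z')
      = inC P (Q \<otimes>\<^sub>0 R) (Unit P v) (?Y, ?Z) \<Zcomp>\<^bsub>P_QR.K\<^esub> inD P (Q \<otimes>\<^sub>0 R) ?X' (inD Q R ?Y k)"
    using vw k by (intro P_QR.inC_Unit_inD[symmetric]) auto
  ultimately have "inD P (Q \<otimes>\<^sub>0 R) ?X (inD Q R ?Y k) \<Zcomp>\<^bsub>P_QR.K\<^esub> (inC P (Q \<otimes>\<^sub>0 R) (Unit P v) (?Y, ?Z') \<Zcomp>\<^bsub>P_QR.K\<^esub> inD P (Q \<otimes>\<^sub>0 R) ?X' (inC Q R (Unit Q w) ?Z'))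
      = (inC P (Q \<otimes>\<^sub>0 R) (Unit P v) (?Y, ?Z) \<Zcomp>\<^bsub>P_QR.K\<^esub> inD P (Q \<otimes>\<^sub>0 R) ?X' (inC Q R (Unit Q w) ?Z)) \<Zcomp>\<^bsub>P_QR.K\<^esub> inD P (Q \<otimes>\<^sub>0 R) ?X' (inD Q R ?Y' k)"
    using vw k by (intro P_QR.K.natural_Comp[symmetric]) (auto simp: Hom_iff)
  then show "(case Dom (Base (P \<otimes>\<^sub>0 Q)) f of (X, Y) \<Rightarrow> \<lambda>k. inD P (Q \<otimes>\<^sub>0 R) X (inD Q R Y k)) k \<Zcomp>\<^bsub>P_QR.K\<^esub>
      inner.ext (Cod (Kleisli R) k) (Unit (P \<otimes>\<^sub>0 Q) f)
    = inner.ext (Dom (Kleisli R) k) (Unit (P \<otimes>\<^sub>0 Q) f) \<Zcomp>\<^bsub>P_QR.K\<^esub>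
      (case Cod (Base (P \<otimes>\<^sub>0 Q)) f of (X, Y) \<Rightarrow> \<lambda>k. inD P (Q \<otimes>\<^sub>0 R) X (inD Q R Y k)) k"
    unfolding C by (simp add: vw)
qed

lemma hom_assoc: "promonad_hom ((P \<otimes>\<^sub>0 Q) \<otimes>\<^sub>0 R) (P \<otimes>\<^sub>0 (Q \<otimes>\<^sub>0 R)) (hom_assoc P Q R)"
  unfolding hom_assoc_def
proof (intro promonad_hom_ext outer.tensor_interp_axioms P_QR.promonad_tensor)
  show "is_functor (prod_cat (Base (P \<otimes>\<^sub>0 Q)) (Base R)) (Base (P \<otimes>\<^sub>0 Q \<otimes>\<^sub>0 R))
      \<lparr>FO = \<lambda>((X, Y), Z). (X, Y, Z), FA = \<lambda>((f, g), h)\<in>(Arr (Base P) \<times> Arr (Base Q)) \<times> Arr (Base R). (f, g, h)\<rparr>"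
    by (auto simp: is_functor_iff category_prod_cat P.base Q.base R.base Hom_iff)
next
  fix f y assume f: "f \<in> Arr (Base (P \<otimes>\<^sub>0 Q))" and y: "y \<in> Arr (Base R)"
  obtain v w where vw: "f = (v, w)" "v \<in> Arr (Base P)" "w \<in> Arr (Base Q)"
    using f by auto
  then show "inner.ext (Dom (Base R) y) (Unit (P \<otimes>\<^sub>0 Q) f) \<Zcomp>\<^bsub>P_QR.K\<^esub>
      (case Cod (Base (P \<otimes>\<^sub>0 Q)) f of (X, Y) \<Rightarrow> \<lambda>k. inD P (Q \<otimes>\<^sub>0 R) X (inD Q R Y k)) (Unit R y)
    = Unit (P \<otimes>\<^sub>0 Q \<otimes>\<^sub>0 R) (FA \<lparr>FO = \<lambda>((X, Y), Z). (X, Y, Z),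
        FA = \<lambda>((f, g), h)\<in>(Arr (Base P) \<times> Arr (Base Q)) \<times> Arr (Base R). (f, g, h)\<rparr> (f, y))"
    using y inner_functor.FA_Comp[of "inC P Q (Unit P v) (Dom (Base Q) w)" "inD P Q (Cod (Base P) v) (Unit Q w)"]
    by (simp add: PQ.Unit_K P_QR.Unit_K P_QR.K.assoc inD_Unit_assoc)
qed simp

lemma assoc_inC_inC: "f \<in> Arr (Kleisli P) \<Longrightarrow>
    EF (hom_assoc P Q R) (inC (P \<otimes>\<^sub>0 Q) R (inC P Q f Y) Z) = inC P (Q \<otimes>\<^sub>0 R) f (Y, Z)"
  by (simp add: hom_assoc_def)

lemma assoc_inC_inD: "g \<in> Arr (Kleisli Q) \<Longrightarrow>
    EF (hom_assoc P Q R) (inC (P \<otimes>\<^sub>0 Q) R (inD P Q X g) Z) = inD P (Q \<otimes>\<^sub>0 R) X (inC Q R g Z)"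
  by (simp add: hom_assoc_def)

lemma assoc_inD: "k \<in> Arr (Kleisli R) \<Longrightarrow>
    EF (hom_assoc P Q R) (inD (P \<otimes>\<^sub>0 Q) R (X, Y) k) = inD P (Q \<otimes>\<^sub>0 R) X (inD Q R Y k)"
  by (simp add: hom_assoc_def)

end

section \<open>The unitors of the pure tensor\<close>

context promonad
begin

lemma lunit_interp: "tensor_interp unit_promonad P (Kleisli P) snd (\<lambda>_ X. Idn (Kleisli P) X) (\<lambda>_ p. p)"
proof -
  interpret I: promonad unit_promonad by (rule promonad_unit)
  show ?thesis
    by unfold_locales (auto simp: is_functor_iff I.K.category_axioms K.category_axioms Hom_iff)
qed

lemma runit_interp: "tensor_interp P unit_promonad (Kleisli P) fst (\<lambda>p _. p) (\<lambda>X _. Idn (Kleisli P) X)"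
proof -
  interpret I: promonad unit_promonad by (rule promonad_unit)
  show ?thesis
    by unfold_locales (auto simp: is_functor_iff I.K.category_axioms K.category_axioms Hom_iff)
qed

lemma hom_lunit: "promonad_hom (unit_promonad \<otimes>\<^sub>0 P) P (hom_lunit P)"
  unfolding hom_lunit_def
  by (intro promonad_hom_ext lunit_interp promonad_axioms)
    (auto simp: is_functor_iff category_prod_cat category_terminal_cat V.category_axioms Hom_iff)

lemma hom_runit: "promonad_hom (P \<otimes>\<^sub>0 unit_promonad) P (hom_runit P)"
  unfolding hom_runit_def
  by (intro promonad_hom_ext runit_interp promonad_axioms)
    (auto simp: is_functor_iff category_prod_cat category_terminal_cat V.category_axioms Hom_iff)

lemma lunit_EF:
  "EF (hom_lunit P) (inC unit_promonad P x X) = Idn (Kleisli P) X"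
  "p \<in> Arr (Kleisli P) \<Longrightarrow> EF (hom_lunit P) (inD unit_promonad P x p) = p"
  using tensor_interp.ext_inC[OF lunit_interp] tensor_interp.ext_inD[OF lunit_interp]
  by (simp_all add: hom_lunit_def)

lemma runit_EF:
  "p \<in> Arr (Kleisli P) \<Longrightarrow> EF (hom_runit P) (inC P unit_promonad p x) = p"
  "EF (hom_runit P) (inD P unit_promonad X x) = Idn (Kleisli P) X"
  using tensor_interp.ext_inC[OF runit_interp] tensor_interp.ext_inD[OF runit_interp]
  by (simp_all add: hom_runit_def)

end

section \<open>Pseudomonoids and effectful categories\<close>

text \<open>Only the 1-cells are assumed to be homomorphisms; the 2-cells of \<open>S\<close> stay
  arbitrary. Each pseudomonoid axiom then unfolds to an equivalence that serves both directions of
  the correspondence.\<close>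

locale tensor_data = promonad P for P :: "('o, 'v, 'p) promonad" (structure) +
  fixes S :: "('o, 'v, 'p) pseudo_str"
  assumes sm_hom: "promonad_hom (P \<otimes>\<^sub>0 P) P (sm S)"
    and su_hom: "promonad_hom unit_promonad P (su S)"
begin

sublocale PP: promonad_pair P P ..
sublocale PPP: promonad_triple P P P ..
sublocale m: promonad_homomorphism "P \<otimes>\<^sub>0 P" P "sm S" by (rule promonad_homomorphismI[OF sm_hom])
sublocale u: promonad_homomorphism unit_promonad P "su S" by (rule promonad_homomorphismI[OF su_hom])

abbreviation "V \<equiv> Base P"
abbreviation "K \<equiv> Kleisli P"
abbreviation "E \<equiv> eff_of_pseudo P S"
abbreviation "i \<equiv> hom_id P"
abbreviation tO where "tO A B \<equiv> FO (BF (sm S)) (A, B)"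
abbreviation tV where "tV f g \<equiv> FA (BF (sm S)) (f, g)"
abbreviation lt where "lt X g \<equiv> EF (sm S) (inD P P X g)"
abbreviation rt where "rt f Y \<equiv> EF (sm S) (inC P P f Y)"
abbreviation "I \<equiv> FO (BF (su S)) ()"

lemma tV_simps [simp]:
  assumes "f \<in> Arr V" "g \<in> Arr V"
  shows "tV f g \<in> Arr V" "Dom V (tV f g) = tO (Dom V f) (Dom V g)" "Cod V (tV f g) = tO (Cod V f) (Cod V g)"
  using m.B.FA_simps[of "(f, g)"] assms by simp_all

text \<open>The unit condition for the multiplication links the two levels. It is the source of
  strict preservation of the tensor by the identity-on-objects functor.\<close>

lemma Unit_tV:
  "\<lbrakk>v \<in> Arr V; w \<in> Arr V\<rbrakk> \<Longrightarrow> Unit P (tV v w) = rt (Unit P v) (Dom V w) \<Zcomp>\<^bsub>K\<^esub> lt (Cod V v) (Unit P w)"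
  using m.EF_Unit[of "(v, w)"] by (simp add: PP.Unit_K)

lemma Unit_tV_lt: "w \<in> Arr V \<Longrightarrow> Unit P (tV (Idn V A) w) = lt A (Unit P w)"
  by (simp add: Unit_tV)

lemma Unit_tV_rt: "v \<in> Arr V \<Longrightarrow> Unit P (tV v (Idn V B)) = rt (Unit P v) B"
  by (simp add: Unit_tV)

text \<open>The terminal category has only an identity arrow, so a homomorphism out of the unit
  promonad carries no information beyond the object \<open>I\<close>.\<close>

lemma unit_functor: "FA (BF (su S)) x = Idn V I" "EF (su S) x = Idn K I"
proof -
  show *: "FA (BF (su S)) x = Idn V I" for x
    using u.B.FA_Idn[of "()"] by (simp add: terminal_cat_def)
  show "EF (su S) x = Idn K I"
    using u.EF_Unit[of x] * by simp
qed

lemma hom_i: "promonad_hom P P i"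
  by (rule promonad_hom_id) (rule promonad_axioms)

sublocale mi: hom_pair "P \<otimes>\<^sub>0 P" P "sm S" P P i by (intro hom_pairI sm_hom hom_i)
sublocale im: hom_pair P P i "P \<otimes>\<^sub>0 P" P "sm S" by (intro hom_pairI sm_hom hom_i)
sublocale ui: hom_pair unit_promonad P "su S" P P i by (intro hom_pairI su_hom hom_i)
sublocale iu: hom_pair P P i unit_promonad P "su S" by (intro hom_pairI su_hom hom_i)

text \<open>Both composites are evaluated on generators. In the base, whose arrows are triples,
  naturality is joint in three variables; in the Kleisli category it splits into one clause per
  variable, and these clauses are the three associator squares of a premonoidal category.\<close>

lemma invertible_assoc_iff:
  "invertible_modification (sm S \<circ>\<^sub>1 (sm S \<otimes>\<^sub>1 i)) (sm S \<circ>\<^sub>1 (i \<otimes>\<^sub>1 sm S) \<circ>\<^sub>1 hom_assoc P P P) \<alpha> \<longleftrightarrow>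
    (\<forall>A B C. \<alpha> ((A, B), C) \<in> Hom V (tO (tO A B) C) (tO A (tO B C)) \<and> iso_arrow V (\<alpha> ((A, B), C))) \<and>
    (\<forall>f\<in>Arr V. \<forall>g\<in>Arr V. \<forall>h\<in>Arr V. tV (tV f g) h \<Zcomp>\<^bsub>V\<^esub> \<alpha> ((Cod V f, Cod V g), Cod V h)
      = \<alpha> ((Dom V f, Dom V g), Dom V h) \<Zcomp>\<^bsub>V\<^esub> tV f (tV g h)) \<and>
    (\<forall>f\<in>Arr K. \<forall>Y Z. rt (rt f Y) Z \<Zcomp>\<^bsub>K\<^esub> Unit P (\<alpha> ((Cod K f, Y), Z))
      = Unit P (\<alpha> ((Dom K f, Y), Z)) \<Zcomp>\<^bsub>K\<^esub> rt f (tO Y Z)) \<and>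
    (\<forall>f\<in>Arr K. \<forall>X Z. rt (lt X f) Z \<Zcomp>\<^bsub>K\<^esub> Unit P (\<alpha> ((X, Cod K f), Z))
      = Unit P (\<alpha> ((X, Dom K f), Z)) \<Zcomp>\<^bsub>K\<^esub> lt X (rt f Z)) \<and>
    (\<forall>f\<in>Arr K. \<forall>X Y. lt (tO X Y) f \<Zcomp>\<^bsub>K\<^esub> Unit P (\<alpha> ((X, Y), Cod K f))
      = Unit P (\<alpha> ((X, Y), Dom K f)) \<Zcomp>\<^bsub>K\<^esub> lt X (lt Y f))"
    (is "invertible_modification ?F ?G \<alpha> \<longleftrightarrow> ?R")
proof -
  have F: "promonad_hom ((P \<otimes>\<^sub>0 P) \<otimes>\<^sub>0 P) P ?F"
    by (rule promonad_hom_comp[OF sm_hom mi.tensor_hom])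
  have G: "promonad_hom ((P \<otimes>\<^sub>0 P) \<otimes>\<^sub>0 P) P ?G"
    by (rule promonad_hom_comp[OF sm_hom promonad_hom_comp[OF im.tensor_hom PPP.hom_assoc]])
  have "nat_trans (Base ((P \<otimes>\<^sub>0 P) \<otimes>\<^sub>0 P)) V (BF ?F) (BF ?G) \<alpha> \<longleftrightarrow>
    (\<forall>A B C. \<alpha> ((A, B), C) \<in> Hom V (tO (tO A B) C) (tO A (tO B C))) \<and>
    (\<forall>f\<in>Arr V. \<forall>g\<in>Arr V. \<forall>h\<in>Arr V. tV (tV f g) h \<Zcomp>\<^bsub>V\<^esub> \<alpha> ((Cod V f, Cod V g), Cod V h)
      = \<alpha> ((Dom V f, Dom V g), Dom V h) \<Zcomp>\<^bsub>V\<^esub> tV f (tV g h))"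
    using F G by (simp add: nat_trans_iff promonad_hom_iff split_paired_All)
  moreover have "nat_trans (Kleisli ((P \<otimes>\<^sub>0 P) \<otimes>\<^sub>0 P)) K (Kleisli_fctr ?F) (Kleisli_fctr ?G) (\<lambda>s. Unit P (\<alpha> s)) \<longleftrightarrow>
    (\<forall>A B C. Unit P (\<alpha> ((A, B), C)) \<in> Hom K (tO (tO A B) C) (tO A (tO B C))) \<and>
    (\<forall>f\<in>Arr K. \<forall>Y Z. rt (rt f Y) Z \<Zcomp>\<^bsub>K\<^esub> Unit P (\<alpha> ((Cod K f, Y), Z))
      = Unit P (\<alpha> ((Dom K f, Y), Z)) \<Zcomp>\<^bsub>K\<^esub> rt f (tO Y Z)) \<and>
    (\<forall>f\<in>Arr K. \<forall>X Z. rt (lt X f) Z \<Zcomp>\<^bsub>K\<^esub> Unit P (\<alpha> ((X, Cod K f), Z))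
      = Unit P (\<alpha> ((X, Dom K f), Z)) \<Zcomp>\<^bsub>K\<^esub> lt X (rt f Z)) \<and>
    (\<forall>f\<in>Arr K. \<forall>X Y. lt (tO X Y) f \<Zcomp>\<^bsub>K\<^esub> Unit P (\<alpha> ((X, Y), Cod K f))
      = Unit P (\<alpha> ((X, Y), Dom K f)) \<Zcomp>\<^bsub>K\<^esub> lt X (lt Y f))"
    using F G promonad_axioms
    by (subst nat_trans_tensor3_iff)
      (simp_all add: promonad_hom_iff mi.tensor_inC mi.tensor_inD im.tensor_inC im.tensor_inD
        PPP.assoc_inC_inC PPP.assoc_inC_inD PPP.assoc_inD split_paired_All)
  ultimately show ?thesis
    unfolding invertible_modification_iff[OF F G] modification_iff[OF F G]
    by (auto simp: Hom_iff)
qed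

lemma invertible_lunit_iff:
  "invertible_modification (sm S \<circ>\<^sub>1 (su S \<otimes>\<^sub>1 i)) (hom_lunit P) l \<longleftrightarrow>
    (\<forall>A. l ((), A) \<in> Hom V (tO I A) A \<and> iso_arrow V (l ((), A))) \<and>
    (\<forall>f\<in>Arr V. tV (Idn V I) f \<Zcomp>\<^bsub>V\<^esub> l ((), Cod V f) = l ((), Dom V f) \<Zcomp>\<^bsub>V\<^esub> f) \<and>
    (\<forall>f\<in>Arr K. lt I f \<Zcomp>\<^bsub>K\<^esub> Unit P (l ((), Cod K f)) = Unit P (l ((), Dom K f)) \<Zcomp>\<^bsub>K\<^esub> f)"
    (is "invertible_modification ?F ?G l \<longleftrightarrow> ?R")
proof -
  have F: "promonad_hom (unit_promonad \<otimes>\<^sub>0 P) P ?F"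
    by (rule promonad_hom_comp[OF sm_hom ui.tensor_hom])
  have G: "promonad_hom (unit_promonad \<otimes>\<^sub>0 P) P ?G"
    by (rule hom_lunit)
  have "nat_trans (Base (unit_promonad \<otimes>\<^sub>0 P)) V (BF ?F) (BF ?G) l \<longleftrightarrow>
    (\<forall>A. l ((), A) \<in> Hom V (tO I A) A) \<and>
    (\<forall>f\<in>Arr V. tV (Idn V I) f \<Zcomp>\<^bsub>V\<^esub> l ((), Cod V f) = l ((), Dom V f) \<Zcomp>\<^bsub>V\<^esub> f)"
    using F G by (simp add: nat_trans_iff promonad_hom_iff split_paired_All unit_functor)
  moreover have "nat_trans (Kleisli (unit_promonad \<otimes>\<^sub>0 P)) K (Kleisli_fctr ?F) (Kleisli_fctr ?G) (\<lambda>s. Unit P (l s)) \<longleftrightarrow>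
    (\<forall>A. Unit P (l ((), A)) \<in> Hom K (tO I A) A) \<and>
    (\<forall>f\<in>Arr K. lt I f \<Zcomp>\<^bsub>K\<^esub> Unit P (l ((), Cod K f)) = Unit P (l ((), Dom K f)) \<Zcomp>\<^bsub>K\<^esub> f)"
    using F G promonad_axioms promonad_unit
    by (subst nat_trans_tensor_iff)
      (auto simp: promonad_hom_iff ui.tensor_inC ui.tensor_inD lunit_EF split_paired_All unit_functor Hom_iff)
  ultimately show ?thesis
    unfolding invertible_modification_iff[OF F G] modification_iff[OF F G]
    by (auto simp: Hom_iff)
qed

lemma invertible_runit_iff:
  "invertible_modification (sm S \<circ>\<^sub>1 (i \<otimes>\<^sub>1 su S)) (hom_runit P) r \<longleftrightarrow>
    (\<forall>A. r (A, ()) \<in> Hom V (tO A I) A \<and> iso_arrow V (r (A, ()))) \<and>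
    (\<forall>f\<in>Arr V. tV f (Idn V I) \<Zcomp>\<^bsub>V\<^esub> r (Cod V f, ()) = r (Dom V f, ()) \<Zcomp>\<^bsub>V\<^esub> f) \<and>
    (\<forall>f\<in>Arr K. rt f I \<Zcomp>\<^bsub>K\<^esub> Unit P (r (Cod K f, ())) = Unit P (r (Dom K f, ())) \<Zcomp>\<^bsub>K\<^esub> f)"
    (is "invertible_modification ?F ?G r \<longleftrightarrow> ?R")
proof -
  have F: "promonad_hom (P \<otimes>\<^sub>0 unit_promonad) P ?F"
    by (rule promonad_hom_comp[OF sm_hom iu.tensor_hom])
  have G: "promonad_hom (P \<otimes>\<^sub>0 unit_promonad) P ?G"
    by (rule hom_runit)
  have "nat_trans (Base (P \<otimes>\<^sub>0 unit_promonad)) V (BF ?F) (BF ?G) r \<longleftrightarrow>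
    (\<forall>A. r (A, ()) \<in> Hom V (tO A I) A) \<and>
    (\<forall>f\<in>Arr V. tV f (Idn V I) \<Zcomp>\<^bsub>V\<^esub> r (Cod V f, ()) = r (Dom V f, ()) \<Zcomp>\<^bsub>V\<^esub> f)"
    using F G by (simp add: nat_trans_iff promonad_hom_iff split_paired_All unit_functor)
  moreover have "nat_trans (Kleisli (P \<otimes>\<^sub>0 unit_promonad)) K (Kleisli_fctr ?F) (Kleisli_fctr ?G) (\<lambda>s. Unit P (r s)) \<longleftrightarrow>
    (\<forall>A. Unit P (r (A, ())) \<in> Hom K (tO A I) A) \<and>
    (\<forall>f\<in>Arr K. rt f I \<Zcomp>\<^bsub>K\<^esub> Unit P (r (Cod K f, ())) = Unit P (r (Dom K f, ())) \<Zcomp>\<^bsub>K\<^esub> f)"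
    using F G promonad_axioms promonad_unit
    by (subst nat_trans_tensor_iff)
      (auto simp: promonad_hom_iff iu.tensor_inC iu.tensor_inD runit_EF split_paired_All unit_functor Hom_iff)
  ultimately show ?thesis
    unfolding invertible_modification_iff[OF F G] modification_iff[OF F G]
    by (auto simp: Hom_iff)
qed

abbreviation "a A B C \<equiv> sA S ((A, B), C)"

text \<open>Equality of 2-cells is equality of components, and the canonical isomorphisms merely
  rebracket the objects at which components are taken. The two coherence axioms thus become pentagon
  and triangle in the base.\<close>

lemma pseudomonoid_iff: "pseudomonoid P S \<longleftrightarrow>
    invertible_modification (sm S \<circ>\<^sub>1 (sm S \<otimes>\<^sub>1 i)) (sm S \<circ>\<^sub>1 (i \<otimes>\<^sub>1 sm S) \<circ>\<^sub>1 hom_assoc P P P) (sA S) \<and>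
    invertible_modification (sm S \<circ>\<^sub>1 (su S \<otimes>\<^sub>1 i)) (hom_lunit P) (sL S) \<and>
    invertible_modification (sm S \<circ>\<^sub>1 (i \<otimes>\<^sub>1 su S)) (hom_runit P) (sR S) \<and>
    (\<forall>A B C D. tV (a A B C) (Idn V D) \<Zcomp>\<^bsub>V\<^esub> a A (tO B C) D \<Zcomp>\<^bsub>V\<^esub> tV (Idn V A) (a B C D)
      = a (tO A B) C D \<Zcomp>\<^bsub>V\<^esub> a A B (tO C D)) \<and>
    (\<forall>A B. a A I B \<Zcomp>\<^bsub>V\<^esub> tV (Idn V A) (sL S ((), B)) = tV (sR S (A, ())) (Idn V B))"
  unfolding pseudomonoid_def Let_def
  by (simp add: promonad_axioms sm_hom su_hom mod_vcomp_def whisker_L_def whisker_R_def mod_tensor_def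
      mod_id_def fun_eq_iff split_paired_All)

text \<open>
  The relations of the presentation interchange pure arrows with all arrows, and the tensor respects
  them: this is centrality.
\<close>

lemma central_Unit:
  assumes v: "v \<in> Arr V"
  shows "premonoidal_data.central K (ePre E) (Unit P v)"
  unfolding premonoidal_data.central_def
proof (intro conjI ballI)
  fix g assume g: "g \<in> Arr K"
  have "EF (sm S) (inC P P (Unit P v) (Dom K g) \<Zcomp>\<^bsub>PP.K\<^esub> inD P P (Cod V v) g)
      = EF (sm S) (inD P P (Dom V v) g \<Zcomp>\<^bsub>PP.K\<^esub> inC P P (Unit P v) (Cod K g))"
    using v g by (subst PP.inC_Unit_inD) auto
  then show "pR (ePre E) (Dom K g) (Unit P v) \<Zcomp>\<^bsub>K\<^esub> pL (ePre E) (Cod K (Unit P v)) g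
      = pL (ePre E) (Dom K (Unit P v)) g \<Zcomp>\<^bsub>K\<^esub> pR (ePre E) (Cod K g) (Unit P v)"
    using v g by (simp add: eff_of_pseudo_def Kleisli_simps)
  have "EF (sm S) (inC P P g (Dom V v) \<Zcomp>\<^bsub>PP.K\<^esub> inD P P (Cod K g) (Unit P v))
      = EF (sm S) (inD P P (Dom K g) (Unit P v) \<Zcomp>\<^bsub>PP.K\<^esub> inC P P g (Cod V v))"
    using v g by (subst PP.inC_inD_Unit) auto
  then show "pL (ePre E) (Dom K g) (Unit P v) \<Zcomp>\<^bsub>K\<^esub> pR (ePre E) (Cod K (Unit P v)) g
      = pR (ePre E) (Dom K (Unit P v)) g \<Zcomp>\<^bsub>K\<^esub> pL (ePre E) (Cod K g) (Unit P v)"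
    using v g by (simp add: eff_of_pseudo_def Kleisli_simps)
qed (simp add: v)

lemma pL_eff: "f \<in> Arr K \<Longrightarrow> pL (ePre E) X f = lt X f"
  and pR_eff: "f \<in> Arr K \<Longrightarrow> pR (ePre E) Y f = rt f Y"
  by (simp_all add: eff_of_pseudo_def Kleisli_simps)

lemma eff_simps [simp]:
  "mT (eMon E) = BF (sm S)" "mI (eMon E) = I" "mA (eMon E) A B C = a A B C"
  "mL (eMon E) A = sL S ((), A)" "mR (eMon E) A = sR S (A, ())"
  "pO (ePre E) A B = tO A B" "pI (ePre E) = I" "pA (ePre E) A B C = Unit P (a A B C)"
  "pLam (ePre E) A = Unit P (sL S ((), A))" "pRho (ePre E) A = Unit P (sR S (A, ()))"
  by (simp_all add: eff_of_pseudo_def)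

text \<open>The \<open>restrict\<close> in \<open>eff_of_pseudo\<close> secures extensionality;
  functoriality is that of the multiplication composed with \<open>inD\<close> and
  \<open>inC\<close>.\<close>

lemma binoidal: "binoidal K (ePre E)"
proof -
  have "pL (ePre E) X \<in> extensional (Arr K)" "pR (ePre E) X \<in> extensional (Arr K)" for X
    by (simp_all add: eff_of_pseudo_def Kleisli_simps(1))
  then show ?thesis
    by unfold_locales (auto simp: is_functor_iff K.category_axioms Hom_iff pL_eff pR_eff)
qed

section \<open>Equivalence of the axioms over fixed 1-cells\<close>

lemma Unit_iso: "iso_arrow V f \<Longrightarrow> iso_arrow K (Unit P f)"
  using Unit.FA_iso[of f] by (simp add: V.iso_arrow_Arr)

text \<open>The structure arrows of the Kleisli category are units of pure ones: they are central by
  \<open>central_Unit\<close>, invertible because functors preserve isomorphisms, and satisfy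
  pentagon and triangle as images of base equations.\<close>

lemma effectful_if_pseudomonoid:
  assumes "pseudomonoid P S"
  shows "effectful (Kleisli_functor P) E"
proof -
  note ps = assms[unfolded pseudomonoid_iff invertible_assoc_iff invertible_lunit_iff invertible_runit_iff]
  have a: "a A B C \<in> Arr V" "Dom V (a A B C) = tO (tO A B) C" "Cod V (a A B C) = tO A (tO B C)"
    "iso_arrow V (a A B C)" for A B C
    using ps by (simp_all add: Hom_iff)
  have l: "sL S ((), A) \<in> Arr V" "Dom V (sL S ((), A)) = tO I A" "Cod V (sL S ((), A)) = A"
    "iso_arrow V (sL S ((), A))" for A
    using ps by (simp_all add: Hom_iff)
  have r: "sR S (A, ()) \<in> Arr V" "Dom V (sR S (A, ())) = tO A I" "Cod V (sR S (A, ())) = A"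
    "iso_arrow V (sR S (A, ()))" for A
    using ps by (simp_all add: Hom_iff)
  have "monoidal V (eMon E)"
    using ps m.B.is_functor by unfold_locales (auto simp: Hom_iff)
  moreover interpret B: binoidal K "ePre E" by (rule binoidal)
  have "premonoidal K (ePre E)"
  proof unfold_locales
    fix X Y Z W
    have "Unit P (tV (a X Y Z) (Idn V W) \<Zcomp>\<^bsub>V\<^esub> a X (tO Y Z) W \<Zcomp>\<^bsub>V\<^esub> tV (Idn V X) (a Y Z W))
      = Unit P (a (tO X Y) Z W \<Zcomp>\<^bsub>V\<^esub> a X Y (tO Z W))"
      using ps by simp
    then show "pR (ePre E) W (pA (ePre E) X Y Z) \<Zcomp>\<^bsub>K\<^esub> pA (ePre E) X (pO (ePre E) Y Z) W \<Zcomp>\<^bsub>K\<^esub>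
        pL (ePre E) X (pA (ePre E) Y Z W)
      = pA (ePre E) (pO (ePre E) X Y) Z W \<Zcomp>\<^bsub>K\<^esub> pA (ePre E) X Y (pO (ePre E) Z W)"
      by (simp add: a pL_eff pR_eff Unit_tV_lt Unit_tV_rt)
    have "Unit P (a X I Y \<Zcomp>\<^bsub>V\<^esub> tV (Idn V X) (sL S ((), Y))) = Unit P (tV (sR S (X, ())) (Idn V Y))"
      using ps by simp
    then show "pA (ePre E) X (pI (ePre E)) Y \<Zcomp>\<^bsub>K\<^esub> pL (ePre E) X (pLam (ePre E) Y) = pR (ePre E) Y (pRho (ePre E) X)"
      by (simp add: a l r pL_eff pR_eff Unit_tV_lt Unit_tV_rt)
  qed (use ps in \<open>auto simp: a l r Hom_iff Unit_iso central_Unit pL_eff pR_eff\<close>)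
  ultimately show ?thesis
    unfolding effectful_def
    using id_on_obj_functor_Kleisli
    by (auto simp: Kleisli_functor_def central_Unit a l r pL_eff pR_eff Unit_tV_lt Unit_tV_rt)
qed

text \<open>Pentagon and triangle are taken from the monoidal structure, since a non-faithful unit
  would not reflect their Kleisli versions; the premonoidal structure contributes the naturality
  squares in single variables.\<close>

lemma pseudomonoid_if_effectful:
  assumes "effectful (Kleisli_functor P) E"
  shows "pseudomonoid P S"
proof -
  interpret M: monoidal V "eMon E"
    using assms by (simp add: effectful_def Kleisli_functor_def)
  interpret N: premonoidal K "ePre E"
    using assms by (simp add: effectful_def Kleisli_functor_def)
  show ?thesis
    unfolding pseudomonoid_iff invertible_assoc_iff invertible_lunit_iff invertible_runit_iff
  proof (intro conjI allI ballI)
    show "tV (tV f g) h \<Zcomp>\<^bsub>V\<^esub> a (Cod V f) (Cod V g) (Cod V h) = a (Dom V f) (Dom V g) (Dom V h) \<Zcomp>\<^bsub>V\<^esub> tV f (tV g h)"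
      if "f \<in> Arr V" "g \<in> Arr V" "h \<in> Arr V" for f g h
      using M.assoc_nat[OF that[THEN Arr_Hom]] by simp
    show "tV (Idn V I) f \<Zcomp>\<^bsub>V\<^esub> sL S ((), Cod V f) = sL S ((), Dom V f) \<Zcomp>\<^bsub>V\<^esub> f"
      "tV f (Idn V I) \<Zcomp>\<^bsub>V\<^esub> sR S (Cod V f, ()) = sR S (Dom V f, ()) \<Zcomp>\<^bsub>V\<^esub> f" if "f \<in> Arr V" for f
      using M.lunit_nat[OF Arr_Hom[OF that]] M.runit_nat[OF Arr_Hom[OF that]] by simp_all
    fix f assume f: "f \<in> Arr K"
    show "lt I f \<Zcomp>\<^bsub>K\<^esub> Unit P (sL S ((), Cod K f)) = Unit P (sL S ((), Dom K f)) \<Zcomp>\<^bsub>K\<^esub> f"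
      "rt f I \<Zcomp>\<^bsub>K\<^esub> Unit P (sR S (Cod K f, ())) = Unit P (sR S (Dom K f, ())) \<Zcomp>\<^bsub>K\<^esub> f"
      using N.lunit_nat[OF Arr_Hom[OF f]] N.runit_nat[OF Arr_Hom[OF f]] f by (simp_all add: pL_eff pR_eff)
    fix X Y
    show "rt (rt f X) Y \<Zcomp>\<^bsub>K\<^esub> Unit P (a (Cod K f) X Y) = Unit P (a (Dom K f) X Y) \<Zcomp>\<^bsub>K\<^esub> rt f (tO X Y)"
      "rt (lt X f) Y \<Zcomp>\<^bsub>K\<^esub> Unit P (a X (Cod K f) Y) = Unit P (a X (Dom K f) Y) \<Zcomp>\<^bsub>K\<^esub> lt X (rt f Y)"
      "lt (tO X Y) f \<Zcomp>\<^bsub>K\<^esub> Unit P (a X Y (Cod K f)) = Unit P (a X Y (Dom K f)) \<Zcomp>\<^bsub>K\<^esub> lt X (lt Y f)"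
      using N.assoc_nat1[OF Arr_Hom[OF f]] N.assoc_nat2[OF Arr_Hom[OF f]] N.assoc_nat3[OF Arr_Hom[OF f]] f
      by (simp_all add: pL_eff pR_eff)
  qed (use M.assoc_Hom M.assoc_iso M.lunit_Hom M.lunit_iso M.runit_Hom M.runit_iso M.pentagon M.triangle in simp_all)
qed

end

section \<open>Injectivity of the comparison\<close>

lemma tensor_dataI: "pseudomonoid P S \<Longrightarrow> tensor_data P S"
  by (auto simp: tensor_data_def tensor_data_axioms_def pseudomonoid_def Let_def)

text \<open>The generators determine the action on all arrows, and extensionality fixes it
  elsewhere, so agreement on generators and on the base gives equality of records.\<close>

lemma tensor_hom_eqI:
  assumes F: "promonad_hom (P \<otimes>\<^sub>0 Q) R F" and G: "promonad_hom (P \<otimes>\<^sub>0 Q) R G"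
    and pr: "promonad P" "promonad Q" and B: "BF F = BF G"
    and C: "\<And>f Y. f \<in> Arr (Kleisli P) \<Longrightarrow> EF F (inC P Q f Y) = EF G (inC P Q f Y)"
    and D: "\<And>X g. g \<in> Arr (Kleisli Q) \<Longrightarrow> EF F (inD P Q X g) = EF G (inD P Q X g)"
  shows "F = G"
proof -
  interpret promonad_pair P Q using pr by (simp add: promonad_pairI)
  interpret F: promonad_homomorphism "P \<otimes>\<^sub>0 Q" R F by (rule promonad_homomorphismI[OF F])
  interpret G: promonad_homomorphism "P \<otimes>\<^sub>0 Q" R G by (rule promonad_homomorphismI[OF G])
  have "EF F p = EF G p" if "p \<in> Arr K" for p
    using that by (induction rule: tensor_induct) (simp_all add: B C D)
  then have "EF F = EF G"
    using F.E.FA_ext G.E.FA_ext by (intro extensionalityI)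
  then show ?thesis
    using B F.PSrc F.PTgt G.PSrc G.PTgt by (intro phom.equality) auto
qed

text \<open>The multiplication is recovered from the base tensor and the two actions, the unit from
  its object. The isomorphisms are read from the monoidal half, where they are pure arrows; their
  Kleisli images need not determine them.\<close>

lemma inj_eff_of_pseudo: "inj_on (eff_of_pseudo P) {S. pseudomonoid P S}"
proof (rule inj_onI)
  fix S T assume "S \<in> {S. pseudomonoid P S}" "T \<in> {S. pseudomonoid P S}" and eq: "eff_of_pseudo P S = eff_of_pseudo P T"
  then interpret S: tensor_data P S + T: tensor_data P T
    by (auto intro: tensor_dataI)
  have B: "BF (sm S) = BF (sm T)" and I: "S.I = T.I"
    using eq S.eff_simps T.eff_simps by metis+
  have "sm S = sm T"
    using eq S.pL_eff T.pL_eff S.pR_eff T.pR_eff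
    by (intro tensor_hom_eqI[OF S.sm_hom T.sm_hom S.promonad_axioms S.promonad_axioms B]) metis+
  moreover have "su S = su T"
    using S.u.PSrc S.u.PTgt T.u.PSrc T.u.PTgt I
    by (intro phom.equality fctr.equality) (auto simp: S.unit_functor T.unit_functor fun_eq_iff)
  moreover have "S.a A B C = T.a A B C" "sL S ((), A) = sL T ((), A)" "sR S (A, ()) = sR T (A, ())" for A B C
    using eq S.eff_simps(3-5) T.eff_simps(3-5) by metis+
  then have "sA S = sA T" "sL S = sL T" "sR S = sR T"
    by (auto simp: fun_eq_iff)
  ultimately show "S = T" by (intro pseudo_str.equality) auto
qed

section \<open>The inverse construction, from effectful structures to pseudomonoids\<close>

definition pseudo_of_eff :: "('o, 'v, 'p) promonad \<Rightarrow> ('o, 'v, 'p) eff_str \<Rightarrow> ('o, 'v, 'p) pseudo_str" where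
  "pseudo_of_eff P E = \<lparr>
     sm = \<lparr>PSrc = P \<otimes>\<^sub>0 P, PTgt = P, BF = mT (eMon E),
       EF = pt_ext P P (Kleisli P) (FO (mT (eMon E))) (\<lambda>f Y. pR (ePre E) Y f) (pL (ePre E))\<rparr>,
     su = \<lparr>PSrc = unit_promonad, PTgt = P,
       BF = \<lparr>FO = (\<lambda>_. mI (eMon E)), FA = (\<lambda>_. Idn (Base P) (mI (eMon E)))\<rparr>,
       EF = (\<lambda>_. Idn (Kleisli P) (mI (eMon E)))\<rparr>,
     sA = (\<lambda>((A, B), C). mA (eMon E) A B C), sL = (\<lambda>(_, A). mL (eMon E) A), sR = (\<lambda>(A, _). mR (eMon E) A)\<rparr>"

locale effectful_promonad = promonad P for P :: "('o, 'v, 'p) promonad" (structure) +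
  fixes E :: "('o, 'v, 'p) eff_str"
  assumes eff: "effectful (Kleisli_functor P) E"
begin

abbreviation "V \<equiv> Base P"
abbreviation "K \<equiv> Kleisli P"

sublocale M: monoidal V "eMon E"
  using eff by (simp add: effectful_def Kleisli_functor_def)
sublocale N: premonoidal K "ePre E"
  using eff by (simp add: effectful_def Kleisli_functor_def)
sublocale T: cat_functor "prod_cat V V" V "mT (eMon E)"
  by (rule cat_functorI) (rule M.tensor_functor)

lemma eff_O: "FO (mT (eMon E)) (A, B) = pO (ePre E) A B" "mI (eMon E) = pI (ePre E)"
  using eff by (simp_all add: effectful_def)

lemma eff_Unit:
  "v \<in> Arr V \<Longrightarrow> N.central (Unit P v)"
  "v \<in> Arr V \<Longrightarrow> Unit P (FA (mT (eMon E)) (Idn V A, v)) = pL (ePre E) A (Unit P v)"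
  "v \<in> Arr V \<Longrightarrow> Unit P (FA (mT (eMon E)) (v, Idn V A)) = pR (ePre E) A (Unit P v)"
  "pA (ePre E) A B C = Unit P (mA (eMon E) A B C)"
  "pLam (ePre E) A = Unit P (mL (eMon E) A)"
  "pRho (ePre E) A = Unit P (mR (eMon E) A)"
proof -
  \<comment> \<open>\<open>Kleisli_functor\<close> restricts the unit, so strict preservation speaks
    about \<open>Unit P\<close> only once the structure arrows are known to be arrows of the
    base.\<close>
  have "mA (eMon E) A B C \<in> Arr V" "mL (eMon E) A \<in> Arr V" "mR (eMon E) A \<in> Arr V"
    using M.assoc_Hom[of A B C] M.lunit_Hom[of A] M.runit_Hom[of A] by (auto simp: Hom_iff)
  then show "pA (ePre E) A B C = Unit P (mA (eMon E) A B C)" "pLam (ePre E) A = Unit P (mL (eMon E) A)"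
    "pRho (ePre E) A = Unit P (mR (eMon E) A)"
    using eff unfolding effectful_def Kleisli_functor_def by (simp_all add: restrict_def) metis+
  assume v: "v \<in> Arr V"
  have "FA (mT (eMon E)) (Idn V A, v) \<in> Arr V" "FA (mT (eMon E)) (v, Idn V A) \<in> Arr V"
    using v by auto
  then show "N.central (Unit P v)" "Unit P (FA (mT (eMon E)) (Idn V A, v)) = pL (ePre E) A (Unit P v)"
    "Unit P (FA (mT (eMon E)) (v, Idn V A)) = pR (ePre E) A (Unit P v)"
    using eff v unfolding effectful_def Kleisli_functor_def by auto
qed

sublocale L: cat_functor K K "\<lparr>FO = (\<lambda>Y. pO (ePre E) X Y), FA = pL (ePre E) X\<rparr>" for X
  using N.functor_L by (intro cat_functorI)
sublocale R: cat_functor K K "\<lparr>FO = (\<lambda>X. pO (ePre E) X Y), FA = pR (ePre E) Y\<rparr>" for Y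
  using N.functor_R by (intro cat_functorI)

text \<open>Centrality of pure arrows has two halves, one per side; they are exactly the two
  interchange conditions of \<open>tensor_interp\<close>.\<close>

sublocale tensor: tensor_interp P P K "FO (mT (eMon E))" "\<lambda>f Y. pR (ePre E) Y f" "pL (ePre E)"
proof unfold_locales
  show "is_functor K K \<lparr>FO = \<lambda>X. FO (mT (eMon E)) (X, Y), FA = restrict (pR (ePre E) Y) (Arr K)\<rparr>" for Y
    using R.is_functor[of Y] R.FA_ext[of Y] by (simp add: eff_O extensional_restrict)
  show "is_functor K K \<lparr>FO = \<lambda>Y. FO (mT (eMon E)) (X, Y), FA = restrict (pL (ePre E) X) (Arr K)\<rparr>" for X
    using L.is_functor[of X] L.FA_ext[of X] by (simp add: eff_O extensional_restrict)
  show "pR (ePre E) (Dom V w) f \<Zcomp>\<^bsub>K\<^esub> pL (ePre E) (Cod K f) (Unit P w)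
      = pL (ePre E) (Dom K f) (Unit P w) \<Zcomp>\<^bsub>K\<^esub> pR (ePre E) (Cod V w) f"
    "pL (ePre E) (Dom V w) f \<Zcomp>\<^bsub>K\<^esub> pR (ePre E) (Cod K f) (Unit P w)
      = pR (ePre E) (Dom K f) (Unit P w) \<Zcomp>\<^bsub>K\<^esub> pL (ePre E) (Cod V w) f"
    if "f \<in> Arr K" "w \<in> Arr V" for f w
    using eff_Unit(1)[of w] that unfolding N.central_def by simp_all
qed

sublocale S: tensor_data P "pseudo_of_eff P E"
proof unfold_locales
  show "promonad_hom (P \<otimes>\<^sub>0 P) P (sm (pseudo_of_eff P E))"
    unfolding pseudo_of_eff_def pseudo_str.simps
  proof (intro promonad_hom_ext tensor.tensor_interp_axioms promonad_axioms M.tensor_functor)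
    fix v w assume v: "v \<in> Arr V" and w: "w \<in> Arr V"
    \<comment> \<open>Functoriality of the tensor splits a pure pair into one arrow per variable;
      strict preservation then applies to each factor.\<close>
    have "Unit P (FA (mT (eMon E)) (v, w))
        = Unit P (FA (mT (eMon E)) (v, Idn V (Dom V w)) \<Zcomp>\<^bsub>V\<^esub> FA (mT (eMon E)) (Idn V (Cod V v), w))"
      using v w by (simp flip: T.FA_Comp)
    then show "pR (ePre E) (Dom V w) (Unit P v) \<Zcomp>\<^bsub>K\<^esub> pL (ePre E) (Cod V v) (Unit P w) = Unit P (FA (mT (eMon E)) (v, w))"
      using v w by (simp add: eff_Unit)
  qed simp
  show "promonad_hom unit_promonad P (su (pseudo_of_eff P E))"
    using promonad.category_Kleisli[OF promonad_unit]
    by (auto simp: promonad_hom_iff pseudo_of_eff_def promonad_unit promonad_axioms Kleisli_fctr_def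
        is_functor_iff category_terminal_cat V.category_axioms K.category_axioms Hom_iff)
qed

text \<open>The actions return as values of the extension on generators, and are equal as functions
  because both sides are extensional. The premonoidal structure arrows return because an effectful
  category has them as images of the monoidal ones.\<close>

lemma eff_of_pseudo_of_eff: "eff_of_pseudo P (pseudo_of_eff P E) = E"
proof -
  have "restrict (\<lambda>g. EF (sm (pseudo_of_eff P E)) (inD P P A g)) (Arr K) = pL (ePre E) A"
    "restrict (\<lambda>f. EF (sm (pseudo_of_eff P E)) (inC P P f A)) (Arr K) = pR (ePre E) A" for A
    using L.FA_ext[of A] R.FA_ext[of A]
    by (auto intro!: extensionalityI[of _ "Arr K"] simp: pseudo_of_eff_def)
  then show ?thesis
    by (intro eff_str.equality mon_str.equality pre_str.equality)
      (simp_all add: eff_of_pseudo_def Kleisli_simps(1), simp_all add: pseudo_of_eff_def fun_eq_iff eff_O eff_Unit)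
qed

lemma pseudomonoid_pseudo_of_eff: "pseudomonoid P (pseudo_of_eff P E)"
  using S.pseudomonoid_if_effectful eff by (simp add: eff_of_pseudo_of_eff)

end

lemma effectful_promonadI: "promonad P \<Longrightarrow> effectful (Kleisli_functor P) E \<Longrightarrow> effectful_promonad P E"
  by (simp add: effectful_promonad_def effectful_promonad_axioms_def)

lemma bij_betw_eff_of_pseudo:
  assumes "promonad P"
  shows "bij_betw (eff_of_pseudo P) {S. pseudomonoid P S} {E. effectful (Kleisli_functor P) E}"
proof (rule bij_betw_imageI[OF inj_eff_of_pseudo], intro equalityI subsetI)
  fix E assume "E \<in> {E. effectful (Kleisli_functor P) E}"
  then interpret effectful_promonad P E
    using assms by (simp add: effectful_promonadI)
  show "E \<in> eff_of_pseudo P ` {S. pseudomonoid P S}"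
    using pseudomonoid_pseudo_of_eff eff_of_pseudo_of_eff by (metis imageI mem_Collect_eq)
qed (auto intro: tensor_data.effectful_if_pseudomonoid tensor_dataI)

section \<open>Homomorphisms of pseudomonoids and effectful functors\<close>

locale tensor_hom_data = S: tensor_data P S + T: tensor_data Q T
  for P :: "('o, 'v, 'p) promonad" and S and Q :: "('q, 'w, 'r) promonad" and T +
  fixes H :: "('o, 'v, 'p, 'q, 'w, 'r) pseudo_hom"
  assumes hF_hom: "promonad_hom P Q (hF H)"
begin

sublocale F: promonad_homomorphism P Q "hF H" by (rule promonad_homomorphismI[OF hF_hom])
sublocale FF: hom_pair P Q "hF H" P Q "hF H" by (intro hom_pairI hF_hom)

abbreviation "W \<equiv> Base Q"
abbreviation "L \<equiv> Kleisli Q"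
abbreviation "f0 \<equiv> FO (BF (hF H))"
abbreviation "fV \<equiv> FA (BF (hF H))"
abbreviation "fK \<equiv> EF (hF H)"

text \<open>Naturality over the Kleisli category of a tensor splits by variable. This gives the two
  squares that an effectful functor requires for effectful arrows, while the base clause is joint,
  as for a strong monoidal functor.\<close>

lemma invertible_mu_iff:
  "invertible_modification (hF H \<circ>\<^sub>1 sm S) (sm T \<circ>\<^sub>1 (hF H \<otimes>\<^sub>1 hF H)) \<mu> \<longleftrightarrow>
    (\<forall>A B. \<mu> (A, B) \<in> Hom W (f0 (S.tO A B)) (T.tO (f0 A) (f0 B)) \<and> iso_arrow W (\<mu> (A, B))) \<and>
    (\<forall>f\<in>Arr S.V. \<forall>g\<in>Arr S.V. fV (S.tV f g) \<Zcomp>\<^bsub>W\<^esub> \<mu> (Cod S.V f, Cod S.V g)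
      = \<mu> (Dom S.V f, Dom S.V g) \<Zcomp>\<^bsub>W\<^esub> T.tV (fV f) (fV g)) \<and>
    (\<forall>f\<in>Arr S.K. \<forall>Y. fK (S.rt f Y) \<Zcomp>\<^bsub>L\<^esub> Unit Q (\<mu> (Cod S.K f, Y))
      = Unit Q (\<mu> (Dom S.K f, Y)) \<Zcomp>\<^bsub>L\<^esub> T.rt (fK f) (f0 Y)) \<and>
    (\<forall>f\<in>Arr S.K. \<forall>X. fK (S.lt X f) \<Zcomp>\<^bsub>L\<^esub> Unit Q (\<mu> (X, Cod S.K f))
      = Unit Q (\<mu> (X, Dom S.K f)) \<Zcomp>\<^bsub>L\<^esub> T.lt (f0 X) (fK f))"
    (is "invertible_modification ?F ?G \<mu> \<longleftrightarrow> ?R")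
proof -
  have F: "promonad_hom (P \<otimes>\<^sub>0 P) Q ?F"
    by (rule promonad_hom_comp[OF hF_hom S.sm_hom])
  have G: "promonad_hom (P \<otimes>\<^sub>0 P) Q ?G"
    by (rule promonad_hom_comp[OF T.sm_hom FF.tensor_hom])
  have "nat_trans (Base (P \<otimes>\<^sub>0 P)) W (BF ?F) (BF ?G) \<mu> \<longleftrightarrow>
    (\<forall>A B. \<mu> (A, B) \<in> Hom W (f0 (S.tO A B)) (T.tO (f0 A) (f0 B))) \<and>
    (\<forall>f\<in>Arr S.V. \<forall>g\<in>Arr S.V. fV (S.tV f g) \<Zcomp>\<^bsub>W\<^esub> \<mu> (Cod S.V f, Cod S.V g)
      = \<mu> (Dom S.V f, Dom S.V g) \<Zcomp>\<^bsub>W\<^esub> T.tV (fV f) (fV g))"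
    using F G by (simp add: nat_trans_iff promonad_hom_iff split_paired_All)
  moreover have "nat_trans (Kleisli (P \<otimes>\<^sub>0 P)) L (Kleisli_fctr ?F) (Kleisli_fctr ?G) (\<lambda>s. Unit Q (\<mu> s)) \<longleftrightarrow>
    (\<forall>A B. Unit Q (\<mu> (A, B)) \<in> Hom L (f0 (S.tO A B)) (T.tO (f0 A) (f0 B))) \<and>
    (\<forall>f\<in>Arr S.K. \<forall>Y. fK (S.rt f Y) \<Zcomp>\<^bsub>L\<^esub> Unit Q (\<mu> (Cod S.K f, Y))
      = Unit Q (\<mu> (Dom S.K f, Y)) \<Zcomp>\<^bsub>L\<^esub> T.rt (fK f) (f0 Y)) \<and>
    (\<forall>f\<in>Arr S.K. \<forall>X. fK (S.lt X f) \<Zcomp>\<^bsub>L\<^esub> Unit Q (\<mu> (X, Cod S.K f))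
      = Unit Q (\<mu> (X, Dom S.K f)) \<Zcomp>\<^bsub>L\<^esub> T.lt (f0 X) (fK f))"
    using F G S.promonad_axioms
    by (subst nat_trans_tensor_iff)
      (simp_all add: promonad_hom_iff FF.tensor_inC FF.tensor_inD split_paired_All)
  ultimately show ?thesis
    unfolding invertible_modification_iff[OF F G] modification_iff[OF F G]
    by (auto simp: Hom_iff)
qed

text \<open>Over the terminal category naturality is trivial, since both functors send the only
  arrow to an identity. What is left is one invertible arrow of the base.\<close>

lemma invertible_eps_iff:
  "invertible_modification (su T) (hF H \<circ>\<^sub>1 su S) \<epsilon> \<longleftrightarrow> \<epsilon> () \<in> Hom W T.I (f0 S.I) \<and> iso_arrow W (\<epsilon> ())"
    (is "invertible_modification ?F ?G \<epsilon> \<longleftrightarrow> ?R")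
proof -
  have F: "promonad_hom unit_promonad Q ?F"
    by (rule T.su_hom)
  have G: "promonad_hom unit_promonad Q ?G"
    by (rule promonad_hom_comp[OF hF_hom S.su_hom])
  show ?thesis
    unfolding invertible_modification_iff[OF F G] modification_iff[OF F G] nat_trans_iff
    using F G by (auto simp: promonad_hom_iff S.unit_functor T.unit_functor Hom_iff)
qed

lemma pseudomonoid_hom_iff: "pseudomonoid_hom P S Q T H \<longleftrightarrow> pseudomonoid P S \<and> pseudomonoid Q T \<and>
    invertible_modification (hF H \<circ>\<^sub>1 sm S) (sm T \<circ>\<^sub>1 (hF H \<otimes>\<^sub>1 hF H)) (hMu H) \<and>
    invertible_modification (su T) (hF H \<circ>\<^sub>1 su S) (hEps H) \<and>
    (\<forall>A B C. hMu H (S.tO A B, C) \<Zcomp>\<^bsub>W\<^esub> T.tV (hMu H (A, B)) (Idn W (f0 C)) \<Zcomp>\<^bsub>W\<^esub> T.a (f0 A) (f0 B) (f0 C)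
      = fV (S.a A B C) \<Zcomp>\<^bsub>W\<^esub> hMu H (A, S.tO B C) \<Zcomp>\<^bsub>W\<^esub> T.tV (Idn W (f0 A)) (hMu H (B, C))) \<and>
    (\<forall>A. fV (sL S ((), A)) = hMu H (S.I, A) \<Zcomp>\<^bsub>W\<^esub> T.tV (inv_arrow W (hEps H ())) (Idn W (f0 A)) \<Zcomp>\<^bsub>W\<^esub> sL T ((), f0 A)) \<and>
    (\<forall>A. fV (sR S (A, ())) = hMu H (A, S.I) \<Zcomp>\<^bsub>W\<^esub> T.tV (Idn W (f0 A)) (inv_arrow W (hEps H ())) \<Zcomp>\<^bsub>W\<^esub> sR T (f0 A, ()))"
  unfolding pseudomonoid_hom_def Let_def
  by (simp add: hF_hom mod_vcomp_def whisker_L_def whisker_R_def mod_tensor_def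
      mod_id_def mod_inv_def fun_eq_iff split_paired_All)

text \<open>Both notions orient \<mu> and \<epsilon> alike and state the unit laws with the inverse
  of \<epsilon>, so the clauses match once the 2-cells are unfolded.\<close>

lemma pseudomonoid_hom_iff_effectful_functor:
  assumes "pseudomonoid P S" "pseudomonoid Q T"
  shows "pseudomonoid_hom P S Q T H \<longleftrightarrow> effectful_functor (Kleisli_functor P) (eff_of_pseudo P S)
    (Kleisli_functor Q) (eff_of_pseudo Q T) (eff_fctr_of_pseudo_hom H)"
proof -
  have E: "effectful (Kleisli_functor P) (eff_of_pseudo P S)" "effectful (Kleisli_functor Q) (eff_of_pseudo Q T)"
    using assms S.effectful_if_pseudomonoid T.effectful_if_pseudomonoid by auto
  then have M: "monoidal S.V (eMon (eff_of_pseudo P S))" "monoidal W (eMon (eff_of_pseudo Q T))"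
    by (simp_all add: effectful_def Kleisli_functor_def)
  have K: "is_functor S.K L \<lparr>FO = f0, FA = fK\<rparr>"
    using F.E.is_functor by (simp add: Kleisli_fctr_def)
  show ?thesis
    unfolding pseudomonoid_hom_iff invertible_mu_iff invertible_eps_iff effectful_functor_def strong_monoidal_def
    unfolding Ball_Hom
    by (auto simp: assms E[unfolded Kleisli_functor_def] M K eff_fctr_of_pseudo_hom_def Kleisli_functor_def F.B.is_functor Hom_iff
        S.pL_eff S.pR_eff T.pL_eff T.pR_eff)
qed

end

lemma tensor_hom_dataI: "\<lbrakk>pseudomonoid P S; pseudomonoid Q T; promonad_hom P Q (hF H)\<rbrakk> \<Longrightarrow> tensor_hom_data P S Q T H"
  by (simp add: tensor_hom_data_def tensor_hom_data_axioms_def tensor_dataI)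

lemma bij_betw_eff_fctr_of_pseudo_hom:
  assumes S: "pseudomonoid P S" and T: "pseudomonoid Q T"
  shows "bij_betw eff_fctr_of_pseudo_hom {H. pseudomonoid_hom P S Q T H}
    {H. effectful_functor (Kleisli_functor P) (eff_of_pseudo P S) (Kleisli_functor Q) (eff_of_pseudo Q T) H}"
    (is "bij_betw _ ?A ?B")
proof (rule bij_betw_imageI)
  have hom: "promonad_hom P Q (hF H)" if "pseudomonoid_hom P S Q T H" for H
    using that by (simp add: pseudomonoid_hom_def Let_def)
  show "inj_on eff_fctr_of_pseudo_hom ?A"
  proof (rule inj_onI)
    fix H H' assume H: "H \<in> ?A" "H' \<in> ?A" and eq: "eff_fctr_of_pseudo_hom H = eff_fctr_of_pseudo_hom H'"
    \<comment> \<open>Source and target are fields that \<open>eff_fctr_of_pseudo_hom\<close>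
      forgets; membership in \<open>?A\<close> fixes them to be \<open>P\<close> and
      \<open>Q\<close>.\<close>
    then have "PSrc (hF H) = PSrc (hF H')" "PTgt (hF H) = PTgt (hF H')"
      using hom[of H] hom[of H'] by (simp_all add: promonad_hom_def)
    with eq show "H = H'"
      by (intro pseudo_hom.equality phom.equality) (auto simp: eff_fctr_of_pseudo_hom_def fun_eq_iff)
  qed
  show "eff_fctr_of_pseudo_hom ` ?A = ?B"
  proof (intro equalityI subsetI)
    fix G assume "G \<in> eff_fctr_of_pseudo_hom ` ?A"
    then show "G \<in> ?B"
      using tensor_hom_data.pseudomonoid_hom_iff_effectful_functor[OF tensor_hom_dataI[OF S T hom] S T] by auto
  next
    fix G assume G: "G \<in> ?B"
    \<comment> \<open>One homomorphism packs both functors; its object map is that of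
      \<open>eF0 G\<close>, which an effectful functor shares with \<open>eF G\<close>.
      \<open>hEps\<close> is constant as the unit promonad has one object.\<close>
    define H where "H = \<lparr>hF = \<lparr>PSrc = P, PTgt = Q, BF = eF0 G, EF = FA (eF G)\<rparr>,
      hMu = (\<lambda>(A, B). eMu G A B), hEps = (\<lambda>_. eEps G)\<rparr>"
    have GH: "eff_fctr_of_pseudo_hom H = G"
      using G by (intro eff_fctr.equality fctr.equality) (auto simp: eff_fctr_of_pseudo_hom_def H_def effectful_functor_def)
    interpret P: promonad P using S by (simp add: pseudomonoid_def Let_def)
    interpret Q: promonad Q using T by (simp add: pseudomonoid_def Let_def)
    have "eF G = \<lparr>FO = FO (eF0 G), FA = FA (eF G)\<rparr>"
      using G by (intro fctr.equality) (auto simp: effectful_functor_def)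
    moreover have "is_functor (Kleisli P) (Kleisli Q) (eF G)"
      using G by (simp add: effectful_functor_def Kleisli_functor_def)
    ultimately have "is_functor (Kleisli P) (Kleisli Q) \<lparr>FO = FO (eF0 G), FA = FA (eF G)\<rparr>"
      by metis
    moreover interpret B: cat_functor "Base P" "Base Q" "eF0 G"
      using G by (intro cat_functorI) (simp add: effectful_functor_def Kleisli_functor_def)
    have "FA (eF G) (Unit P v) = Unit Q (FA (eF0 G) v)" if "v \<in> Arr (Base P)" for v
      using G that by (auto simp: effectful_functor_def Kleisli_functor_def)
    ultimately have "promonad_hom P Q (hF H)"
      using G by (simp add: promonad_hom_iff H_def Kleisli_fctr_def P.promonad_axioms Q.promonad_axioms
          effectful_functor_def Kleisli_functor_def)
    then interpret tensor_hom_data P S Q T H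
      by (rule tensor_hom_dataI[OF S T])
    show "G \<in> eff_fctr_of_pseudo_hom ` ?A"
      using pseudomonoid_hom_iff_effectful_functor[OF S T] G GH by (metis imageI mem_Collect_eq)
  qed
qed

section \<open>The centre of a premonoidal category\<close>

sublocale binoidal \<subseteq> cat: category C
  using functor_L by (auto simp: is_functor_def)
sublocale binoidal \<subseteq> L: cat_functor C C "\<lparr>FO = (\<lambda>Y. X \<odot> Y), FA = (\<lambda>f. X \<ltimes> f)\<rparr>" for X
  using functor_L by (rule cat_functorI)
sublocale binoidal \<subseteq> R: cat_functor C C "\<lparr>FO = (\<lambda>X. X \<odot> Y), FA = (\<lambda>f. f \<rtimes> Y)\<rparr>" for Y
  using functor_R by (rule cat_functorI)

text \<open>Composition with an isomorphism is injective. This moves the test of an interchange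
  square from one bracketing to the other.\<close>

lemma (in category) natural_eq_iff:
  assumes "iso_arrow C s" "iso_arrow C t" "p \<in> Arr C" "q \<in> Arr C" "p' \<in> Arr C" "q' \<in> Arr C"
    "Cod C p = Dom C t" "Cod C q = Dom C t" "Dom C p' = Cod C s" "Dom C q' = Cod C s"
    "p \<Zcomp> t = s \<Zcomp> p'" "q \<Zcomp> t = s \<Zcomp> q'"
  shows "p = q \<longleftrightarrow> p' = q'"
proof
  assume "p = q"
  have "p' = inv_arrow C s \<Zcomp> (s \<Zcomp> p')" "q' = inv_arrow C s \<Zcomp> (s \<Zcomp> q')"
    using assms by (simp_all add: iso_cancel)
  with \<open>p = q\<close> show "p' = q'"
    using assms(11,12) by simp
next
  assume "p' = q'"
  have "p = (p \<Zcomp> t) \<Zcomp> inv_arrow C t" "q = (q \<Zcomp> t) \<Zcomp> inv_arrow C t"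
    using assms(1-10) by (simp_all add: assoc iso_arrow_Arr)
  with \<open>p' = q'\<close> show "p = q"
    using assms(11,12) by simp
qed

section \<open>Closure properties of central arrows\<close>

context binoidal
begin

lemma ltr_simps [simp]:
  assumes "f \<in> Arr C"
  shows "X \<ltimes> f \<in> Arr C" "Dom C (X \<ltimes> f) = X \<odot> Dom C f" "Cod C (X \<ltimes> f) = X \<odot> Cod C f"
    "f \<rtimes> X \<in> Arr C" "Dom C (f \<rtimes> X) = Dom C f \<odot> X" "Cod C (f \<rtimes> X) = Cod C f \<odot> X"
  using L.FA_simps[OF assms, of X] R.FA_simps[OF assms, of X] by simp_all

lemma ltr_Idn [simp]: "X \<ltimes> Idn C Y = Idn C (X \<odot> Y)" "Idn C X \<rtimes> Y = Idn C (X \<odot> Y)"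
  using L.FA_Idn[of X Y] R.FA_Idn[of Y X] by simp_all

lemma ltr_Comp:
  assumes "f \<in> Arr C" "g \<in> Arr C" "Cod C f = Dom C g"
  shows "X \<ltimes> (f \<Zcomp> g) = (X \<ltimes> f) \<Zcomp> (X \<ltimes> g)" "(f \<Zcomp> g) \<rtimes> X = (f \<rtimes> X) \<Zcomp> (g \<rtimes> X)"
  using L.FA_Comp[OF assms, of X] R.FA_Comp[OF assms, of X] by simp_all

lemma central_Arr: "central f \<Longrightarrow> f \<in> Arr C"
  by (simp add: central_def)

lemma centralD:
  assumes "central f" "g \<in> Arr C"
  shows "(f \<rtimes> Dom C g) \<Zcomp> (Cod C f \<ltimes> g) = (Dom C f \<ltimes> g) \<Zcomp> (f \<rtimes> Cod C g)"
    "(Dom C g \<ltimes> f) \<Zcomp> (g \<rtimes> Cod C f) = (g \<rtimes> Dom C f) \<Zcomp> (Cod C g \<ltimes> f)"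
  using assms by (simp_all add: central_def)

lemma central_Idn: "central (Idn C X)"
  by (simp add: central_def)

text \<open>Whiskerings preserve composites, and the interchange squares of the two factors paste
  along the whiskering of \<open>g\<close> by the middle object.\<close>

lemma central_Comp:
  assumes f: "central f" and f': "central f'" and eq: "Cod C f = Dom C f'"
  shows "central (f \<Zcomp> f')"
  unfolding central_def
proof (intro conjI ballI)
  note A = central_Arr[OF f] central_Arr[OF f'] eq
  fix g assume g: "g \<in> Arr C"
  have "((f \<rtimes> Dom C g) \<Zcomp> (f' \<rtimes> Dom C g)) \<Zcomp> (Cod C f' \<ltimes> g) = (Dom C f \<ltimes> g) \<Zcomp> ((f \<rtimes> Cod C g) \<Zcomp> (f' \<rtimes> Cod C g))"
    using A g centralD(1)[OF f g] centralD(1)[OF f' g]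
    by (intro cat.natural_Comp[where t = "Cod C f \<ltimes> g"]) (auto simp: Hom_iff)
  then show "((f \<Zcomp> f') \<rtimes> Dom C g) \<Zcomp> (Cod C (f \<Zcomp> f') \<ltimes> g) = (Dom C (f \<Zcomp> f') \<ltimes> g) \<Zcomp> ((f \<Zcomp> f') \<rtimes> Cod C g)"
    using A by (simp add: ltr_Comp)
  have "((Dom C g \<ltimes> f) \<Zcomp> (Dom C g \<ltimes> f')) \<Zcomp> (g \<rtimes> Cod C f') = (g \<rtimes> Dom C f) \<Zcomp> ((Cod C g \<ltimes> f) \<Zcomp> (Cod C g \<ltimes> f'))"
    using A g centralD(2)[OF f g] centralD(2)[OF f' g]
    by (intro cat.natural_Comp[where t = "g \<rtimes> Cod C f"]) (auto simp: Hom_iff)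
  then show "(Dom C g \<ltimes> (f \<Zcomp> f')) \<Zcomp> (g \<rtimes> Cod C (f \<Zcomp> f')) = (g \<rtimes> Dom C (f \<Zcomp> f')) \<Zcomp> (Cod C g \<ltimes> (f \<Zcomp> f'))"
    using A by (simp add: ltr_Comp)
qed (use f f' eq central_Arr in auto)

lemma ltr_iso:
  assumes "iso_arrow C f"
  shows "iso_arrow C (X \<ltimes> f)" "iso_arrow C (f \<rtimes> X)" "X \<ltimes> inv_arrow C f = inv_arrow C (X \<ltimes> f)"
    "inv_arrow C f \<rtimes> X = inv_arrow C (f \<rtimes> X)"
  using L.FA_iso[OF assms, of X] R.FA_iso[OF assms, of X] L.FA_inv[OF assms, of X] R.FA_inv[OF assms, of X]
  by simp_all

text \<open>Whiskerings preserve inverses, so the interchange squares of the inverse are those of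
  \<open>f\<close> turned around by \<open>natural_inv\<close>.\<close>

lemma central_inv:
  assumes f: "central f" and iso: "iso_arrow C f"
  shows "central (inv_arrow C f)"
  unfolding central_def
proof (intro conjI ballI)
  note A = central_Arr[OF f] iso ltr_iso[OF iso]
  fix g assume g: "g \<in> Arr C"
  have "(Cod C f \<ltimes> g) \<Zcomp> inv_arrow C (f \<rtimes> Cod C g) = inv_arrow C (f \<rtimes> Dom C g) \<Zcomp> (Dom C f \<ltimes> g)"
    using A g centralD(1)[OF f g] by (intro cat.natural_inv) auto
  then show "(inv_arrow C f \<rtimes> Dom C g) \<Zcomp> (Cod C (inv_arrow C f) \<ltimes> g) = (Dom C (inv_arrow C f) \<ltimes> g) \<Zcomp> (inv_arrow C f \<rtimes> Cod C g)"
    using A by simp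
  have "(g \<rtimes> Cod C f) \<Zcomp> inv_arrow C (Cod C g \<ltimes> f) = inv_arrow C (Dom C g \<ltimes> f) \<Zcomp> (g \<rtimes> Dom C f)"
    using A g centralD(2)[OF f g] by (intro cat.natural_inv) auto
  then show "(Dom C g \<ltimes> inv_arrow C f) \<Zcomp> (g \<rtimes> Cod C (inv_arrow C f)) = (g \<rtimes> Dom C (inv_arrow C f)) \<Zcomp> (Cod C g \<ltimes> inv_arrow C f)"
    using A by simp
qed (simp add: iso)

end

context premonoidal
begin

lemma pA_simps [simp]:
  "pA P X Y Z \<in> Arr C" "Dom C (pA P X Y Z) = (X \<odot> Y) \<odot> Z" "Cod C (pA P X Y Z) = X \<odot> (Y \<odot> Z)"
  using assoc_Hom[of X Y Z] by (simp_all add: Hom_iff)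

lemma assoc_nat:
  assumes "f \<in> Arr C"
  shows "((f \<rtimes> Y) \<rtimes> Z) \<Zcomp> pA P (Cod C f) Y Z = pA P (Dom C f) Y Z \<Zcomp> (f \<rtimes> (Y \<odot> Z))"
    "((X \<ltimes> f) \<rtimes> Z) \<Zcomp> pA P X (Cod C f) Z = pA P X (Dom C f) Z \<Zcomp> (X \<ltimes> (f \<rtimes> Z))"
    "((X \<odot> Y) \<ltimes> f) \<Zcomp> pA P X Y (Cod C f) = pA P X Y (Dom C f) \<Zcomp> (X \<ltimes> (Y \<ltimes> f))"
  using assoc_nat1 assoc_nat2 assoc_nat3 Arr_Hom[OF assms] by blast+

text \<open>
  Each interchange square for \<open>f \<rtimes> B\<close> or \<open>B \<ltimes> f\<close> is conjugate, along the associator, to an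
  interchange square for \<open>f\<close> or to the image of one.
\<close>

lemma central_ltr:
  assumes f: "central f"
  shows "central (f \<rtimes> B)" "central (B \<ltimes> f)"
proof -
  note A = central_Arr[OF f]
  let ?X = "Dom C f" and ?X' = "Cod C f"
  have 1: "((f \<rtimes> B) \<rtimes> Dom C g) \<Zcomp> ((?X' \<odot> B) \<ltimes> g) = ((?X \<odot> B) \<ltimes> g) \<Zcomp> ((f \<rtimes> B) \<rtimes> Cod C g)"
    "(Dom C g \<ltimes> (f \<rtimes> B)) \<Zcomp> (g \<rtimes> (?X' \<odot> B)) = (g \<rtimes> (?X \<odot> B)) \<Zcomp> (Cod C g \<ltimes> (f \<rtimes> B))"
    "((B \<ltimes> f) \<rtimes> Dom C g) \<Zcomp> ((B \<odot> ?X') \<ltimes> g) = ((B \<odot> ?X) \<ltimes> g) \<Zcomp> ((B \<ltimes> f) \<rtimes> Cod C g)"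
    "(Dom C g \<ltimes> (B \<ltimes> f)) \<Zcomp> (g \<rtimes> (B \<odot> ?X')) = (g \<rtimes> (B \<odot> ?X)) \<Zcomp> (Cod C g \<ltimes> (B \<ltimes> f))"
    if g: "g \<in> Arr C" for g
  proof -
    let ?Y = "Dom C g" and ?Y' = "Cod C g"
    have "(((f \<rtimes> B) \<rtimes> ?Y) \<Zcomp> ((?X' \<odot> B) \<ltimes> g)) \<Zcomp> pA P ?X' B ?Y' = pA P ?X B ?Y \<Zcomp> ((f \<rtimes> (B \<odot> ?Y)) \<Zcomp> (?X' \<ltimes> (B \<ltimes> g)))"
      using A g by (intro cat.natural_Comp[where t = "pA P ?X' B ?Y"]) (auto simp: Hom_iff assoc_nat)
    moreover have "(((?X \<odot> B) \<ltimes> g) \<Zcomp> ((f \<rtimes> B) \<rtimes> ?Y')) \<Zcomp> pA P ?X' B ?Y' = pA P ?X B ?Y \<Zcomp> ((?X \<ltimes> (B \<ltimes> g)) \<Zcomp> (f \<rtimes> (B \<odot> ?Y')))"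
      using A g by (intro cat.natural_Comp[where t = "pA P ?X B ?Y'"]) (auto simp: Hom_iff assoc_nat)
    \<comment> \<open>Centrality of \<open>f\<close> is tested against \<open>B \<ltimes> g\<close>.
      The fourth square likewise uses \<open>g \<rtimes> B\<close>, whereas the second and third are
      images of the square for \<open>f\<close> and \<open>g\<close> under whiskering by
      \<open>B\<close> on the right and on the left.\<close>
    moreover have "(f \<rtimes> (B \<odot> ?Y)) \<Zcomp> (?X' \<ltimes> (B \<ltimes> g)) = (?X \<ltimes> (B \<ltimes> g)) \<Zcomp> (f \<rtimes> (B \<odot> ?Y'))"
      using centralD(1)[OF f, of "B \<ltimes> g"] g by simp
    ultimately show "((f \<rtimes> B) \<rtimes> ?Y) \<Zcomp> ((?X' \<odot> B) \<ltimes> g) = ((?X \<odot> B) \<ltimes> g) \<Zcomp> ((f \<rtimes> B) \<rtimes> ?Y')"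
      using A g by (subst cat.natural_eq_iff[OF assoc_iso assoc_iso]) auto
    have "(((?Y \<ltimes> f) \<rtimes> B) \<Zcomp> ((g \<rtimes> ?X') \<rtimes> B)) \<Zcomp> pA P ?Y' ?X' B = pA P ?Y ?X B \<Zcomp> ((?Y \<ltimes> (f \<rtimes> B)) \<Zcomp> (g \<rtimes> (?X' \<odot> B)))"
      using A g by (intro cat.natural_Comp[where t = "pA P ?Y ?X' B"]) (auto simp: Hom_iff assoc_nat)
    moreover have "(((g \<rtimes> ?X) \<rtimes> B) \<Zcomp> ((?Y' \<ltimes> f) \<rtimes> B)) \<Zcomp> pA P ?Y' ?X' B = pA P ?Y ?X B \<Zcomp> ((g \<rtimes> (?X \<odot> B)) \<Zcomp> (?Y' \<ltimes> (f \<rtimes> B)))"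
      using A g by (intro cat.natural_Comp[where t = "pA P ?Y' ?X B"]) (auto simp: Hom_iff assoc_nat)
    moreover have "((?Y \<ltimes> f) \<rtimes> B) \<Zcomp> ((g \<rtimes> ?X') \<rtimes> B) = ((g \<rtimes> ?X) \<rtimes> B) \<Zcomp> ((?Y' \<ltimes> f) \<rtimes> B)"
      using centralD(2)[OF f g] A g by (simp flip: ltr_Comp)
    ultimately show "(?Y \<ltimes> (f \<rtimes> B)) \<Zcomp> (g \<rtimes> (?X' \<odot> B)) = (g \<rtimes> (?X \<odot> B)) \<Zcomp> (?Y' \<ltimes> (f \<rtimes> B))"
      using A g by (subst cat.natural_eq_iff[OF assoc_iso assoc_iso, symmetric]) auto
    have "(((B \<ltimes> f) \<rtimes> ?Y) \<Zcomp> ((B \<odot> ?X') \<ltimes> g)) \<Zcomp> pA P B ?X' ?Y' = pA P B ?X ?Y \<Zcomp> ((B \<ltimes> (f \<rtimes> ?Y)) \<Zcomp> (B \<ltimes> (?X' \<ltimes> g)))"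
      using A g by (intro cat.natural_Comp[where t = "pA P B ?X' ?Y"]) (auto simp: Hom_iff assoc_nat)
    moreover have "(((B \<odot> ?X) \<ltimes> g) \<Zcomp> ((B \<ltimes> f) \<rtimes> ?Y')) \<Zcomp> pA P B ?X' ?Y' = pA P B ?X ?Y \<Zcomp> ((B \<ltimes> (?X \<ltimes> g)) \<Zcomp> (B \<ltimes> (f \<rtimes> ?Y')))"
      using A g by (intro cat.natural_Comp[where t = "pA P B ?X ?Y'"]) (auto simp: Hom_iff assoc_nat)
    moreover have "(B \<ltimes> (f \<rtimes> ?Y)) \<Zcomp> (B \<ltimes> (?X' \<ltimes> g)) = (B \<ltimes> (?X \<ltimes> g)) \<Zcomp> (B \<ltimes> (f \<rtimes> ?Y'))"
      using centralD(1)[OF f g] A g by (simp flip: ltr_Comp)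
    ultimately show "((B \<ltimes> f) \<rtimes> ?Y) \<Zcomp> ((B \<odot> ?X') \<ltimes> g) = ((B \<odot> ?X) \<ltimes> g) \<Zcomp> ((B \<ltimes> f) \<rtimes> ?Y')"
      using A g by (subst cat.natural_eq_iff[OF assoc_iso assoc_iso]) auto
    have "(((?Y \<odot> B) \<ltimes> f) \<Zcomp> ((g \<rtimes> B) \<rtimes> ?X')) \<Zcomp> pA P ?Y' B ?X' = pA P ?Y B ?X \<Zcomp> ((?Y \<ltimes> (B \<ltimes> f)) \<Zcomp> (g \<rtimes> (B \<odot> ?X')))"
      using A g by (intro cat.natural_Comp[where t = "pA P ?Y B ?X'"]) (auto simp: Hom_iff assoc_nat)
    moreover have "(((g \<rtimes> B) \<rtimes> ?X) \<Zcomp> ((?Y' \<odot> B) \<ltimes> f)) \<Zcomp> pA P ?Y' B ?X' = pA P ?Y B ?X \<Zcomp> ((g \<rtimes> (B \<odot> ?X)) \<Zcomp> (?Y' \<ltimes> (B \<ltimes> f)))"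
      using A g by (intro cat.natural_Comp[where t = "pA P ?Y' B ?X"]) (auto simp: Hom_iff assoc_nat)
    moreover have "((?Y \<odot> B) \<ltimes> f) \<Zcomp> ((g \<rtimes> B) \<rtimes> ?X') = ((g \<rtimes> B) \<rtimes> ?X) \<Zcomp> ((?Y' \<odot> B) \<ltimes> f)"
      using centralD(2)[OF f, of "g \<rtimes> B"] g by simp
    ultimately show "(?Y \<ltimes> (B \<ltimes> f)) \<Zcomp> (g \<rtimes> (B \<odot> ?X')) = (g \<rtimes> (B \<odot> ?X)) \<Zcomp> (?Y' \<ltimes> (B \<ltimes> f))"
      using A g by (subst cat.natural_eq_iff[OF assoc_iso assoc_iso, symmetric]) auto
  qed
  show "central (f \<rtimes> B)" "central (B \<ltimes> f)"
    unfolding central_def using A 1 by auto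
qed

section \<open>The centre as a monoidal category\<close>

abbreviation "Z \<equiv> centre C P"

lemma centre_simps [simp]:
  "Arr Z = {f. central f}" "Dom Z = Dom C" "Cod Z = Cod C" "Idn Z = Idn C" "Comp Z = Comp C"
  by (simp_all add: centre_def)

lemma category_centre: "category Z"
  by unfold_locales (auto simp: Hom_iff central_Arr central_Idn central_Comp cat.assoc)

text \<open>A subcategory could lose inverses; centrality of the inverse keeps the structure
  isomorphisms invertible in the centre.\<close>

lemma centre_iso: "\<lbrakk>central f; iso_arrow C f\<rbrakk> \<Longrightarrow> iso_arrow Z f"
  using central_inv[of f] unfolding iso_arrow_def[of Z]
  by (intro exI[of _ "inv_arrow C f"]) (simp add: inverse_arrows_def Hom_iff)

lemma centre_Hom: "f \<in> Hom Z X Y \<longleftrightarrow> central f \<and> f \<in> Hom C X Y"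
  by (auto simp: Hom_iff central_Arr)

text \<open>Without joint functoriality a tensor of arrows needs an order: here the left factor acts
  first, and on central arrows the other order gives the same arrow.\<close>

definition centre_monoidal :: "('a, 'b) mon_str" where
  "centre_monoidal = \<lparr>mT = \<lparr>FO = (\<lambda>(A, B). A \<odot> B),
       FA = restrict (\<lambda>(f, g). (f \<rtimes> Dom C g) \<Zcomp> (Cod C f \<ltimes> g)) (Arr Z \<times> Arr Z)\<rparr>,
     mI = pI P, mA = pA P, mL = pLam P, mR = pRho P\<rparr>"

lemma centre_monoidal_simps [simp]:
  "FO (mT centre_monoidal) (A, B) = A \<odot> B"
  "\<lbrakk>central f; central g\<rbrakk> \<Longrightarrow> FA (mT centre_monoidal) (f, g) = (f \<rtimes> Dom C g) \<Zcomp> (Cod C f \<ltimes> g)"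
  "mI centre_monoidal = pI P" "mA centre_monoidal = pA P" "mL centre_monoidal = pLam P" "mR centre_monoidal = pRho P"
  by (simp_all add: centre_monoidal_def)

lemma monoidal_centre: "monoidal Z centre_monoidal"
proof unfold_locales
  show "is_functor (prod_cat Z Z) Z (mT centre_monoidal)"
    unfolding is_functor_iff
  proof (intro conjI ballI allI impI)
    fix p assume "p \<in> Arr (prod_cat Z Z)"
    then show "FA (mT centre_monoidal) p \<in> Hom Z (FO (mT centre_monoidal) (Dom (prod_cat Z Z) p)) (FO (mT centre_monoidal) (Cod (prod_cat Z Z) p))"
      by (auto simp: Hom_iff central_Arr intro!: central_Comp central_ltr)
  next
    fix p q assume "p \<in> Arr (prod_cat Z Z)" "q \<in> Arr (prod_cat Z Z)" "Cod (prod_cat Z Z) p = Dom (prod_cat Z Z) q"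
    then obtain f g f' g' where pq: "p = (f, g)" "q = (f', g')" and c: "central f" "central g" "central f'" "central g'"
      and e: "Cod C f = Dom C f'" "Cod C g = Dom C g'"
      by (cases p; cases q) auto
    note A = c[THEN central_Arr] e
    \<comment> \<open>Joint functoriality is where centrality enters: \<open>g\<close> has to pass
      \<open>f'\<close> before the factors can be regrouped.\<close>
    have "(f' \<rtimes> Dom C g) \<Zcomp> ((Cod C f' \<ltimes> g) \<Zcomp> (Cod C f' \<ltimes> g')) = (Dom C f' \<ltimes> g) \<Zcomp> ((f' \<rtimes> Cod C g) \<Zcomp> (Cod C f' \<ltimes> g'))"
      using A centralD(1)[of f' g] c by (intro cat.Comp_reassoc) auto
    then show "FA (mT centre_monoidal) (p \<Zcomp>\<^bsub>prod_cat Z Z\<^esub> q) = FA (mT centre_monoidal) p \<Zcomp>\<^bsub>Z\<^esub> FA (mT centre_monoidal) q"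
      using A c by (simp add: pq central_Comp ltr_Comp cat.assoc)
  qed (auto simp: category_prod_cat category_centre central_Idn, simp add: centre_monoidal_def)
next
  fix f A A' g B B' h D D'
  assume "f \<in> Hom Z A A'" "g \<in> Hom Z B B'" "h \<in> Hom Z D D'"
  then have c: "central f" "central g" "central h"
    and H: "f \<in> Hom C A A'" "g \<in> Hom C B B'" "h \<in> Hom C D D'"
    by (simp_all add: centre_Hom)
  \<comment> \<open>Joint naturality of the associator is pasted from its squares in single
    variables, through the intermediate components at \<open>A' B D\<close> and
    \<open>A' B' D\<close>.\<close>
  have "(((f \<rtimes> B) \<rtimes> D) \<Zcomp> ((A' \<ltimes> g) \<rtimes> D)) \<Zcomp> pA P A' B' D = pA P A B D \<Zcomp> ((f \<rtimes> (B \<odot> D)) \<Zcomp> (A' \<ltimes> (g \<rtimes> D)))"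
    using H assoc_nat1[OF H(1)] assoc_nat2[OF H(2)]
    by (intro cat.natural_Comp[where t = "pA P A' B D"]) (auto simp: Hom_iff)
  then have "((((f \<rtimes> B) \<rtimes> D) \<Zcomp> ((A' \<ltimes> g) \<rtimes> D)) \<Zcomp> ((A' \<odot> B') \<ltimes> h)) \<Zcomp> pA P A' B' D'
      = pA P A B D \<Zcomp> (((f \<rtimes> (B \<odot> D)) \<Zcomp> (A' \<ltimes> (g \<rtimes> D))) \<Zcomp> (A' \<ltimes> (B' \<ltimes> h)))"
    using H assoc_nat3[OF H(3)]
    by - (rule cat.natural_Comp[where t = "pA P A' B' D"], auto simp: Hom_iff)
  then show "FA (mT centre_monoidal) (FA (mT centre_monoidal) (f, g), h) \<Zcomp>\<^bsub>Z\<^esub> mA centre_monoidal A' B' D'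
      = mA centre_monoidal A B D \<Zcomp>\<^bsub>Z\<^esub> FA (mT centre_monoidal) (f, FA (mT centre_monoidal) (g, h))"
    using H c by (simp add: Hom_iff central_Comp central_ltr ltr_Comp cat.assoc)
next
  fix f A A' assume "f \<in> Hom Z A A'"
  then have c: "central f" and H: "f \<in> Hom C A A'"
    by (simp_all add: centre_Hom)
  show "FA (mT centre_monoidal) (Idn Z (mI centre_monoidal), f) \<Zcomp>\<^bsub>Z\<^esub> mL centre_monoidal A' = mL centre_monoidal A \<Zcomp>\<^bsub>Z\<^esub> f"
    "FA (mT centre_monoidal) (f, Idn Z (mI centre_monoidal)) \<Zcomp>\<^bsub>Z\<^esub> mR centre_monoidal A' = mR centre_monoidal A \<Zcomp>\<^bsub>Z\<^esub> f"
    using lunit_nat[OF H] runit_nat[OF H] c H by (simp_all add: central_Idn Hom_iff)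
next
  show "FA (mT centre_monoidal) (mA centre_monoidal A B D, Idn Z X) \<Zcomp>\<^bsub>Z\<^esub>
      mA centre_monoidal A (FO (mT centre_monoidal) (B, D)) X \<Zcomp>\<^bsub>Z\<^esub>
      FA (mT centre_monoidal) (Idn Z A, mA centre_monoidal B D X)
    = mA centre_monoidal (FO (mT centre_monoidal) (A, B)) D X \<Zcomp>\<^bsub>Z\<^esub> mA centre_monoidal A B (FO (mT centre_monoidal) (D, X))" for A B D X
    using pentagon[of X A B D] by (simp add: central_Idn assoc_central)
  show "mA centre_monoidal A (mI centre_monoidal) B \<Zcomp>\<^bsub>Z\<^esub> FA (mT centre_monoidal) (Idn Z A, mL centre_monoidal B)
      = FA (mT centre_monoidal) (mR centre_monoidal A, Idn Z B)" for A B
    using triangle[of A B] lunit_Hom[of B] runit_Hom[of A]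
    by (simp add: central_Idn lunit_central runit_central Hom_iff)
qed (auto simp: centre_Hom centre_iso assoc_central lunit_central runit_central assoc_iso lunit_iso runit_iso
    assoc_Hom lunit_Hom runit_Hom)

lemma id_on_obj_functor_centre: "id_on_obj_functor (centre_inclusion C P)"
  by (auto simp: id_on_obj_functor_def centre_inclusion_def is_functor_iff category_centre cat.category_axioms
      Hom_iff central_Arr central_Idn central_Comp)

text \<open>Tensoring with an identity makes one of the two composed factors an identity, so the
  whiskerings are preserved strictly; the remaining structure is shared by the centre and
  \<open>C\<close>.\<close>

lemma effectful_centre: "effectful (centre_inclusion C P) \<lparr>eMon = centre_monoidal, ePre = P\<rparr>"
  unfolding effectful_def
  using id_on_obj_functor_centre monoidal_centre premonoidal_axioms
  by (auto simp: centre_inclusion_def central_Idn central_Arr central_ltr central_Comp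
      assoc_central lunit_central runit_central)

end

theorem theorem5p3:
  fixes J :: "('o, 'v, 'c) id_on_obj"
    and P :: "('o, 'v, 'c) promonad" and Q :: "('q, 'w, 'd) promonad"
    and C :: "('x, 'a) cat" and M :: "('x, 'a) pre_str"
  shows "(id_on_obj_functor J \<longrightarrow> promonad (promonad_of J) \<and> Kleisli_functor (promonad_of J) = J)
    \<and> (promonad P \<longrightarrow>
        bij_betw (eff_of_pseudo P) {S. pseudomonoid P S} {E. effectful (Kleisli_functor P) E})
    \<and> (\<forall>S T. pseudomonoid P S \<and> pseudomonoid Q T \<longrightarrow>
        bij_betw eff_fctr_of_pseudo_hom
          {H. pseudomonoid_hom P S Q T H}
          {H. effectful_functor (Kleisli_functor P) (eff_of_pseudo P S)
                (Kleisli_functor Q) (eff_of_pseudo Q T) H})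
    \<and> (premonoidal C M \<longrightarrow>
        (\<exists>S. pseudomonoid (promonad_of (centre_inclusion C M)) S
            \<and> ePre (eff_of_pseudo (promonad_of (centre_inclusion C M)) S) = M))"
proof (intro conjI impI allI)
  show "promonad (promonad_of J)" "Kleisli_functor (promonad_of J) = J" if "id_on_obj_functor J"
    using that by (rule promonad_promonad_of, rule Kleisli_functor_promonad_of)
  show "bij_betw (eff_of_pseudo P) {S. pseudomonoid P S} {E. effectful (Kleisli_functor P) E}" if "promonad P"
    using that by (rule bij_betw_eff_of_pseudo)
  show "bij_betw eff_fctr_of_pseudo_hom {H. pseudomonoid_hom P S Q T H}
      {H. effectful_functor (Kleisli_functor P) (eff_of_pseudo P S) (Kleisli_functor Q) (eff_of_pseudo Q T) H}"
    if "pseudomonoid P S \<and> pseudomonoid Q T" for S T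
    using that by (simp add: bij_betw_eff_fctr_of_pseudo_hom)
  assume "premonoidal C M"
  then interpret premonoidal C M .
  let ?R = "promonad_of (centre_inclusion C M)"
  \<comment> \<open>The Kleisli category of \<open>?R\<close> is \<open>C\<close> itself, so the
    effectful structure of the centre lives on it; \<open>pseudo_of_eff\<close> is the witness, and
    the round trip returns \<open>M\<close> as its premonoidal half.\<close>
  interpret effectful_promonad ?R "\<lparr>eMon = centre_monoidal, ePre = M\<rparr>"
    using effectful_centre id_on_obj_functor_centre
    by (intro effectful_promonadI) (simp_all add: promonad_promonad_of Kleisli_functor_promonad_of)
  show "\<exists>S. pseudomonoid ?R S \<and> ePre (eff_of_pseudo ?R S) = M"
    using pseudomonoid_pseudo_of_eff eff_of_pseudo_of_eff by (metis eff_str.select_convs(2))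
qed

end
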